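(* Let $L/k$ be a finite Galois extension of fields and set $X=\mathrm{Spec}(L)$. Let $K$ be an algebraically closed field containing $L$ and let $U=\mathrm{Spec}(K)$. Then, for any integer $n\ge 0$, the canonical map of sets $$\vartheta^n_X(U):(\mathrm{Sym}^nh_X)(U)\to(\mathrm{Sym}^n_gh_X)(U)$$ is an isomorphism (i.e. a bijection).
   Context: Schemes and morphisms are over $k$. $h_X$ is the functor represented by $X$. $\mathrm{Sym}^nh_X=(h_X)^{\times n}/\Sigma_n$ is the categoric symmetric power, so $(\mathrm{Sym}^nh_X)(U)=\mathrm{Hom}_k(U,X)^n/\Sigma_n=\mathrm{Hom}_k(L,K)^n/\Sigma_n$ (sets of $k$-algebra homomorphisms). $\mathrm{Sym}^n_gh_X=h_{\mathrm{Sym}^nX}$ is the geometric symmetric power, where $\mathrm{Sym}^nX=X^n/\Sigma_n=\mathrm{Spec}\big((L^{\otimes_kn})^{\Sigma_n}\big)$, so $(\mathrm{Sym}^n_gh_X)(U)=\mathrm{Hom}_k\big((L^{\otimes_kn})^{\Sigma_n},K\big)$. The map $\vartheta^n_X(U)$ sends the class of $(f_1,\dots,f_n)$ to the restriction to $(L^{\otimes_kn})^{\Sigma_n}$ of $f_1\otimes\cdots\otimes f_n:L^{\otimes_kn}\to K$, $a_1\otimes\cdots\otimes a_n\mapsto f_1(a_1)\cdots f_n(a_n)$. *)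

theory Defs
  imports "HOL-Algebra.Algebra"
begin

section \<open>Finite Galois extensions\<close>

text \<open>
  A finite Galois extension \<open>L/k\<close> is a finite extension that is normal and separable: the minimal
  polynomial over \<open>k\<close> of every element of \<open>L\<close> splits over \<open>L\<close>, and its roots are simple.
  As all roots already lie in \<open>L\<close>, it suffices to consider multiplicities of roots in \<open>L\<close>.
\<close>

locale finite_galois_extension = field L + subfield k L for k and L (structure) +
  assumes finite_extension: "finite_dimension k (carrier L)"
    and normal: "x \<in> carrier L \<Longrightarrow> splitted (Irr k x)"
    and separable: "\<lbrakk> x \<in> carrier L; a \<in># roots (Irr k x) \<rbrakk> \<Longrightarrow> alg_mult (Irr k x) a = 1"


section \<open>Tensor powers of an algebra over a subfield\<close>

definition tuples :: "('a, 'm) ring_scheme \<Rightarrow> nat \<Rightarrow> (nat \<Rightarrow> 'a) set"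
  where "tuples L n = {1..n} \<rightarrow>\<^sub>E carrier L"

definition tuple_mult ::
    "('a, 'm) ring_scheme \<Rightarrow> nat \<Rightarrow> (nat \<Rightarrow> 'a) \<Rightarrow> (nat \<Rightarrow> 'a) \<Rightarrow> (nat \<Rightarrow> 'a)"
  where "tuple_mult L n x y = (\<lambda>i\<in>{1..n}. x i \<otimes>\<^bsub>L\<^esub> y i)"

definition tuple_one :: "('a, 'm) ring_scheme \<Rightarrow> nat \<Rightarrow> (nat \<Rightarrow> 'a)"
  where "tuple_one L n = (\<lambda>i\<in>{1..n}. \<one>\<^bsub>L\<^esub>)"

definition supp :: "('a, 'm) ring_scheme \<Rightarrow> ('t \<Rightarrow> 'a) \<Rightarrow> 't set"
  where "supp L c = {x. c x \<noteq> \<zero>\<^bsub>L\<^esub>}"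

text \<open>
  The free \<open>k\<close>-module on the set \<open>L\<^sup>n\<close>, whose elements are finitely supported coefficient functions,
  with the product that extends the componentwise product of tuples bilinearly.
\<close>

definition tuple_algebra ::
    "'a set \<Rightarrow> ('a, 'm) ring_scheme \<Rightarrow> nat \<Rightarrow> ((nat \<Rightarrow> 'a) \<Rightarrow> 'a) ring"
  where "tuple_algebra k L n =
    \<lparr> carrier = {c. range c \<subseteq> k \<and> finite (supp L c) \<and> supp L c \<subseteq> tuples L n},
      monoid.mult = (\<lambda>c d z. \<Oplus>\<^bsub>L\<^esub>x \<in> supp L c. \<Oplus>\<^bsub>L\<^esub>y \<in> {y \<in> supp L d. tuple_mult L n x y = z}.
                        c x \<otimes>\<^bsub>L\<^esub> d y),
      one = (\<lambda>z. if z = tuple_one L n then \<one>\<^bsub>L\<^esub> else \<zero>\<^bsub>L\<^esub>),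
      ring.zero = (\<lambda>z. \<zero>\<^bsub>L\<^esub>),
      add = (\<lambda>c d z. c z \<oplus>\<^bsub>L\<^esub> d z) \<rparr>"

definition single :: "('a, 'm) ring_scheme \<Rightarrow> 'a \<Rightarrow> 't \<Rightarrow> ('t \<Rightarrow> 'a)"
  where "single L a x = (\<lambda>z. if z = x then a else \<zero>\<^bsub>L\<^esub>)"

definition multilinear_relations ::
    "'a set \<Rightarrow> ('a, 'm) ring_scheme \<Rightarrow> nat \<Rightarrow> ((nat \<Rightarrow> 'a) \<Rightarrow> 'a) set"
  where "multilinear_relations k L n =
    {single L \<one>\<^bsub>L\<^esub> (x(i := a \<oplus>\<^bsub>L\<^esub> b))
        \<ominus>\<^bsub>tuple_algebra k L n\<^esub> (single L \<one>\<^bsub>L\<^esub> (x(i := a)) \<oplus>\<^bsub>tuple_algebra k L n\<^esub> single L \<one>\<^bsub>L\<^esub> (x(i := b)))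
      | x i a b. x \<in> tuples L n \<and> i \<in> {1..n} \<and> a \<in> carrier L \<and> b \<in> carrier L}
    \<union> {single L \<one>\<^bsub>L\<^esub> (x(i := c \<otimes>\<^bsub>L\<^esub> a)) \<ominus>\<^bsub>tuple_algebra k L n\<^esub> single L c (x(i := a))
      | x i a c. x \<in> tuples L n \<and> i \<in> {1..n} \<and> a \<in> carrier L \<and> c \<in> k}"

text \<open>
  The tensor power \<open>L \<otimes>\<^sub>k \<dots> \<otimes>\<^sub>k L\<close> is the free module on \<open>L\<^sup>n\<close> modulo the multilinearity relations.
  The product of a tuple and a relation is again a relation, so the \<open>k\<close>-submodule generated
  by the relations is an ideal, and the quotient below is the usual tensor product, with its usual
  product.  For \<open>n = 0\<close> it is \<open>k\<close>.
\<close>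

definition tensor_ideal :: "'a set \<Rightarrow> ('a, 'm) ring_scheme \<Rightarrow> nat \<Rightarrow> ((nat \<Rightarrow> 'a) \<Rightarrow> 'a) set"
  where "tensor_ideal k L n = Idl\<^bsub>tuple_algebra k L n\<^esub> (multilinear_relations k L n)"

definition tensor_power ::
    "'a set \<Rightarrow> ('a, 'm) ring_scheme \<Rightarrow> nat \<Rightarrow> ((nat \<Rightarrow> 'a) \<Rightarrow> 'a) set ring"
  where "tensor_power k L n = tuple_algebra k L n Quot tensor_ideal k L n"

text \<open>The structure map \<open>k \<rightarrow> L \<otimes>\<^sub>k \<dots> \<otimes>\<^sub>k L\<close>.\<close>

definition tensor_scalar ::
    "'a set \<Rightarrow> ('a, 'm) ring_scheme \<Rightarrow> nat \<Rightarrow> 'a \<Rightarrow> ((nat \<Rightarrow> 'a) \<Rightarrow> 'a) set"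
  where "tensor_scalar k L n c =
    tensor_ideal k L n +>\<^bsub>tuple_algebra k L n\<^esub> single L c (tuple_one L n)"

text \<open>
  The action of permutations on the tensor power, induced by the one on coefficient functions that
  maps the basis element of the tuple \<open>y\<close> to the basis element of \<open>y \<circ> \<sigma>\<^sup>-\<^sup>1\<close>.
\<close>

definition tensor_act ::
    "(nat \<Rightarrow> nat) \<Rightarrow> ((nat \<Rightarrow> 'a) \<Rightarrow> 'a) set \<Rightarrow> ((nat \<Rightarrow> 'a) \<Rightarrow> 'a) set"
  where "tensor_act \<sigma> T = (\<lambda>c x. c (x \<circ> \<sigma>)) ` T"

definition symmetric_tensors ::
    "'a set \<Rightarrow> ('a, 'm) ring_scheme \<Rightarrow> nat \<Rightarrow> ((nat \<Rightarrow> 'a) \<Rightarrow> 'a) set ring"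
  where "symmetric_tensors k L n = (tensor_power k L n)
    \<lparr> carrier := {T \<in> carrier (tensor_power k L n).
                    \<forall>\<sigma> \<in> carrier (sym_group n). tensor_act \<sigma> T = T} \<rparr>"


section \<open>Symmetric powers on points\<close>

text \<open>
  A \<open>k\<close>-algebra is given by a ring and its structure map, here \<open>s\<close> for \<open>A\<close> and \<open>t\<close> for \<open>B\<close>.
  Homomorphisms are taken extensional, so that they are equal iff they agree on the carrier.
\<close>

definition alg_homs ::
    "'k set \<Rightarrow> ('a, 'm) ring_scheme \<Rightarrow> ('k \<Rightarrow> 'a) \<Rightarrow> ('b, 'p) ring_scheme \<Rightarrow> ('k \<Rightarrow> 'b) \<Rightarrow> ('a \<Rightarrow> 'b) set"
  where "alg_homs k A s B t =
    {f \<in> ring_hom A B \<inter> extensional (carrier A). \<forall>c \<in> k. f (s c) = t c}"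

text \<open>
  For \<open>X = Spec L\<close> and \<open>U = Spec K\<close>, with \<open>K\<close> a \<open>k\<close>-algebra via \<open>\<iota>\<close>, the following two sets are
  \<open>(Sym\<^sup>n h\<^sub>X)(U)\<close> and \<open>h\<^sub>Y(U)\<close> with \<open>Y = Sym\<^sup>n X\<close>.
\<close>

definition categoric_sym_power ::
    "'a set \<Rightarrow> ('a, 'm) ring_scheme \<Rightarrow> ('b, 'p) ring_scheme \<Rightarrow> ('a \<Rightarrow> 'b) \<Rightarrow> nat \<Rightarrow>
      (nat \<Rightarrow> 'a \<Rightarrow> 'b) set set"
  where "categoric_sym_power k L K \<iota> n =
    orbits (sym_group n) ({1..n} \<rightarrow>\<^sub>E alg_homs k L id K \<iota>) (\<lambda>\<sigma> f. f \<circ> inv' \<sigma>)"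

definition geometric_sym_power ::
    "'a set \<Rightarrow> ('a, 'm) ring_scheme \<Rightarrow> ('b, 'p) ring_scheme \<Rightarrow> ('a \<Rightarrow> 'b) \<Rightarrow> nat \<Rightarrow>
      (((nat \<Rightarrow> 'a) \<Rightarrow> 'a) set \<Rightarrow> 'b) set"
  where "geometric_sym_power k L K \<iota> n =
    alg_homs k (symmetric_tensors k L n) (tensor_scalar k L n) K \<iota>"

text \<open>
  The linear extension of \<open>a\<^sub>1 \<otimes> \<dots> \<otimes> a\<^sub>n \<mapsto> f\<^sub>1(a\<^sub>1) \<cdots> f\<^sub>n(a\<^sub>n)\<close>, first on the free module and then
  on the tensor power, where it is constant on each class.
\<close>

definition tuple_hom ::
    "('a, 'm) ring_scheme \<Rightarrow> ('b, 'p) ring_scheme \<Rightarrow> ('a \<Rightarrow> 'b) \<Rightarrow> nat \<Rightarrow> (nat \<Rightarrow> 'a \<Rightarrow> 'b) \<Rightarrow>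
      ((nat \<Rightarrow> 'a) \<Rightarrow> 'a) \<Rightarrow> 'b"
  where "tuple_hom L K \<iota> n f c =
    (\<Oplus>\<^bsub>K\<^esub>x \<in> supp L c. \<iota> (c x) \<otimes>\<^bsub>K\<^esub> (\<Otimes>\<^bsub>K\<^esub>i \<in> {1..n}. f i (x i)))"

definition tensor_hom ::
    "('a, 'm) ring_scheme \<Rightarrow> ('b, 'p) ring_scheme \<Rightarrow> ('a \<Rightarrow> 'b) \<Rightarrow> nat \<Rightarrow> (nat \<Rightarrow> 'a \<Rightarrow> 'b) \<Rightarrow>
      ((nat \<Rightarrow> 'a) \<Rightarrow> 'a) set \<Rightarrow> 'b"
  where "tensor_hom L K \<iota> n f T = the_elem (tuple_hom L K \<iota> n f ` T)"

text \<open>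
  The map \<open>\<vartheta>\<close> sends the class of \<open>(f\<^sub>1, \<dots>, f\<^sub>n)\<close> to the restriction of \<open>f\<^sub>1 \<otimes> \<dots> \<otimes> f\<^sub>n\<close> to the
  symmetric tensors, which does not depend on the representative.
\<close>

definition theta ::
    "'a set \<Rightarrow> ('a, 'm) ring_scheme \<Rightarrow> ('b, 'p) ring_scheme \<Rightarrow> ('a \<Rightarrow> 'b) \<Rightarrow> nat \<Rightarrow>
      (nat \<Rightarrow> 'a \<Rightarrow> 'b) set \<Rightarrow> (((nat \<Rightarrow> 'a) \<Rightarrow> 'a) set \<Rightarrow> 'b)"
  where "theta k L K \<iota> n F =
    the_elem ((\<lambda>f. restrict (tensor_hom L K \<iota> n f) (carrier (symmetric_tensors k L n))) ` F)"

end

theory Submission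
  imports Defs
begin

text \<open>
  Let \<open>H = Hom\<^sub>k(L, K)\<close>, let \<open>B\<close> be the \<open>n\<close>-th tensor power of \<open>L\<close>, and for \<open>f \<in> H\<^sup>n\<close> let
  \<open>\<phi>\<^sub>f: B \<rightarrow> K\<close> be the product of the \<open>f\<^sub>i\<close>.  As \<open>L/k\<close> is Galois, there are \<open>\<alpha>\<^sub>j, \<beta>\<^sub>j \<in> L\<close> such
  that \<open>\<Sum>\<^sub>j g(\<alpha>\<^sub>j) f(\<beta>\<^sub>j)\<close> is \<open>1\<close> for \<open>f = g\<close> and \<open>0\<close> for \<open>f \<noteq> g\<close> in \<open>H\<close>, and \<open>\<Sum>\<^sub>f f(y)\<close> (the trace) lies
  in \<open>k\<close> for all \<open>y \<in> L\<close>.  Hence \<open>x = \<Sum>\<^sub>j Tr(\<beta>\<^sub>j x) \<alpha>\<^sub>j\<close> in \<open>L\<close>, and each \<open>b \<in> B\<close> is a combination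
  of the products \<open>\<alpha>\<^sub>J\<close> of the \<open>\<alpha>\<^sub>j\<close>, with coefficients that are \<open>K\<close>-linear combinations of the \<open>\<phi>\<^sub>f(b)\<close>.

  If \<open>b\<close> is invariant under permutations, then so are the coefficients, and \<open>b\<close> is a combination of
  the orbit sums of the \<open>\<alpha>\<^sub>J\<close>.  So a homomorphism \<open>\<chi>\<close> from the invariants to \<open>K\<close> is a \<open>K\<close>-linear
  combination of the \<open>\<phi>\<^sub>f\<close>, and it is one of them by Dedekind's independence of characters.
  Conversely, combining orbit sums with coefficients built from the \<open>\<beta>\<^sub>j\<close> gives an element of the
  invariants over \<open>K\<close> on which \<open>\<phi>\<^sub>g\<close> is \<open>1\<close> if \<open>g\<close> is in the orbit of \<open>f\<close>, and \<open>0\<close> otherwise.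
\<close>

section \<open>Sums and products in commutative rings\<close>

text \<open>The \<open>\<alpha>_j\<close> are not claimed to be independent, so \<open>b\<close>
  alone does not determine its coefficients at the \<open>\<alpha>_J\<close>. One choice of them is
  given by a formula in the values \<open>\<phi> f b\<close>; the invariance of \<open>b\<close> is
  visible in these values, and as \<open>L\<close> embeds into \<open>K\<close> it passes to the
  coefficients in \<open>k\<close>. The \<open>\<alpha>_j\<close>, \<open>\<beta>_j\<close> come
  from the idempotent of \<open>L \<otimes>_k L\<close> that cuts out the diagonal, built as a
  product of functions on \<open>H\<close>, one for each point to be separated from the inclusion of
  \<open>L\<close>. The Galois hypothesis enters through two facts: all points take values in the
  image of \<open>L\<close>, and an element of \<open>L\<close> fixed by all points lies in
  \<open>k\<close>.\<close>

lemma (in comm_monoid) finprod_fibers: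
  assumes "finite A" and "g \<in> A \<rightarrow> carrier G"
  shows "(\<Otimes>x\<in>A. g x) = (\<Otimes>y\<in>h ` A. \<Otimes>x\<in>{x \<in> A. h x = y}. g x)"
proof -
  have "(\<Union>y\<in>h ` A. {x \<in> A. h x = y}) = A"
    by auto
  moreover have "finprod G g (\<Union>y\<in>h ` A. {x \<in> A. h x = y}) =
      (\<Otimes>y\<in>h ` A. \<Otimes>x\<in>{x \<in> A. h x = y}. g x)"
    using assms by (intro finprod_UN_disjoint) (auto simp: pairwise_def disjnt_def)
  ultimately show ?thesis
    by simp
qed

lemma (in comm_monoid) finprod_cartesian:
  assumes "finite A" "finite B" and "\<And>x y. x \<in> A \<Longrightarrow> y \<in> B \<Longrightarrow> g x y \<in> carrier G"
  shows "(\<Otimes>x\<in>A. \<Otimes>y\<in>B. g x y) = (\<Otimes>z\<in>A \<times> B. g (fst z) (snd z))"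
proof -
  have "(\<Otimes>z\<in>(\<Union>x\<in>A. Pair x ` B). g (fst z) (snd z)) = (\<Otimes>x\<in>A. \<Otimes>z\<in>Pair x ` B. g (fst z) (snd z))"
    using assms by (intro finprod_UN_disjoint) (auto simp: pairwise_def disjnt_def)
  also have "\<dots> = (\<Otimes>x\<in>A. \<Otimes>y\<in>B. g x y)"
    using assms by (intro finprod_cong' refl) (auto simp: finprod_reindex inj_on_def Pi_iff)
  finally show ?thesis
    by (simp add: Sigma_def UNION_singleton_eq_range)
qed

lemma (in comm_monoid) finprod_swap:
  assumes "finite A" "finite B" and "\<And>x y. x \<in> A \<Longrightarrow> y \<in> B \<Longrightarrow> g x y \<in> carrier G"
  shows "(\<Otimes>x\<in>A. \<Otimes>y\<in>B. g x y) = (\<Otimes>y\<in>B. \<Otimes>x\<in>A. g x y)"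
  using assms(1,3)
proof (induction A)
  case (insert a A)
  then have "(\<Otimes>x\<in>insert a A. \<Otimes>y\<in>B. g x y) = (\<Otimes>y\<in>B. g a y) \<otimes> (\<Otimes>x\<in>A. \<Otimes>y\<in>B. g x y)"
    by (subst finprod_insert) (auto intro!: finprod_closed)
  also have "\<dots> = (\<Otimes>y\<in>B. g a y \<otimes> (\<Otimes>x\<in>A. g x y))"
    using insert by (subst finprod_multf) (auto intro!: finprod_closed)
  also have "\<dots> = (\<Otimes>y\<in>B. \<Otimes>x\<in>insert a A. g x y)"
    using insert by (intro finprod_cong') (auto intro!: finprod_closed simp: Pi_iff)
  finally show ?case .
qed simp

context abelian_monoid
begin

lemmas finsum_fibers = add.finprod_fibers
lemmas finsum_cartesian = add.finprod_cartesian
lemmas finsum_swap = add.finprod_swap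
lemmas finsum_mono_neutral_right = add.finprod_mono_neutral_cong_right
lemmas finsum_mono_neutral_left = add.finprod_mono_neutral_cong_left

lemma finsum_eq_single:
  assumes "finite A" "a \<in> A" "f a \<in> carrier G" "\<And>x. x \<in> A \<Longrightarrow> x \<noteq> a \<Longrightarrow> f x = \<zero>"
  shows "(\<Oplus>x\<in>A. f x) = f a"
proof -
  have "(\<Oplus>x\<in>A. f x) = (\<Oplus>x\<in>{a}. f x)"
    using assms by (intro finsum_mono_neutral_right) fastforce+
  then show ?thesis
    using assms by simp
qed

end

text \<open>A choice function on \<open>insert i I\<close> is a value at \<open>i\<close> together
  with a choice function on \<open>I\<close>, which gives the induction step. With \<open>S\<close>
  the set of points, or the set of indices \<open>j\<close>, this turns an identity for one tensor
  factor into one for all factors.\<close>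

lemma (in cring) finprod_finsum:
  assumes "finite I" "finite S" and "\<And>i j. i \<in> I \<Longrightarrow> j \<in> S \<Longrightarrow> F i j \<in> carrier R"
  shows "(\<Otimes>i\<in>I. \<Oplus>j\<in>S. F i j) = (\<Oplus>J\<in>I \<rightarrow>\<^sub>E S. \<Otimes>i\<in>I. F i (J i))"
  using assms(1,3)
proof (induction I)
  case empty
  then show ?case by simp
next
  case (insert i I)
  let ?h = "\<lambda>(j, J). J(i := j)"
  have fin: "finite (I \<rightarrow>\<^sub>E S)"
    using insert assms by (intro finite_PiE) auto
  have F: "F i' j \<in> carrier R" if "j \<in> S" "i' \<in> insert i I" for i' j
    using insert that by auto
  have P: "(\<Otimes>i\<in>I. F i (J i)) \<in> carrier R" if "J \<in> I \<rightarrow>\<^sub>E S" for J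
    using that F by (intro finprod_closed) (auto dest: PiE_mem)
  have inj: "inj_on ?h (S \<times> (I \<rightarrow>\<^sub>E S))"
    using insert(2) inj_combinator[of i I "\<lambda>_. S"] by simp
  have "(\<Otimes>i\<in>insert i I. \<Oplus>j\<in>S. F i j) = (\<Oplus>j\<in>S. F i j) \<otimes> (\<Oplus>J\<in>I \<rightarrow>\<^sub>E S. \<Otimes>i\<in>I. F i (J i))"
    using insert F by (subst finprod_insert) (auto intro!: finsum_closed)
  also have "\<dots> = (\<Oplus>j\<in>S. F i j \<otimes> (\<Oplus>J\<in>I \<rightarrow>\<^sub>E S. \<Otimes>i\<in>I. F i (J i)))"
    using P F by (intro finsum_ldistr assms finsum_closed) auto
  also have "\<dots> = (\<Oplus>j\<in>S. \<Oplus>J\<in>I \<rightarrow>\<^sub>E S. F i j \<otimes> (\<Otimes>i\<in>I. F i (J i)))"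
    using P F fin by (intro finsum_cong' refl finsum_rdistr) auto
  also have "\<dots> = (\<Oplus>z\<in>S \<times> (I \<rightarrow>\<^sub>E S). F i (fst z) \<otimes> (\<Otimes>i\<in>I. F i (snd z i)))"
    using P F fin assms by (intro finsum_cartesian) auto
  also have "\<dots> = (\<Oplus>z\<in>S \<times> (I \<rightarrow>\<^sub>E S). \<Otimes>i'\<in>insert i I. F i' (?h z i'))"
  proof (intro finsum_cong' refl)
    fix z assume z: "z \<in> S \<times> (I \<rightarrow>\<^sub>E S)"
    then obtain j J where [simp]: "z = (j, J)" and jJ: "j \<in> S" "J \<in> I \<rightarrow>\<^sub>E S"
      by auto
    have "(\<Otimes>i'\<in>I. F i' ((J(i := j)) i')) = (\<Otimes>i'\<in>I. F i' (J i'))"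
      using insert(2) jJ F by (intro finprod_cong') (auto dest: PiE_mem)
    then show "F i (fst z) \<otimes> (\<Otimes>i\<in>I. F i (snd z i)) = (\<Otimes>i'\<in>insert i I. F i' (?h z i'))"
      using insert jJ F by (subst finprod_insert) (auto dest: PiE_mem)
  next
    show "(\<lambda>z. \<Otimes>i'\<in>insert i I. F i' (?h z i')) \<in> S \<times> (I \<rightarrow>\<^sub>E S) \<rightarrow> carrier R"
      using F by (intro funcsetI finprod_closed) (auto dest: PiE_mem)
  qed
  also have "\<dots> = (\<Oplus>J\<in>?h ` (S \<times> (I \<rightarrow>\<^sub>E S)). \<Otimes>i\<in>insert i I. F i (J i))"
  proof (rule finsum_reindex[OF _ inj, symmetric])
    show "(\<lambda>J. \<Otimes>i\<in>insert i I. F i (J i)) \<in> ?h ` (S \<times> (I \<rightarrow>\<^sub>E S)) \<rightarrow> carrier R"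
      using F by (intro funcsetI finprod_closed) (auto dest: PiE_mem)
  qed
  finally show ?case
    by (simp add: PiE_insert_eq)
qed

section \<open>Extension of homomorphisms to an algebraically closed field\<close>

text \<open>The homomorphism theorem without a quotient: \<open>eq\<close> says that
  \<open>e'\<close> is constant on the fibres of \<open>e\<close>, so any preimage chosen by
  \<open>inv_into\<close> gives the same value.\<close>

lemma ring_hom_through_image:
  assumes "ring P" and e: "e \<in> ring_hom P R" and e': "e' \<in> ring_hom P S"
    and eq: "\<And>p q. p \<in> carrier P \<Longrightarrow> q \<in> carrier P \<Longrightarrow> e p = e q \<Longrightarrow> e' p = e' q"
  obtains \<tau> where "\<tau> \<in> ring_hom (R\<lparr>carrier := e ` carrier P\<rparr>) S"
    and "\<And>p. p \<in> carrier P \<Longrightarrow> \<tau> (e p) = e' p"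
proof
  interpret P: ring P by fact
  let ?\<tau> = "\<lambda>u. e' (inv_into (carrier P) e u)"
  show \<tau>: "?\<tau> (e p) = e' p" if "p \<in> carrier P" for p
    by (intro eq inv_into_into f_inv_into_f) (use that in auto)
  show "?\<tau> \<in> ring_hom (R\<lparr>carrier := e ` carrier P\<rparr>) S"
  proof (rule ring_hom_memI)
    fix x y assume "x \<in> carrier (R\<lparr>carrier := e ` carrier P\<rparr>)" "y \<in> carrier (R\<lparr>carrier := e ` carrier P\<rparr>)"
    then obtain p q where pq: "p \<in> carrier P" "q \<in> carrier P" and [simp]: "x = e p" "y = e q"
      by auto
    show "?\<tau> x \<in> carrier S"
      using pq \<tau> ring_hom_closed[OF e'] by simp
    show "?\<tau> (x \<otimes>\<^bsub>R\<lparr>carrier := e ` carrier P\<rparr>\<^esub> y) = ?\<tau> x \<otimes>\<^bsub>S\<^esub> ?\<tau> y"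
      using pq \<tau>[of "p \<otimes>\<^bsub>P\<^esub> q"] \<tau>[of p] \<tau>[of q] ring_hom_mult[OF e'] ring_hom_mult[OF e] by simp
    show "?\<tau> (x \<oplus>\<^bsub>R\<lparr>carrier := e ` carrier P\<rparr>\<^esub> y) = ?\<tau> x \<oplus>\<^bsub>S\<^esub> ?\<tau> y"
      using pq \<tau>[of "p \<oplus>\<^bsub>P\<^esub> q"] \<tau>[of p] \<tau>[of q] ring_hom_add[OF e'] ring_hom_add[OF e] by simp
  next
    show "?\<tau> \<one>\<^bsub>R\<lparr>carrier := e ` carrier P\<rparr>\<^esub> = \<one>\<^bsub>S\<^esub>"
      using \<tau>[of "\<one>\<^bsub>P\<^esub>"] ring_hom_one[OF e'] ring_hom_one[OF e] by simp
  qed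
qed

lemma (in ring_hom_cring) eval_map_hom:
  assumes w: "w \<in> carrier S"
  shows "(\<lambda>p. S.eval (map h p) w) \<in> ring_hom (poly_ring R) S"
proof (rule ring_hom_memI)
  fix p q assume "p \<in> carrier (poly_ring R)" "q \<in> carrier (poly_ring R)"
  then have p: "set p \<subseteq> carrier R" and q: "set q \<subseteq> carrier R"
    by (auto simp: univ_poly_carrier[symmetric] polynomial_def)
  then have hp: "set (map h p) \<subseteq> carrier S" and hq: "set (map h q) \<subseteq> carrier S"
    by auto
  show "S.eval (map h p) w \<in> carrier S"
    using S.eval_in_carrier[OF hp w] .
  \<comment> \<open>\<open>h\<close> may send a leading coefficient to zero, so \<open>map h\<close>
    of a product need not be a normalized list; evaluation does not see leading zeros.\<close>
  have "S.eval (map h (R.poly_mult p q)) w = S.eval (S.normalize (map h (R.poly_mult p q))) w"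
    using R.poly_mult_in_carrier[OF p q] w by (intro S.eval_normalize[symmetric]) auto
  then show "S.eval (map h (p \<otimes>\<^bsub>poly_ring R\<^esub> q)) w = S.eval (map h p) w \<otimes>\<^bsub>S\<^esub> S.eval (map h q) w"
    by (simp add: univ_poly_mult ring.poly_mult_hom'[OF p q] S.eval_poly_mult[OF hp hq w])
  have "S.eval (map h (R.poly_add p q)) w = S.eval (S.normalize (map h (R.poly_add p q))) w"
    using R.poly_add_in_carrier[OF p q] w by (intro S.eval_normalize[symmetric]) auto
  then show "S.eval (map h (p \<oplus>\<^bsub>poly_ring R\<^esub> q)) w = S.eval (map h p) w \<oplus>\<^bsub>S\<^esub> S.eval (map h q) w"
    by (simp only: univ_poly_add ring.poly_add_hom'[OF p q] S.eval_poly_add[OF hp hq w])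
qed (use w in \<open>simp add: univ_poly_one\<close>)

text \<open>\<open>F(z)\<close> is the image of evaluation at \<open>z\<close>, and \<open>w\<close>
  gives a second evaluation of the same polynomials. Two polynomials with equal value at
  \<open>z\<close> differ by a multiple of the minimal polynomial of \<open>z\<close>, which the
  second evaluation kills.\<close>

lemma simple_extension_hom:
  assumes "field L" "field K" and F: "subfield F L"
    and \<sigma>: "\<sigma> \<in> ring_hom (L\<lparr>carrier := F\<rparr>) K"
    and z: "z \<in> carrier L" "(ring.algebraic L over F) z"
    and w: "w \<in> carrier K" "ring.eval K (map \<sigma> (ring.Irr L F z)) w = \<zero>\<^bsub>K\<^esub>"
  obtains \<tau> where "\<tau> \<in> ring_hom (L\<lparr>carrier := ring.simple_extension L F z\<rparr>) K"
    and "\<And>c. c \<in> F \<Longrightarrow> \<tau> c = \<sigma> c" and "\<tau> z = w"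
proof -
  interpret L: field L by fact
  interpret K: field K by fact
  have subring: "subring F L" and subset: "F \<subseteq> carrier L"
    using F subfieldE by auto
  interpret FL: field "L\<lparr>carrier := F\<rparr>"
    using L.subfield_iff(2)[OF F] .
  interpret \<sigma>: ring_hom_cring "L\<lparr>carrier := F\<rparr>" K \<sigma>
    by unfold_locales (rule \<sigma>)
  let ?P = "F[X]\<^bsub>L\<^esub>"
  let ?e = "\<lambda>p. L.eval p z" and ?e' = "\<lambda>p. K.eval (map \<sigma> p) w"
  interpret P: domain ?P
    using L.univ_poly_is_domain[OF subring] .
  have e: "?e \<in> ring_hom ?P L"
    using L.eval_is_hom[OF subring z(1)] .
  have e': "?e' \<in> ring_hom ?P K"
    using \<sigma>.eval_map_hom[OF w(1)] L.univ_poly_consistent[OF subring] by simp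
  interpret e: ring_hom_cring ?P L ?e by unfold_locales (rule e)
  interpret e': ring_hom_cring ?P K ?e' by unfold_locales (rule e')
  note Irr = L.IrrE[OF F z]
  have "?e' p = ?e' q" if pq: "p \<in> carrier ?P" "q \<in> carrier ?P" "?e p = ?e q" for p q
  proof -
    have "?e (p \<ominus>\<^bsub>?P\<^esub> q) = \<zero>\<^bsub>L\<^esub>"
      using pq e.hom_sub[OF pq(1,2)] by (simp add: L.r_right_minus_eq)
    then have "L.Irr F z divides\<^bsub>?P\<^esub> (p \<ominus>\<^bsub>?P\<^esub> q)"
      using L.Irr_minimal[OF F z] L.pdivides_iff_shell[OF F Irr(1)] pq by simp
    then obtain r where "r \<in> carrier ?P" "p \<ominus>\<^bsub>?P\<^esub> q = L.Irr F z \<otimes>\<^bsub>?P\<^esub> r"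
      by (auto elim: dividesE)
    then have "?e' (p \<ominus>\<^bsub>?P\<^esub> q) = \<zero>\<^bsub>K\<^esub>"
      using e'.hom_mult[OF Irr(1)] w(2) e'.hom_closed by simp
    then show ?thesis
      using pq e'.hom_sub[OF pq(1,2)] by (simp add: K.r_right_minus_eq)
  qed
  then obtain \<tau> where \<tau>: "\<tau> \<in> ring_hom (L\<lparr>carrier := ?e ` carrier ?P\<rparr>) K"
      "\<And>p. p \<in> carrier ?P \<Longrightarrow> \<tau> (?e p) = ?e' p"
    using ring_hom_through_image[OF P.ring_axioms e e'] by blast
  show thesis
  proof
    show "\<tau> \<in> ring_hom (L\<lparr>carrier := L.simple_extension F z\<rparr>) K"
      using \<tau>(1) L.simple_extension_as_eval_img[OF subset z(1)] by simp
    show "\<tau> c = \<sigma> c" if c: "c \<in> F" for c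
    \<comment> \<open>The zero polynomial is the empty list and not \<open>[c]\<close>, so constants
      need two cases.\<close>
    proof (cases "c = \<zero>\<^bsub>L\<^esub>")
      case True
      then show ?thesis
        using \<tau>(2)[of "[]"] \<sigma>.hom_zero by (simp add: univ_poly_zero_closed)
    next
      case False
      then have "[c] \<in> carrier ?P"
        using c by (simp add: univ_poly_carrier[symmetric] polynomial_def)
      then show ?thesis
        using \<tau>(2)[of "[c]"] c subset z w \<sigma>.hom_closed[of c] by auto
    qed
    have "[\<one>\<^bsub>L\<^esub>, \<zero>\<^bsub>L\<^esub>] \<in> carrier ?P"
      using subringE(2,3)[OF subring] by (simp add: univ_poly_carrier[symmetric] polynomial_def)
    then show "\<tau> z = w"
      using \<tau>(2)[of "[\<one>\<^bsub>L\<^esub>, \<zero>\<^bsub>L\<^esub>]"] z w \<sigma>.hom_one \<sigma>.hom_zero by simp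
  qed
qed

context algebraically_closed
begin

lemma exists_root_of_pos_degree:
  assumes "p \<in> carrier (poly_ring L)" "degree p \<ge> 1"
  obtains w where "w \<in> carrier L" "eval p w = \<zero>"
proof -
  have "roots p \<noteq> {#}"
    using assms roots_over_carrier[OF assms(1)] by (auto simp: splitted_def)
  then obtain w where "w \<in># roots p"
    by blast
  then show thesis
    using that roots_mem_iff_is_root[OF assms(1)] by (auto simp: is_root_def)
qed

end

text \<open>The generators are adjoined one at a time: the minimal polynomial of the next one over
  the field reached so far has positive degree, so its image has a root in \<open>K\<close> to which
  the generator can be sent.\<close>

lemma finite_extension_hom:
  assumes "field L" "algebraically_closed K" and F: "subfield F L"
    and \<sigma>: "\<sigma> \<in> ring_hom (L\<lparr>carrier := F\<rparr>) K"
    and zs: "set zs \<subseteq> carrier L" "\<And>z. z \<in> set zs \<Longrightarrow> (ring.algebraic L over F) z"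
  shows "\<exists>\<tau> \<in> ring_hom (L\<lparr>carrier := ring.finite_extension L F zs\<rparr>) K. \<forall>c\<in>F. \<tau> c = \<sigma> c"
  using zs
proof (induction zs)
  case Nil
  interpret L: field L by fact
  show ?case using \<sigma> by auto
next
  case (Cons z zs)
  interpret L: field L by fact
  interpret K: algebraically_closed K by fact
  let ?E = "L.finite_extension F zs"
  obtain \<sigma>' where \<sigma>': "\<sigma>' \<in> ring_hom (L\<lparr>carrier := ?E\<rparr>) K" "\<forall>c\<in>F. \<sigma>' c = \<sigma> c"
    using Cons by auto
  have E: "subfield ?E L"
    using Cons.prems L.finite_extension_is_subfield[OF F] by auto
  have FE: "F \<subseteq> ?E"
    using L.finite_extension_incl[OF subfieldE(3)[OF F]] Cons.prems by auto
  then have z: "z \<in> carrier L" "(L.algebraic over ?E) z"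
    using Cons.prems L.algebraic_mono[OF FE] by auto
  note Irr = L.IrrE[OF E z]
  have "L.Irr ?E z \<in> carrier (poly_ring (L\<lparr>carrier := ?E\<rparr>))"
    using Irr(1) L.univ_poly_consistent[OF subfieldE(1)[OF E]] by simp
  then have "map \<sigma>' (L.Irr ?E z) \<in> carrier (poly_ring K)"
    using polynomial_hom[OF \<sigma>'(1) L.subfield_iff(2)[OF E] K.field_axioms] by blast
  moreover have "degree (map \<sigma>' (L.Irr ?E z)) \<ge> 1"
    using L.pirreducible_degree[OF E Irr(1,2)] by simp
  ultimately obtain w where "w \<in> carrier K" "K.eval (map \<sigma>' (L.Irr ?E z)) w = \<zero>\<^bsub>K\<^esub>"
    using K.exists_root_of_pos_degree by blast
  then obtain \<tau> where "\<tau> \<in> ring_hom (L\<lparr>carrier := L.simple_extension ?E z\<rparr>) K"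
      "\<And>c. c \<in> ?E \<Longrightarrow> \<tau> c = \<sigma>' c"
    using simple_extension_hom[OF L.field_axioms K.field_axioms E \<sigma>'(1) z] by blast
  then show ?case
    using \<sigma>'(2) FE by (intro bexI[of _ \<tau>]) auto
qed

section \<open>Points of a Galois extension\<close>

text \<open>As \<open>p\<close> splits over \<open>L\<close>, linear factors \<open>X - a\<close>
  are removed one by one: \<open>w\<close> is \<open>\<iota> a\<close> or a root of the image of the
  cofactor. A constant left at the end is nonzero, and so is its image, as \<open>\<iota>\<close> is
  injective.\<close>

lemma map_hom_root_imp_root:
  assumes "field L" "field K" "\<iota> \<in> ring_hom L K"
    and "p \<in> carrier (poly_ring L)" "p \<noteq> []" "ring.splitted L p"
    and w: "w \<in> carrier K" "ring.eval K (map \<iota> p) w = \<zero>\<^bsub>K\<^esub>"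
  shows "\<exists>y. ring.is_root L p y \<and> w = \<iota> y"
proof -
  interpret L: field L by fact
  interpret K: field K by fact
  interpret \<iota>: ring_hom_cring L K \<iota>
    by unfold_locales fact
  interpret P: domain "poly_ring L"
    using L.univ_poly_is_domain[OF L.carrier_is_subring] .
  interpret e: ring_hom_cring "poly_ring L" K "\<lambda>p. K.eval (map \<iota> p) w"
    by unfold_locales (rule \<iota>.eval_map_hom[OF w(1)])
  show ?thesis
    using assms(4-6) w(2)
  proof (induction "degree p" arbitrary: p)
    case 0
    then obtain c where c: "p = [c]" "c \<in> carrier L" "c \<noteq> \<zero>\<^bsub>L\<^esub>"
      by (cases p) (auto simp: univ_poly_carrier[symmetric] polynomial_def)
    then have "\<iota> c = \<zero>\<^bsub>K\<^esub>"
      using 0 w(1) by simp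
    then show ?case
      using c non_trivial_field_hom_is_inj[OF assms(3,1,2)] \<iota>.hom_zero
      by (metis L.zero_closed inj_onD)
  next
    case (Suc d)
    have "L.roots p \<noteq> {#}"
      using Suc by (auto simp: L.splitted_def)
    then obtain a where a: "a \<in> carrier L" "[\<one>\<^bsub>L\<^esub>, \<ominus>\<^bsub>L\<^esub> a] \<in> carrier (poly_ring L)"
        "[\<one>\<^bsub>L\<^esub>, \<ominus>\<^bsub>L\<^esub> a] pdivides\<^bsub>L\<^esub> p" "a \<in># L.roots p"
      using L.not_empty_rootsE[OF Suc.prems(1)] by metis
    then obtain q where q: "q \<in> carrier (poly_ring L)" "p = [\<one>\<^bsub>L\<^esub>, \<ominus>\<^bsub>L\<^esub> a] \<otimes>\<^bsub>poly_ring L\<^esub> q"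
      by (auto simp: pdivides_def elim: dividesE)
    then have q0: "q \<noteq> []"
      using Suc.prems(2) a(2) P.r_null by (auto simp: univ_poly_zero)
    have lin: "K.eval (map \<iota> [\<one>\<^bsub>L\<^esub>, \<ominus>\<^bsub>L\<^esub> a]) w = w \<ominus>\<^bsub>K\<^esub> \<iota> a"
      using a w by (simp add: a_minus_def)
    have deg: "degree p = 1 + degree q"
      using L.poly_mult_degree_eq[OF L.carrier_is_subring, of "[\<one>\<^bsub>L\<^esub>, \<ominus>\<^bsub>L\<^esub> a]" q] a q q0
      by (simp add: univ_poly_mult univ_poly_carrier)
    have "(w \<ominus>\<^bsub>K\<^esub> \<iota> a) \<otimes>\<^bsub>K\<^esub> K.eval (map \<iota> q) w = \<zero>\<^bsub>K\<^esub>"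
      using Suc.prems(4) e.hom_mult[OF a(2) q(1)] q(2) lin by simp
    then consider "w = \<iota> a" | "K.eval (map \<iota> q) w = \<zero>\<^bsub>K\<^esub>"
      using K.integral_iff a(1) w(1) q(1) e.hom_closed by (metis K.minus_closed K.r_right_minus_eq \<iota>.hom_closed)
    then show ?case
    proof cases
      case 1
      then show ?thesis
        using a(4) L.roots_mem_iff_is_root[OF Suc.prems(1)] by blast
    next
      case 2
      \<comment> \<open>One root and one degree are lost together, so the cofactor still has as many
        roots as its degree.\<close>
      have roots: "L.roots p = add_mset a (L.roots q)"
        using L.poly_mult_degree_one_monic_imp_same_roots[OF a(1) q(1) q0] q(2) by simp
      then have "L.splitted q"
        using Suc.prems(3) deg by (simp add: L.splitted_def)
      moreover have degq: "d = degree q"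
        using Suc.hyps(2) deg by linarith
      ultimately obtain y where "L.is_root q y" "w = \<iota> y"
        using Suc.hyps(1)[of q] degq q q0 2 by auto
      then show ?thesis
        using roots L.roots_mem_iff_is_root[OF Suc.prems(1)] L.roots_mem_iff_is_root[OF q(1)] by auto
    qed
  qed
qed

locale galois_points = finite_galois_extension k L + K: algebraically_closed K
  for k and L :: "('a, 'm) ring_scheme" (structure) and K :: "('b, 'p) ring_scheme" +
  fixes \<iota> :: "'a \<Rightarrow> 'b"
  assumes hom: "\<iota> \<in> ring_hom L K"
begin

sublocale \<iota>: ring_hom_cring L K \<iota>
  by unfold_locales (rule hom)

definition points :: "('a \<Rightarrow> 'b) set"
  where "points = alg_homs k L id K \<iota>"

lemma k_subset: "k \<subseteq> carrier L"
  using subfieldE(3) subfield_axioms by blast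

lemma k_subring: "subring k L"
  using subfieldE(1) subfield_axioms by blast

lemma points_iff:
  "f \<in> points \<longleftrightarrow> f \<in> ring_hom L K \<and> f \<in> extensional (carrier L) \<and> (\<forall>c\<in>k. f c = \<iota> c)"
  by (auto simp: points_def alg_homs_def)

lemma point_ring_hom_cring:
  assumes "f \<in> points"
  shows "ring_hom_cring L K f"
  using assms by unfold_locales (simp add: points_iff)

lemma inj_on_point: "f \<in> points \<Longrightarrow> inj_on f (carrier L)"
  using non_trivial_field_hom_is_inj[OF _ field_axioms K.field_axioms] by (simp add: points_iff)

lemma points_eqI:
  assumes "f \<in> points" "g \<in> points" "\<And>x. x \<in> carrier L \<Longrightarrow> f x = g x"
  shows "f = g"
  using assms extensionalityI[of f "carrier L" g] by (simp add: points_iff)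

lemma restrict_ring_hom_in_points:
  assumes "f \<in> ring_hom L K" "\<And>c. c \<in> k \<Longrightarrow> f c = \<iota> c"
  shows "restrict f (carrier L) \<in> points"
  using assms k_subset by (auto simp: points_iff ring_hom_def Pi_iff subset_iff)

text \<open>The point that plays the role of the identity of the Galois group. The restriction is
  there because points are extensional, while \<open>\<iota>\<close> is arbitrary outside
  \<open>L\<close>.\<close>

definition point0 :: "'a \<Rightarrow> 'b"
  where "point0 = restrict \<iota> (carrier L)"

lemma point0: "point0 \<in> points" "x \<in> carrier L \<Longrightarrow> point0 x = \<iota> x"
  using restrict_ring_hom_in_points[OF hom] by (auto simp: point0_def)

lemma inj_on_\<iota>: "inj_on \<iota> (carrier L)"
  using non_trivial_field_hom_is_inj[OF hom field_axioms K.field_axioms] .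

section \<open>Minimal polynomials, finiteness and existence of points\<close>

lemma algebraic_L: "x \<in> carrier L \<Longrightarrow> (algebraic over k) x"
  using finite_dimension_imp_algebraic[OF subfield_axioms carrier_is_subring finite_extension] .

lemmas Irr_props = IrrE[OF subfield_axioms _ algebraic_L]

lemma Irr_carrier:
  assumes "x \<in> carrier L"
  shows "Irr k x \<in> carrier (poly_ring L)" "Irr k x \<noteq> []"
  using Irr_props(1,2)[OF assms assms] carrier_polynomial_shell[OF k_subring]
    pirreducibleE(1)[OF k_subring] by auto

lemma eval_Irr_point:
  assumes f: "f \<in> points" and x: "x \<in> carrier L"
  shows "K.eval (map \<iota> (Irr k x)) (f x) = \<zero>\<^bsub>K\<^esub>"
proof -
  interpret f: ring_hom_cring L K f using point_ring_hom_cring[OF f] .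
  have "set (Irr k x) \<subseteq> k"
    using Irr_props(1)[OF x x] by (auto simp: univ_poly_carrier[symmetric] polynomial_def)
  then have "map \<iota> (Irr k x) = map f (Irr k x)"
    using f by (auto simp: points_iff)
  then show ?thesis
    using f.ring.eval_hom[OF k_subring x Irr_props(1)[OF x x]] Irr_props(4)[OF x x] f.hom_zero
    by (simp only:)
qed

text \<open>\<open>f x\<close> is a root of the image of the minimal polynomial of \<open>x\<close>,
  which by normality has all its roots in \<open>L\<close>. Hence the image of every point lies in
  that of \<open>\<iota>\<close>.\<close>

lemma point_factor:
  assumes "f \<in> points" "x \<in> carrier L"
  obtains y where "is_root (Irr k x) y" "f x = \<iota> y"
  using map_hom_root_imp_root[OF field_axioms K.field_axioms hom Irr_carrier normal _ eval_Irr_point] assms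
    point_ring_hom_cring[OF assms(1)] ring_hom_cring.homh ring_hom_closed by metis

text \<open>A spanning family over \<open>k\<close> also generates \<open>L\<close> as an extension,
  since linear combinations stay in the subring. Points are extended along this list, one generator
  at a time.\<close>

lemma finite_generators:
  obtains zs where "set zs \<subseteq> carrier L" "finite_extension k zs = carrier L"
proof -
  obtain n where "dimension n k (carrier L)"
    using finite_extension by (auto simp: finite_dimension_def)
  then obtain zs where zs: "set zs \<subseteq> carrier L" "Span k zs = carrier L"
    using exists_base[OF subfield_axioms] by metis
  have sub: "subring (finite_extension k zs) L"
    using finite_extension_is_subring[OF k_subring zs(1)] .
  have "combine Ks Us \<in> finite_extension k zs"
    if "set Ks \<subseteq> k" "set Us \<subseteq> set zs" for Ks Us
    using that
  proof (induction Ks Us rule: combine.induct)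
    case (1 c Ks u Us)
    then have "c \<in> finite_extension k zs" "u \<in> finite_extension k zs"
      using finite_extension_incl[OF k_subset zs(1)] finite_extension_mem[OF k_subring zs(1)]
      by (auto simp del: finite_extension.simps)
    then show ?case
      using 1 subringE(6,7)[OF sub] by (simp del: finite_extension.simps)
  qed (use subringE(2)[OF sub] in \<open>auto simp del: finite_extension.simps\<close>)
  then have "carrier L \<subseteq> finite_extension k zs"
    by (subst zs(2)[symmetric], subst Span_eq_combine_set[OF subfield_axioms zs(1)]) blast
  then show thesis
    using that zs(1) subringE(1)[OF sub] by blast
qed

text \<open>A point is determined by its values on the generators, because two points agree on a
  subring that contains \<open>k\<close>; each value has only finitely many candidates, the images
  of the roots of a minimal polynomial.\<close>

lemma finite_points: "finite points"
proof -
  obtain zs where zs: "set zs \<subseteq> carrier L" "finite_extension k zs = carrier L"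
    using finite_generators .
  let ?V = "\<lambda>z. \<iota> ` {y. is_root (Irr k z) y}"
  have "(\<lambda>f. restrict f (set zs)) ` points \<subseteq> (\<Pi>\<^sub>E z\<in>set zs. ?V z)"
  proof (rule image_subsetI)
    fix f assume "f \<in> points"
    then have "f z \<in> ?V z" if "z \<in> set zs" for z
      using point_factor[of f z] that zs(1) by blast
    then show "restrict f (set zs) \<in> (\<Pi>\<^sub>E z\<in>set zs. ?V z)"
      by auto
  qed
  moreover have "finite (\<Pi>\<^sub>E z\<in>set zs. ?V z)"
    using finite_number_of_roots[OF Irr_carrier(1)] zs(1) by (intro finite_PiE) auto
  moreover have "inj_on (\<lambda>f. restrict f (set zs)) points"
  proof (rule inj_onI)
    fix f g assume f: "f \<in> points" and g: "g \<in> points"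
      and eq: "restrict f (set zs) = restrict g (set zs)"
    interpret f: ring_hom_cring L K f using point_ring_hom_cring[OF f] .
    interpret g: ring_hom_cring L K g using point_ring_hom_cring[OF g] .
    have "subring {x \<in> carrier L. f x = g x} L"
      by (rule subringI) auto
    moreover have "k \<subseteq> {x \<in> carrier L. f x = g x}"
      using f g k_subset by (auto simp: points_iff)
    moreover have "set zs \<subseteq> {x \<in> carrier L. f x = g x}"
      using zs(1) eq by (auto dest: fun_cong simp: restrict_def split: if_splits)
    ultimately have "carrier L \<subseteq> {x \<in> carrier L. f x = g x}"
      using finite_extension_subring_incl[of "{x \<in> carrier L. f x = g x}" k zs] zs(2) by simp
    then show "f = g"
      using points_eqI[OF f g] by blast
  qed
  ultimately show ?thesis
    using finite_imageD finite_subset by blast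
qed

text \<open>The point is given on \<open>k(x)\<close> by \<open>x \<mapsto> w\<close> and extended
  to \<open>L\<close> along generators over \<open>k\<close>, which generate \<open>L\<close> over
  \<open>k(x)\<close> as well.\<close>

lemma exists_point:
  assumes x: "x \<in> carrier L" and w: "w \<in> carrier K" "K.eval (map \<iota> (Irr k x)) w = \<zero>\<^bsub>K\<^esub>"
  obtains f where "f \<in> points" "f x = w"
proof -
  have "\<iota> \<in> ring_hom (L\<lparr>carrier := k\<rparr>) K"
    using ring_hom_ring.homh[OF \<iota>.ring.induced_ring_hom[OF k_subring]] .
  then obtain \<tau> where \<tau>: "\<tau> \<in> ring_hom (L\<lparr>carrier := simple_extension k x\<rparr>) K"
      "\<And>c. c \<in> k \<Longrightarrow> \<tau> c = \<iota> c" "\<tau> x = w"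
    using simple_extension_hom[OF field_axioms K.field_axioms subfield_axioms _ x algebraic_L[OF x] w]
    by blast
  let ?E = "simple_extension k x"
  obtain zs where zs: "set zs \<subseteq> carrier L" "finite_extension k zs = carrier L"
    using finite_generators .
  have E: "subfield ?E L"
    using simple_extension_is_subfield[OF subfield_axioms x] algebraic_L[OF x] by simp
  have kE: "k \<subseteq> ?E"
    using simple_extension_incl[OF k_subset x] .
  have "(algebraic over ?E) z" if "z \<in> set zs" for z
    using algebraic_mono[OF kE algebraic_L] zs(1) that by blast
  then obtain f where f: "f \<in> ring_hom (L\<lparr>carrier := finite_extension ?E zs\<rparr>) K"
      "\<forall>c\<in>?E. f c = \<tau> c"
    using finite_extension_hom[OF field_axioms K.algebraically_closed_axioms E \<tau>(1) zs(1)] by blast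
  have "finite_extension ?E zs = carrier L"
    using mono_finite_extension[OF kE] zs
      finite_extension_in_carrier[OF subfieldE(3)[OF E] zs(1)] by blast
  then have "restrict f (carrier L) \<in> points"
    using f \<tau>(2) kE by (intro restrict_ring_hom_in_points) auto
  moreover have "restrict f (carrier L) x = w"
    using f(2) \<tau>(3) x simple_extension_mem[OF k_subring x] by simp
  ultimately show thesis
    using that by blast
qed

text \<open>The fixed field is \<open>k\<close>, in contrapositive form. The minimal polynomial of
  \<open>x\<close> has degree at least two and splits; separability makes \<open>x\<close> a simple
  root, so there is another root \<open>y\<close>, and a point sends \<open>x\<close> to
  \<open>\<iota> y\<close>.\<close>

lemma exists_moving_point:
  assumes x: "x \<in> carrier L" "x \<notin> k"
  obtains f where "f \<in> points" "f x \<noteq> \<iota> x"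
proof -
  let ?p = "Irr k x"
  note p = Irr_carrier[OF x(1)]
  have root: "x \<in># roots ?p"
    using Irr_props(4)[OF x(1) x(1)] x(1) p by (simp add: roots_mem_iff_is_root is_root_def)
  have "degree ?p \<noteq> 1"
  proof
    assume "degree ?p = 1"
    then have "length ?p = 2"
      by linarith
    then obtain a b where ab: "?p = [a, b]"
      by (auto simp: length_Suc_conv numeral_2_eq_2)
    then have "a = \<one>" "b \<in> k"
      using Irr_props(1,3)[OF x(1) x(1)] by (auto simp: univ_poly_carrier[symmetric] polynomial_def)
    moreover have "x \<oplus> b = \<zero>"
      using Irr_props(4)[OF x(1) x(1)] ab calculation x(1) k_subset by auto
    ultimately have "x = \<ominus> b"
      using x(1) k_subset add.inv_unique' minus_equality by (metis add.m_comm subsetD)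
    then show False
      using x(2) \<open>b \<in> k\<close> subringE(5)[OF k_subring] by simp
  qed
  moreover have "degree ?p \<ge> 1"
    using pirreducible_degree[OF subfield_axioms] Irr_props(1,2)[OF x(1) x(1)] by blast
  ultimately have "size (roots ?p) \<ge> 2"
    using normal[OF x(1)] by (simp add: splitted_def)
  then have "size (roots ?p - {#x#}) \<noteq> 0"
    using root by (simp add: size_Diff_singleton)
  then obtain y where y: "y \<in># roots ?p - {#x#}"
    by (metis multiset_nonemptyE size_empty)
  have "count (roots ?p) x = 1"
    using separable[OF x(1) root] alg_mult_eq_count_roots[OF p(1)] by simp
  then have "y \<noteq> x"
    using y by (auto simp: in_diff_count)
  moreover have "y \<in># roots ?p"
    using y by (rule in_diffD)
  then have y': "y \<in> carrier L" "eval ?p y = \<zero>"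
    using roots_mem_iff_is_root[OF p(1)] by (auto simp: is_root_def)
  then have "K.eval (map \<iota> ?p) (\<iota> y) = \<zero>\<^bsub>K\<^esub>"
    using \<iota>.ring.eval_hom[OF carrier_is_subring y'(1) p(1)] \<iota>.hom_zero by simp
  then obtain f where "f \<in> points" "f x = \<iota> y"
    using exists_point[OF x(1), of "\<iota> y"] y'(1) by auto
  ultimately show thesis
    using that x(1) y'(1) inj_on_\<iota> by (metis inj_onD)
qed

section \<open>Points as automorphisms of the Galois extension\<close>

definition lift :: "('a \<Rightarrow> 'b) \<Rightarrow> 'a \<Rightarrow> 'a"
  where "lift f x = inv_into (carrier L) \<iota> (f x)"

lemma lift:
  assumes f: "f \<in> points" and x: "x \<in> carrier L"
  shows "lift f x \<in> carrier L" "\<iota> (lift f x) = f x"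
proof -
  have "f x \<in> \<iota> ` carrier L"
    using point_factor[OF f x] by (auto simp: is_root_def)
  then show "lift f x \<in> carrier L" "\<iota> (lift f x) = f x"
    by (auto simp: lift_def inv_into_into f_inv_into_f)
qed

text \<open>The identities hold after the injective \<open>\<iota>\<close> is applied, where they
  are those of \<open>f\<close>.\<close>

lemma lift_ring_hom: "f \<in> points \<Longrightarrow> lift f \<in> ring_hom L L"
proof (rule ring_hom_memI)
  assume f: "f \<in> points"
  interpret f: ring_hom_cring L K f using point_ring_hom_cring[OF f] .
  show "lift f x \<in> carrier L" if "x \<in> carrier L" for x
    using lift(1)[OF f that] .
  show "lift f (x \<otimes> y) = lift f x \<otimes> lift f y" if "x \<in> carrier L" "y \<in> carrier L" for x y
    using that lift[OF f] by (intro inj_onD[OF inj_on_\<iota>]) auto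
  show "lift f (x \<oplus> y) = lift f x \<oplus> lift f y" if "x \<in> carrier L" "y \<in> carrier L" for x y
    using that lift[OF f] by (intro inj_onD[OF inj_on_\<iota>]) auto
  show "lift f \<one> = \<one>"
    using lift[OF f] by (intro inj_onD[OF inj_on_\<iota>]) auto
qed

text \<open>
  Composition of automorphisms of \<open>L\<close> over \<open>k\<close>, transported to \<open>points\<close> along \<open>g \<mapsto> \<iota> \<circ> g\<close>.
\<close>

definition point_comp :: "('a \<Rightarrow> 'b) \<Rightarrow> ('a \<Rightarrow> 'b) \<Rightarrow> 'a \<Rightarrow> 'b"
  where "point_comp f g = (\<lambda>x\<in>carrier L. f (lift g x))"

lemma point_comp_in_points:
  assumes f: "f \<in> points" and g: "g \<in> points"
  shows "point_comp f g \<in> points"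
proof -
  have "f \<circ> lift g \<in> ring_hom L K"
    using ring_hom_trans[OF lift_ring_hom[OF g]] f by (auto simp: points_iff)
  moreover have "lift g c = c" if "c \<in> k" for c
    using that k_subset lift[OF g] g by (intro inj_onD[OF inj_on_\<iota>]) (auto simp: points_iff)
  ultimately have "restrict (f \<circ> lift g) (carrier L) \<in> points"
    using f by (intro restrict_ring_hom_in_points) (auto simp: points_iff)
  then show ?thesis
    by (simp add: point_comp_def o_def restrict_def)
qed

lemma point_comp_inj:
  assumes f: "f \<in> points"
  shows "inj_on (point_comp f) points"
proof (rule inj_onI)
  fix g h assume gh: "g \<in> points" "h \<in> points" "point_comp f g = point_comp f h"
  show "g = h"
  proof (rule points_eqI[OF gh(1,2)])
    fix x assume x: "x \<in> carrier L"
    then have "f (lift g x) = f (lift h x)"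
      using fun_cong[OF gh(3), of x] by (simp add: point_comp_def)
    then have "lift g x = lift h x"
      using inj_onD[OF inj_on_point[OF f]] lift(1) gh x by blast
    then show "g x = h x"
      using lift(2) gh x by metis
  qed
qed

text \<open>An injective map from the finite set of points to itself is onto; this stands in for
  inverses of automorphisms.\<close>

lemma point_comp_image:
  assumes f: "f \<in> points"
  shows "point_comp f ` points = points"
  using endo_inj_surj[OF finite_points _ point_comp_inj[OF f]] point_comp_in_points[OF f] by blast

lemma point_comp_point0: "f \<in> points \<Longrightarrow> point_comp f point0 = f"
proof (rule points_eqI)
  fix x assume f: "f \<in> points" and x: "x \<in> carrier L"
  have "lift point0 x = x"
    using lift[OF point0(1) x] point0(2)[OF x] x by (intro inj_onD[OF inj_on_\<iota>]) auto
  then show "point_comp f point0 x = f x"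
    using x by (simp add: point_comp_def)
qed (auto intro: point_comp_in_points point0)

lemma point_closed [simp]: "f \<in> points \<Longrightarrow> x \<in> carrier L \<Longrightarrow> f x \<in> carrier K"
  by (auto simp: points_iff intro: ring_hom_closed)

text \<open>The trace is formed in \<open>L\<close> as the sum of the conjugates
  \<open>lift g y\<close>. A point \<open>f\<close> only permutes the summands, as left translation
  by \<open>f\<close> permutes the points; so no point moves the sum, and it lies in
  \<open>k\<close>.\<close>

lemma trace_in_k:
  assumes y: "y \<in> carrier L"
  obtains t where "t \<in> k" "\<iota> t = (\<Oplus>\<^bsub>K\<^esub>f\<in>points. f y)"
proof -
  let ?t = "\<Oplus>g\<in>points. lift g y"
  have t: "?t \<in> carrier L"
    using y lift(1) by (intro finsum_closed) auto
  have hom_t: "h ?t = (\<Oplus>\<^bsub>K\<^esub>g\<in>points. h (lift g y))" if "ring_hom_cring L K h" for h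
  proof -
    interpret h: ring_hom_cring L K h by fact
    show ?thesis
      using y lift(1) by (subst h.hom_finsum) (auto simp: o_def)
  qed
  have \<iota>t: "\<iota> ?t = (\<Oplus>\<^bsub>K\<^esub>g\<in>points. g y)"
    using y lift(2) by (subst hom_t[OF \<iota>.ring_hom_cring_axioms], intro K.finsum_cong') auto
  have "f ?t = \<iota> ?t" if f: "f \<in> points" for f
  proof -
    have "f ?t = (\<Oplus>\<^bsub>K\<^esub>g\<in>points. point_comp f g y)"
      using y f lift(1)
      by (subst hom_t[OF point_ring_hom_cring[OF f]], intro K.finsum_cong') (auto simp: point_comp_def)
    also have "\<dots> = (\<Oplus>\<^bsub>K\<^esub>g\<in>point_comp f ` points. g y)"
      using y point_comp_inj[OF f] point_comp_image[OF f] by (subst K.finsum_reindex) auto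
    finally show ?thesis
      by (simp add: point_comp_image[OF f] \<iota>t)
  qed
  then have "?t \<in> k"
    using exists_moving_point[OF t] by metis
  then show thesis
    using that \<iota>t by blast
qed

section \<open>Dual systems from the diagonal idempotent\<close>

text \<open>The functions on \<open>points\<close> which are given by elements of \<open>L \<otimes>\<^sub>k L\<close>.\<close>

inductive tensor_fun :: "(('a \<Rightarrow> 'b) \<Rightarrow> 'b) \<Rightarrow> bool" where
  zero: "(\<And>f. f \<in> points \<Longrightarrow> u f = \<zero>\<^bsub>K\<^esub>) \<Longrightarrow> tensor_fun u"
| step: "tensor_fun u \<Longrightarrow> a \<in> carrier L \<Longrightarrow> b \<in> carrier L \<Longrightarrow>
    (\<And>f. f \<in> points \<Longrightarrow> v f = \<iota> a \<otimes>\<^bsub>K\<^esub> f b \<oplus>\<^bsub>K\<^esub> u f) \<Longrightarrow> tensor_fun v"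

lemma tensor_fun_closed: "tensor_fun u \<Longrightarrow> f \<in> points \<Longrightarrow> u f \<in> carrier K"
  by (induction rule: tensor_fun.induct) auto

text \<open>Elements of \<open>L \<otimes>_k L\<close> enter only through their values at points, so
  the sum is any \<open>w\<close> with the right values there.\<close>

lemma tensor_fun_add:
  assumes u: "tensor_fun u" and v: "tensor_fun v"
    and w: "\<And>f. f \<in> points \<Longrightarrow> w f = u f \<oplus>\<^bsub>K\<^esub> v f"
  shows "tensor_fun w"
  using u w
proof (induction arbitrary: w rule: tensor_fun.induct)
  case (zero u)
  from v show ?case
  proof cases
    case zero
    then show ?thesis using zero.hyps zero.prems by (intro tensor_fun.zero) simp
  next
    case (step u' a b)
    then show ?thesis
      using zero.hyps zero.prems tensor_fun_closed[OF step(1)]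
      by (intro tensor_fun.step[OF step(1-3)]) simp
  qed
next
  case (step u a b u')
  have "tensor_fun (\<lambda>f. u f \<oplus>\<^bsub>K\<^esub> v f)"
    by (rule step.IH) simp
  then show ?case
    using step tensor_fun_closed[OF step(1)] tensor_fun_closed[OF v]
    by (intro tensor_fun.step[OF \<open>tensor_fun (\<lambda>f. u f \<oplus>\<^bsub>K\<^esub> v f)\<close> step(2,3)]) (simp add: K.a_assoc)
qed

text \<open>Reflects the product of pure tensors: \<open>(a \<otimes> b)(c \<otimes> d)\<close> is
  \<open>ac \<otimes> bd\<close>.\<close>

lemma tensor_fun_mult_pure:
  assumes "tensor_fun v" and a: "a \<in> carrier L" and b: "b \<in> carrier L"
    and "\<And>f. f \<in> points \<Longrightarrow> w f = (\<iota> a \<otimes>\<^bsub>K\<^esub> f b) \<otimes>\<^bsub>K\<^esub> v f"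
  shows "tensor_fun w"
  using assms(1,4)
proof (induction arbitrary: w rule: tensor_fun.induct)
  case (zero v)
  then show ?case
    using a b by (intro tensor_fun.zero) simp
next
  case (step v c d v')
  have "tensor_fun (\<lambda>f. (\<iota> a \<otimes>\<^bsub>K\<^esub> f b) \<otimes>\<^bsub>K\<^esub> v f)"
    by (rule step.IH) simp
  then show ?case
  proof (rule tensor_fun.step)
    show "w f = \<iota> (a \<otimes> c) \<otimes>\<^bsub>K\<^esub> f (b \<otimes> d) \<oplus>\<^bsub>K\<^esub> (\<iota> a \<otimes>\<^bsub>K\<^esub> f b) \<otimes>\<^bsub>K\<^esub> v f"
      if f: "f \<in> points" for f
    proof -
      interpret f: ring_hom_cring L K f using point_ring_hom_cring[OF f] .
      have "v f \<in> carrier K" using tensor_fun_closed[OF step(1) f] .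
      then show ?thesis
        using step.prems[OF f] step.hyps(4)[OF f] step.hyps(2,3) a b f
        by (simp add: K.r_distr K.m_ac)
    qed
  qed (use step.hyps a b in auto)
qed

lemma tensor_fun_mult:
  assumes "tensor_fun u" and v: "tensor_fun v"
  shows "tensor_fun (\<lambda>f. u f \<otimes>\<^bsub>K\<^esub> v f)"
  using assms(1)
proof (induction rule: tensor_fun.induct)
  case (zero u)
  then show ?case
    using tensor_fun_closed[OF v] by (intro tensor_fun.zero) simp
next
  case (step u a b u')
  have "tensor_fun (\<lambda>f. (\<iota> a \<otimes>\<^bsub>K\<^esub> f b) \<otimes>\<^bsub>K\<^esub> v f)"
    by (rule tensor_fun_mult_pure[OF v step(2,3)]) simp
  then show ?case
    using step tensor_fun_closed[OF v] tensor_fun_closed[OF step(1)]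
    by (intro tensor_fun_add[OF \<open>tensor_fun (\<lambda>f. (\<iota> a \<otimes>\<^bsub>K\<^esub> f b) \<otimes>\<^bsub>K\<^esub> v f)\<close> step.IH]) (simp add: K.l_distr)
qed

text \<open>
  The functions \<open>f \<mapsto> (f x - g x) / (\<iota> x - g x)\<close> take the value \<open>1\<close> at \<open>\<iota>\<close> and vanish at \<open>g\<close>.
\<close>

lemma tensor_fun_separating:
  assumes g: "g \<in> points" "g \<noteq> point0"
  obtains u where "tensor_fun u" "u point0 = \<one>\<^bsub>K\<^esub>" "u g = \<zero>\<^bsub>K\<^esub>"
proof -
  interpret g: ring_hom_cring L K g using point_ring_hom_cring[OF g(1)] .
  interpret p: ring_hom_cring L K point0 using point_ring_hom_cring[OF point0(1)] .
  obtain x where x: "x \<in> carrier L" "g x \<noteq> \<iota> x"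
    using g points_eqI[OF g(1) point0(1)] point0(2) by metis
  define y where "y = lift g x"
  have y: "y \<in> carrier L" "\<iota> y = g x"
    using lift[OF g(1) x(1)] by (auto simp: y_def)
  \<comment> \<open>\<open>y\<close> is the value of \<open>g\<close> at \<open>x\<close> moved into
    \<open>L\<close>, so that the denominator \<open>x - y\<close> can be inverted there; it is
    nonzero because \<open>g\<close> moves \<open>x\<close>.\<close>
  define d where "d = inv (x \<ominus> y)"
  have "x \<ominus> y \<noteq> \<zero>"
    using x y by (auto simp: r_right_minus_eq)
  then have d: "d \<in> carrier L" "d \<otimes> (x \<ominus> y) = \<one>"
    using x y by (auto simp: d_def field_Units)
  \<comment> \<open>The constant term is the pure tensor of \<open>- d y\<close> and
    \<open>1\<close>; the added zero is the empty sum from which \<open>tensor_fun\<close>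
    starts.\<close>
  let ?v = "\<lambda>f. \<iota> (\<ominus> (d \<otimes> y)) \<otimes>\<^bsub>K\<^esub> f \<one> \<oplus>\<^bsub>K\<^esub> \<zero>\<^bsub>K\<^esub>"
  let ?u = "\<lambda>f. \<iota> d \<otimes>\<^bsub>K\<^esub> f x \<oplus>\<^bsub>K\<^esub> ?v f"
  have "tensor_fun ?v"
    by (rule tensor_fun.step[of "\<lambda>_. \<zero>\<^bsub>K\<^esub>" "\<ominus> (d \<otimes> y)" \<one>])
      (use d(1) y(1) in \<open>auto intro: tensor_fun.zero\<close>)
  then have "tensor_fun ?u"
    by (rule tensor_fun.step[OF _ d(1) x(1)]) simp
  moreover have "?u point0 = \<iota> (d \<otimes> (x \<ominus> y))"
    using x(1) y(1) d(1) by (simp add: a_minus_def r_distr r_minus K.r_minus point0(2))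
  then have "?u point0 = \<one>\<^bsub>K\<^esub>"
    using d by simp
  moreover have "?u g = \<zero>\<^bsub>K\<^esub>"
    using x y d by (simp add: K.r_neg)
  ultimately show thesis
    using that by blast
qed

text \<open>A product of functions, one for each \<open>g\<close> other than \<open>point0\<close>,
  each equal to one at \<open>point0\<close> and to zero at its \<open>g\<close>. The result
  corresponds to the idempotent of \<open>L \<otimes>_k L\<close> that belongs to the
  diagonal.\<close>

lemma tensor_fun_delta:
  "\<exists>u. tensor_fun u \<and> (\<forall>f\<in>points. u f = (if f = point0 then \<one>\<^bsub>K\<^esub> else \<zero>\<^bsub>K\<^esub>))"
proof -
  have "\<exists>u. tensor_fun u \<and> u point0 = \<one>\<^bsub>K\<^esub> \<and> (\<forall>g\<in>S. u g = \<zero>\<^bsub>K\<^esub>)"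
    if "finite S" "S \<subseteq> points - {point0}" for S
    using that
  proof (induction S)
    case empty
    let ?u = "\<lambda>f. \<iota> \<one> \<otimes>\<^bsub>K\<^esub> f \<one> \<oplus>\<^bsub>K\<^esub> \<zero>\<^bsub>K\<^esub>"
    have "tensor_fun ?u"
      by (rule tensor_fun.step[of "\<lambda>_. \<zero>\<^bsub>K\<^esub>" \<one> \<one>]) (auto intro: tensor_fun.zero)
    moreover have "?u point0 = \<one>\<^bsub>K\<^esub>"
      using point0(2) by simp
    ultimately show ?case
      by blast
  next
    case (insert g S)
    then obtain u where u: "tensor_fun u" "u point0 = \<one>\<^bsub>K\<^esub>" "\<forall>g\<in>S. u g = \<zero>\<^bsub>K\<^esub>"
      by auto
    obtain v where v: "tensor_fun v" "v point0 = \<one>\<^bsub>K\<^esub>" "v g = \<zero>\<^bsub>K\<^esub>"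
      using tensor_fun_separating insert.prems by blast
    have "tensor_fun (\<lambda>f. u f \<otimes>\<^bsub>K\<^esub> v f)"
      using tensor_fun_mult[OF u(1) v(1)] .
    moreover have "\<forall>h\<in>insert g S. u h \<otimes>\<^bsub>K\<^esub> v h = \<zero>\<^bsub>K\<^esub>"
      using u v insert.prems tensor_fun_closed[OF u(1)] tensor_fun_closed[OF v(1)] by auto
    ultimately show ?case
      using u v by (intro exI[of _ "\<lambda>f. u f \<otimes>\<^bsub>K\<^esub> v f"]) auto
  qed
  from this[of "points - {point0}"] obtain u where
    "tensor_fun u" "u point0 = \<one>\<^bsub>K\<^esub>" "\<forall>g\<in>points - {point0}. u g = \<zero>\<^bsub>K\<^esub>"
    using finite_points by blast
  then show ?thesis
    by (intro exI[of _ u]) auto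
qed

lemma tensor_fun_as_sum:
  assumes "tensor_fun u"
  shows "\<exists>(m::nat) a b. a \<in> {..<m} \<rightarrow> carrier L \<and> b \<in> {..<m} \<rightarrow> carrier L \<and>
    (\<forall>f\<in>points. u f = (\<Oplus>\<^bsub>K\<^esub>j\<in>{..<m}. \<iota> (a j) \<otimes>\<^bsub>K\<^esub> f (b j)))"
  using assms
proof (induction rule: tensor_fun.induct)
  case (zero u)
  then show ?case
    by (intro exI[of _ "0::nat"]) auto
next
  case (step u c d v)
  then obtain m :: nat and a b where ab: "a \<in> {..<m} \<rightarrow> carrier L" "b \<in> {..<m} \<rightarrow> carrier L"
    and u: "\<forall>f\<in>points. u f = (\<Oplus>\<^bsub>K\<^esub>j\<in>{..<m}. \<iota> (a j) \<otimes>\<^bsub>K\<^esub> f (b j))"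
    by blast
  let ?a = "a(m := c)" and ?b = "b(m := d)"
  have "v f = (\<Oplus>\<^bsub>K\<^esub>j\<in>{..<Suc m}. \<iota> (?a j) \<otimes>\<^bsub>K\<^esub> f (?b j))" if f: "f \<in> points" for f
  proof -
    have "(\<Oplus>\<^bsub>K\<^esub>j\<in>{..<m}. \<iota> (?a j) \<otimes>\<^bsub>K\<^esub> f (?b j)) = (\<Oplus>\<^bsub>K\<^esub>j\<in>{..<m}. \<iota> (a j) \<otimes>\<^bsub>K\<^esub> f (b j))"
      using ab f by (intro K.finsum_cong') (auto simp: Pi_iff)
    then show ?thesis
      using step f ab u by (simp add: lessThan_Suc K.finsum_insert Pi_iff)
  qed
  moreover have "?a \<in> {..<Suc m} \<rightarrow> carrier L" "?b \<in> {..<Suc m} \<rightarrow> carrier L"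
    using ab step.hyps by (auto simp: Pi_iff less_Suc_eq)
  ultimately show ?case
    by blast
qed

text \<open>The two sequences are read off a sum of pure tensors that represents the indicator
  function of \<open>point0\<close>. This is the case \<open>g = point0\<close>; the general case
  follows by applying \<open>g\<close>, with \<open>f\<close> written as the composition of
  \<open>g\<close> with some \<open>h\<close>.\<close>

lemma dual_bases:
  obtains m :: nat and a b
  where "\<And>j. j < m \<Longrightarrow> a j \<in> carrier L" "\<And>j. j < m \<Longrightarrow> b j \<in> carrier L"
    and "\<And>f g. f \<in> points \<Longrightarrow> g \<in> points \<Longrightarrow>
      (\<Oplus>\<^bsub>K\<^esub>j\<in>{..<m}. g (a j) \<otimes>\<^bsub>K\<^esub> f (b j)) = (if f = g then \<one>\<^bsub>K\<^esub> else \<zero>\<^bsub>K\<^esub>)"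
proof -
  obtain u where u: "tensor_fun u" "\<And>f. f \<in> points \<Longrightarrow> u f = (if f = point0 then \<one>\<^bsub>K\<^esub> else \<zero>\<^bsub>K\<^esub>)"
    using tensor_fun_delta by blast
  obtain m :: nat and a b where ab: "a \<in> {..<m} \<rightarrow> carrier L" "b \<in> {..<m} \<rightarrow> carrier L"
    and sum: "\<And>f. f \<in> points \<Longrightarrow> u f = (\<Oplus>\<^bsub>K\<^esub>j\<in>{..<m}. \<iota> (a j) \<otimes>\<^bsub>K\<^esub> f (b j))"
    using tensor_fun_as_sum[OF u(1)] by blast
  have "(\<Oplus>\<^bsub>K\<^esub>j\<in>{..<m}. g (a j) \<otimes>\<^bsub>K\<^esub> f (b j)) = (if f = g then \<one>\<^bsub>K\<^esub> else \<zero>\<^bsub>K\<^esub>)"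
    if f: "f \<in> points" and g: "g \<in> points" for f g
  proof -
    interpret g: ring_hom_cring L K g using point_ring_hom_cring[OF g] .
    obtain h where h: "h \<in> points" "f = point_comp g h"
      using f point_comp_image[OF g] by blast
    have hb: "lift h (b j) \<in> carrier L" "\<iota> (lift h (b j)) = h (b j)" if "j < m" for j
      using lift[OF h(1)] ab that by (auto simp: Pi_iff)
    \<comment> \<open>The identity known in \<open>K\<close> is moved back into \<open>L\<close>,
      where \<open>g\<close> can be applied to it.\<close>
    let ?t = "\<Oplus>j\<in>{..<m}. a j \<otimes> lift h (b j)"
    have "\<iota> ?t = (\<Oplus>\<^bsub>K\<^esub>j\<in>{..<m}. \<iota> (a j) \<otimes>\<^bsub>K\<^esub> h (b j))"
      using ab hb h by (subst \<iota>.hom_finsum) (auto simp: Pi_iff intro!: K.finsum_cong')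
    also have "\<dots> = \<iota> (if h = point0 then \<one> else \<zero>)"
      unfolding sum[OF h(1), symmetric] u(2)[OF h(1)] using \<iota>.hom_zero by simp
    finally have t: "?t = (if h = point0 then \<one> else \<zero>)"
      using ab hb by (intro inj_onD[OF inj_on_\<iota>]) (auto simp: Pi_iff intro!: finsum_closed)
    have "(\<Oplus>\<^bsub>K\<^esub>j\<in>{..<m}. g (a j) \<otimes>\<^bsub>K\<^esub> f (b j)) = g ?t"
      using ab hb h by (subst g.hom_finsum) (auto simp: Pi_iff point_comp_def intro!: K.finsum_cong')
    also have "\<dots> = (if h = point0 then \<one>\<^bsub>K\<^esub> else \<zero>\<^bsub>K\<^esub>)"
      using t g.hom_zero by simp
    also have "h = point0 \<longleftrightarrow> f = g"
      using h point_comp_point0[OF g] inj_onD[OF point_comp_inj[OF g] _ h(1) point0(1)] by auto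
    finally show ?thesis .
  qed
  then show thesis
    using ab by (intro that[of m a b]) auto
qed

end

section \<open>Points of the invariants\<close>

text \<open>Dedekind's argument. Assume that \<open>\<chi>\<close> differs from every
  \<open>\<phi> f\<close>. If \<open>e\<close> times \<open>\<chi>\<close> is a combination of the
  \<open>\<phi> f\<close>, then \<open>e\<close> is zero, by induction on \<open>S\<close>: choose
  \<open>y\<close> with \<open>\<chi> y \<noteq> \<phi> g y\<close>, and subtract
  \<open>\<phi> g y\<close> times the relation at \<open>x\<close> from the relation at the product
  of \<open>y\<close> and \<open>x\<close>. The term of \<open>g\<close> disappears.\<close>

lemma (in field) character_in_span:
  assumes S: "finite S"
    and closed: "\<one>\<^bsub>A\<^esub> \<in> carrier A" "\<And>x y. x \<in> carrier A \<Longrightarrow> y \<in> carrier A \<Longrightarrow> x \<otimes>\<^bsub>A\<^esub> y \<in> carrier A"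
    and \<phi>: "\<And>f. f \<in> S \<Longrightarrow> \<phi> f \<in> ring_hom A R"
    and \<chi>: "\<chi> \<in> ring_hom A R"
    and d: "\<And>f. f \<in> S \<Longrightarrow> d f \<in> carrier R"
    and eq: "\<And>x. x \<in> carrier A \<Longrightarrow> \<chi> x = (\<Oplus>f\<in>S. d f \<otimes> \<phi> f x)"
  obtains f where "f \<in> S" "\<And>x. x \<in> carrier A \<Longrightarrow> \<chi> x = \<phi> f x"
proof -
  have shift: "a \<otimes> (p \<otimes> z) = a \<otimes> (p \<ominus> q) \<otimes> z \<oplus> q \<otimes> (a \<otimes> z)"
    if "a \<in> carrier R" "p \<in> carrier R" "q \<in> carrier R" "z \<in> carrier R" for a p q z
    using that by algebra
  have elim: "e \<otimes> (p \<ominus> q) \<otimes> z = D"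
    if cl: "e \<in> carrier R" "p \<in> carrier R" "z \<in> carrier R" "q \<in> carrier R" "r \<in> carrier R"
      "c \<in> carrier R" "D \<in> carrier R" "s \<in> carrier R"
    and eq: "e \<otimes> (p \<otimes> z) = c \<otimes> (q \<otimes> r) \<oplus> (D \<oplus> q \<otimes> s)" "q \<otimes> (e \<otimes> z) = q \<otimes> (c \<otimes> r \<oplus> s)"
    for e p q r z c D s
  proof -
    have "e \<otimes> (p \<ominus> q) \<otimes> z = e \<otimes> (p \<otimes> z) \<ominus> q \<otimes> (e \<otimes> z)"
      using cl by algebra
    also have "\<dots> = D"
      unfolding eq using cl by algebra
    finally show ?thesis .
  qed
  have False if neq: "\<forall>f\<in>S. \<exists>x\<in>carrier A. \<chi> x \<noteq> \<phi> f x"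
  proof -
    \<comment> \<open>The scalar \<open>e\<close> has to vary in the induction: eliminating
      \<open>g\<close> multiplies the left side by the nonzero difference of \<open>\<chi> y\<close>
      and \<open>\<phi> g y\<close>.\<close>
    have "e = \<zero>" if "e \<in> carrier R" "\<forall>x\<in>carrier A. e \<otimes> \<chi> x = (\<Oplus>f\<in>S. d f \<otimes> \<phi> f x)"
        "\<forall>f\<in>S. d f \<in> carrier R" for d e
      using S neq that \<phi>
    proof (induction S arbitrary: d e)
      case empty
      then show ?case
        using closed(1) ring_hom_one[OF \<chi>] by auto
    next
      case (insert g S)
      obtain y where y: "y \<in> carrier A" "\<chi> y \<noteq> \<phi> g y"
        using insert.prems(1) by blast
      let ?d = "\<lambda>f. d f \<otimes> (\<phi> f y \<ominus> \<phi> g y)"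
      have cl: "\<chi> x \<in> carrier R" "\<phi> g x \<in> carrier R" if "x \<in> carrier A" for x
        using that insert.prems(5)[of g] ring_hom_closed[of _ A R x] \<chi> by blast+
      have cl': "\<phi> f x \<in> carrier R" "d f \<in> carrier R" if "f \<in> S" "x \<in> carrier A" for f x
        using that insert.prems ring_hom_closed[of "\<phi> f" A R x] by auto
      have dg: "d g \<in> carrier R"
        using insert.prems by auto
      have "e \<otimes> (\<chi> y \<ominus> \<phi> g y) \<otimes> \<chi> x = (\<Oplus>f\<in>S. ?d f \<otimes> \<phi> f x)" if x: "x \<in> carrier A" for x
      proof -
        let ?s = "\<lambda>x. \<Oplus>f\<in>S. d f \<otimes> \<phi> f x"
        have sum: "e \<otimes> \<chi> z = d g \<otimes> \<phi> g z \<oplus> ?s z" if z: "z \<in> carrier A" for z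
        proof -
          have "e \<otimes> \<chi> z = (\<Oplus>f\<in>insert g S. d f \<otimes> \<phi> f z)"
            using insert.prems(3) z by blast
          then show ?thesis
            using insert.hyps z cl(2) cl' dg by (subst (asm) finsum_insert) auto
        qed
        have s: "?s z \<in> carrier R" if "z \<in> carrier A" for z
          using that cl' by (intro finsum_closed) auto
        have yx: "y \<otimes>\<^bsub>A\<^esub> x \<in> carrier A"
          using closed(2) x y by blast
        have "?s (y \<otimes>\<^bsub>A\<^esub> x) = (\<Oplus>f\<in>S. ?d f \<otimes> \<phi> f x \<oplus> \<phi> g y \<otimes> (d f \<otimes> \<phi> f x))"
        proof (intro finsum_cong' refl)
          fix f assume f: "f \<in> S"
          then have "\<phi> f (y \<otimes>\<^bsub>A\<^esub> x) = \<phi> f y \<otimes> \<phi> f x"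
            using ring_hom_mult[OF insert.prems(5)[of f] y(1) x] by simp
          then show "d f \<otimes> \<phi> f (y \<otimes>\<^bsub>A\<^esub> x) = ?d f \<otimes> \<phi> f x \<oplus> \<phi> g y \<otimes> (d f \<otimes> \<phi> f x)"
            using shift[OF cl'(2)[OF f x] cl'(1)[OF f y(1)] cl(2)[OF y(1)] cl'(1)[OF f x]] by simp
        qed (use cl cl' x y in auto)
        also have "\<dots> = (\<Oplus>f\<in>S. ?d f \<otimes> \<phi> f x) \<oplus> (\<Oplus>f\<in>S. \<phi> g y \<otimes> (d f \<otimes> \<phi> f x))"
          using cl cl' x y by (intro finsum_addf) auto
        also have "(\<Oplus>f\<in>S. \<phi> g y \<otimes> (d f \<otimes> \<phi> f x)) = \<phi> g y \<otimes> ?s x"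
          using insert.hyps cl cl' x y by (intro finsum_rdistr[symmetric]) auto
        finally have *: "?s (y \<otimes>\<^bsub>A\<^esub> x) = (\<Oplus>f\<in>S. ?d f \<otimes> \<phi> f x) \<oplus> \<phi> g y \<otimes> ?s x" .
        define D where "D = (\<Oplus>f\<in>S. ?d f \<otimes> \<phi> f x)"
        have D: "D \<in> carrier R"
          unfolding D_def using cl cl' x y by (intro finsum_closed) auto
        have "e \<otimes> (\<chi> y \<otimes> \<chi> x) = d g \<otimes> (\<phi> g y \<otimes> \<phi> g x) \<oplus> (D \<oplus> \<phi> g y \<otimes> ?s x)"
          using sum[OF yx] * ring_hom_mult[OF \<chi> y(1) x] ring_hom_mult[OF insert.prems(5)[of g] y(1) x]
          by (simp add: D_def)
        moreover have "\<phi> g y \<otimes> (e \<otimes> \<chi> x) = \<phi> g y \<otimes> (d g \<otimes> \<phi> g x \<oplus> ?s x)"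
          using sum[OF x] by simp
        ultimately have "e \<otimes> (\<chi> y \<ominus> \<phi> g y) \<otimes> \<chi> x = D"
          using elim[OF insert.prems(2) cl(1)[OF y(1)] cl(1)[OF x] cl(2)[OF y(1)] cl(2)[OF x] dg D s[OF x]]
          by blast
        then show ?thesis
          by (simp add: D_def)
      qed
      moreover have "\<forall>f\<in>S. ?d f \<in> carrier R"
        using cl[OF y(1)] cl'[OF _ y(1)] by auto
      ultimately have "e \<otimes> (\<chi> y \<ominus> \<phi> g y) = \<zero>"
        using insert.IH[of "e \<otimes> (\<chi> y \<ominus> \<phi> g y)" ?d] insert.prems cl[OF y(1)] by auto
      then show ?case
        using y(2) cl[OF y(1)] insert.prems(2) by (simp add: integral_iff r_right_minus_eq)
    qed
    from this[of \<one> d] have "\<one> = \<zero>"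
      using eq d ring_hom_closed[OF \<chi>] by simp
    then show False
      by simp
  qed
  then show thesis
    using that by blast
qed

lemma inv_comp_funcset:
  assumes "\<pi> permutes I" "x \<in> I \<rightarrow> C"
  shows "x \<circ> inv' \<pi> \<in> I \<rightarrow> C" "x \<circ> \<pi> \<in> I \<rightarrow> C"
  using assms permutes_in_image[OF permutes_inv[OF assms(1)]] permutes_in_image[OF assms(1)]
  by (auto simp: Pi_iff)

text \<open>Outside \<open>I\<close> the permutation is the identity, so the composite keeps the
  default value there.\<close>

lemma comp_PiE:
  assumes "\<pi> permutes I" "x \<in> I \<rightarrow>\<^sub>E C"
  shows "x \<circ> \<pi> \<in> I \<rightarrow>\<^sub>E C"
  using assms permutes_in_image[OF assms(1)] permutes_not_in[OF assms(1)]
  by (auto simp: PiE_iff extensional_def)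

lemma comp_PiE_image:
  assumes \<pi>: "\<pi> permutes I"
  shows "(\<lambda>x. x \<circ> \<pi>) ` (I \<rightarrow>\<^sub>E C) = (I \<rightarrow>\<^sub>E C)"
proof
  show "(I \<rightarrow>\<^sub>E C) \<subseteq> (\<lambda>x. x \<circ> \<pi>) ` (I \<rightarrow>\<^sub>E C)"
  proof
    fix x assume "x \<in> I \<rightarrow>\<^sub>E C"
    then have "x \<circ> inv' \<pi> \<in> I \<rightarrow>\<^sub>E C"
      using comp_PiE[OF permutes_inv[OF \<pi>]] by blast
    moreover have "x = (x \<circ> inv' \<pi>) \<circ> \<pi>"
      using \<pi> by (simp add: o_assoc[symmetric] permutes_inv_o(2))
    ultimately show "x \<in> (\<lambda>x. x \<circ> \<pi>) ` (I \<rightarrow>\<^sub>E C)"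
      by blast
  qed
qed (use comp_PiE[OF \<pi>] in blast)

lemma comp_inj_on:
  assumes \<pi>: "\<pi> permutes I"
  shows "inj_on (\<lambda>x. x \<circ> \<pi>) T"
  using \<pi> by (intro inj_onI) (metis comp_id o_assoc permutes_inv_o(1))

text \<open>
  \<open>B\<close> abstracts the \<open>n\<close>-th tensor power of \<open>L\<close>: \<open>s\<close> is its structure map, \<open>\<epsilon> i\<close> the inclusion of
  the factor \<open>i\<close>, and \<open>\<phi> f\<close> the product of the homomorphisms \<open>f i\<close>.
\<close>

locale tensor_points = galois_points k L K \<iota> + B: cring B
  for k and L :: "('a, 'm) ring_scheme" (structure) and K :: "('b, 'p) ring_scheme" and \<iota>
    and B :: "('c, 'q) ring_scheme" +
  fixes I :: "nat set" and s :: "'a \<Rightarrow> 'c" and \<epsilon> :: "nat \<Rightarrow> 'a \<Rightarrow> 'c"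
    and act :: "(nat \<Rightarrow> nat) \<Rightarrow> 'c \<Rightarrow> 'c" and \<phi> :: "(nat \<Rightarrow> 'a \<Rightarrow> 'b) \<Rightarrow> 'c \<Rightarrow> 'b"
  assumes finite_I: "finite I"
    and s_hom: "s \<in> ring_hom (L\<lparr>carrier := k\<rparr>) B"
    and \<epsilon>_hom: "i \<in> I \<Longrightarrow> \<epsilon> i \<in> ring_hom L B"
    and \<epsilon>_k: "i \<in> I \<Longrightarrow> c \<in> k \<Longrightarrow> \<epsilon> i c = s c"
    and generated: "b \<in> carrier B \<Longrightarrow> \<exists>T c. finite T \<and> T \<subseteq> (I \<rightarrow>\<^sub>E carrier L) \<and> c \<in> T \<rightarrow> k \<and>
      b = (\<Oplus>\<^bsub>B\<^esub>x\<in>T. s (c x) \<otimes>\<^bsub>B\<^esub> (\<Otimes>\<^bsub>B\<^esub>i\<in>I. \<epsilon> i (x i)))"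
    and \<phi>_hom: "f \<in> I \<rightarrow>\<^sub>E points \<Longrightarrow> \<phi> f \<in> ring_hom B K"
    and \<phi>_s: "f \<in> I \<rightarrow>\<^sub>E points \<Longrightarrow> c \<in> k \<Longrightarrow> \<phi> f (s c) = \<iota> c"
    and \<phi>_\<epsilon>: "f \<in> I \<rightarrow>\<^sub>E points \<Longrightarrow> i \<in> I \<Longrightarrow> y \<in> carrier L \<Longrightarrow> \<phi> f (\<epsilon> i y) = f i y"
    and act_hom: "\<pi> permutes I \<Longrightarrow> act \<pi> \<in> ring_hom B B"
    and act_s: "\<pi> permutes I \<Longrightarrow> c \<in> k \<Longrightarrow> act \<pi> (s c) = s c"
    and act_\<epsilon>: "\<pi> permutes I \<Longrightarrow> i \<in> I \<Longrightarrow> y \<in> carrier L \<Longrightarrow> act \<pi> (\<epsilon> i y) = \<epsilon> (\<pi> i) y"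
begin

definition invariants :: "'c set"
  where "invariants = {b \<in> carrier B. \<forall>\<pi>. \<pi> permutes I \<longrightarrow> act \<pi> b = b}"

lemma s_closed [simp]: "c \<in> k \<Longrightarrow> s c \<in> carrier B"
  using ring_hom_closed[OF s_hom] by simp

lemma s_mult: "c \<in> k \<Longrightarrow> d \<in> k \<Longrightarrow> s (c \<otimes> d) = s c \<otimes>\<^bsub>B\<^esub> s d"
  using ring_hom_mult[OF s_hom] by simp

lemma s_add: "c \<in> k \<Longrightarrow> d \<in> k \<Longrightarrow> s (c \<oplus> d) = s c \<oplus>\<^bsub>B\<^esub> s d"
  using ring_hom_add[OF s_hom] by simp

lemma \<epsilon>_closed [simp]: "i \<in> I \<Longrightarrow> y \<in> carrier L \<Longrightarrow> \<epsilon> i y \<in> carrier B"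
  using ring_hom_closed[OF \<epsilon>_hom] by simp

lemma ring_hom_cring_\<phi>: "f \<in> I \<rightarrow>\<^sub>E points \<Longrightarrow> ring_hom_cring B K (\<phi> f)"
  by unfold_locales (rule \<phi>_hom)

lemma ring_hom_cring_act: "\<pi> permutes I \<Longrightarrow> ring_hom_cring B B (act \<pi>)"
  by unfold_locales (rule act_hom)

lemma ring_hom_cring_\<epsilon>: "i \<in> I \<Longrightarrow> ring_hom_cring L B (\<epsilon> i)"
  by unfold_locales (rule \<epsilon>_hom)

definition pure :: "(nat \<Rightarrow> 'a) \<Rightarrow> 'c"
  where "pure x = (\<Otimes>\<^bsub>B\<^esub>i\<in>I. \<epsilon> i (x i))"

lemma pure_closed [simp]: "x \<in> I \<rightarrow> carrier L \<Longrightarrow> pure x \<in> carrier B"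
  unfolding pure_def by (intro B.finprod_closed) (auto simp: Pi_iff)

lemma \<phi>_pure:
  assumes f: "f \<in> I \<rightarrow>\<^sub>E points" and x: "x \<in> I \<rightarrow> carrier L"
  shows "\<phi> f (pure x) = (\<Otimes>\<^bsub>K\<^esub>i\<in>I. f i (x i))"
proof -
  interpret h: ring_hom_cring B K "\<phi> f" using ring_hom_cring_\<phi>[OF f] .
  have "\<phi> f (pure x) = (\<Otimes>\<^bsub>K\<^esub>i\<in>I. \<phi> f (\<epsilon> i (x i)))"
    unfolding pure_def using x by (subst h.hom_finprod) (auto simp: o_def Pi_iff)
  also have "\<dots> = (\<Otimes>\<^bsub>K\<^esub>i\<in>I. f i (x i))"
    using f x \<phi>_\<epsilon>[OF f] by (intro K.finprod_cong') (auto simp: Pi_iff PiE_iff)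
  finally show ?thesis .
qed

text \<open>Factor \<open>i\<close> moves to place \<open>\<pi> i\<close>, so place \<open>i\<close>
  receives the entry that was at \<open>inv' \<pi> i\<close>.\<close>

lemma act_pure:
  assumes \<pi>: "\<pi> permutes I" and x: "x \<in> I \<rightarrow> carrier L"
  shows "act \<pi> (pure x) = pure (x \<circ> inv' \<pi>)"
proof -
  interpret h: ring_hom_cring B B "act \<pi>" using ring_hom_cring_act[OF \<pi>] .
  have "act \<pi> (pure x) = (\<Otimes>\<^bsub>B\<^esub>i\<in>I. act \<pi> (\<epsilon> i (x i)))"
    unfolding pure_def using x by (subst h.hom_finprod) (auto simp: o_def Pi_iff)
  also have "\<dots> = (\<Otimes>\<^bsub>B\<^esub>i\<in>I. \<epsilon> (\<pi> i) ((x \<circ> inv' \<pi>) (\<pi> i)))"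
    using x \<pi> act_\<epsilon>[OF \<pi>]
    by (intro B.finprod_cong') (auto simp: Pi_iff permutes_in_image permutes_inverses)
  also have "\<dots> = (\<Otimes>\<^bsub>B\<^esub>i\<in>\<pi> ` I. \<epsilon> i ((x \<circ> inv' \<pi>) i))"
    using x \<pi>
    by (subst B.finprod_reindex) (auto simp: Pi_iff permutes_in_image permutes_inverses permutes_inj_on)
  finally show ?thesis
    using \<pi> by (simp add: pure_def permutes_image)
qed

text \<open>For additive statements about \<open>B\<close> this replaces a basis: they are checked
  on scalar multiples of pure tensors, with no need for unique representations.\<close>

lemma pure_induct [consumes 1, case_names pure zero add]:
  assumes b: "b \<in> carrier B"
    and pure: "\<And>c x. c \<in> k \<Longrightarrow> x \<in> I \<rightarrow>\<^sub>E carrier L \<Longrightarrow> P (s c \<otimes>\<^bsub>B\<^esub> pure x)"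
    and zero: "P \<zero>\<^bsub>B\<^esub>"
    and add: "\<And>u v. u \<in> carrier B \<Longrightarrow> v \<in> carrier B \<Longrightarrow> P u \<Longrightarrow> P v \<Longrightarrow> P (u \<oplus>\<^bsub>B\<^esub> v)"
  shows "P b"
proof -
  obtain T c where T: "finite T" "T \<subseteq> (I \<rightarrow>\<^sub>E carrier L)" "c \<in> T \<rightarrow> k"
    and b_eq: "b = (\<Oplus>\<^bsub>B\<^esub>x\<in>T. s (c x) \<otimes>\<^bsub>B\<^esub> pure x)"
    using generated[OF b] by (auto simp: pure_def)
  have "P (\<Oplus>\<^bsub>B\<^esub>x\<in>T. s (c x) \<otimes>\<^bsub>B\<^esub> pure x)"
    using T
  proof (induction T)
    case empty
    then show ?case using zero by simp
  next
    case (insert x T)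
    have cl: "s (c y) \<otimes>\<^bsub>B\<^esub> pure y \<in> carrier B" if "y \<in> insert x T" for y
      using insert.prems that by (intro B.m_closed pure_closed s_closed) (auto simp: Pi_iff)
    then have "(\<Oplus>\<^bsub>B\<^esub>y\<in>T. s (c y) \<otimes>\<^bsub>B\<^esub> pure y) \<in> carrier B"
      by (intro B.finsum_closed) auto
    then show ?case
      using insert cl by (subst B.finsum_insert) (auto intro!: add pure)
  qed
  then show ?thesis
    by (simp add: b_eq)
qed

text \<open>Both sides are additive in \<open>b\<close>. On a pure tensor, reindexing the product by
  \<open>\<pi>\<close> pairs the point \<open>f (\<pi> i)\<close> with the entry
  \<open>x i\<close>.\<close>

lemma \<phi>_act:
  assumes f: "f \<in> I \<rightarrow>\<^sub>E points" and \<pi>: "\<pi> permutes I" and b: "b \<in> carrier B"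
  shows "\<phi> f (act \<pi> b) = \<phi> (f \<circ> \<pi>) b"
proof -
  define g where "g = f \<circ> \<pi>"
  have g: "g \<in> I \<rightarrow>\<^sub>E points"
    using comp_PiE[OF \<pi> f] by (simp add: g_def)
  interpret h: ring_hom_cring B K "\<phi> f" using ring_hom_cring_\<phi>[OF f] .
  interpret h': ring_hom_cring B K "\<phi> g" using ring_hom_cring_\<phi>[OF g] .
  interpret a: ring_hom_cring B B "act \<pi>" using ring_hom_cring_act[OF \<pi>] .
  have "\<phi> f (act \<pi> b) = \<phi> g b"
    using b
  proof (induction rule: pure_induct)
    case (pure c x)
    then have x: "x \<in> I \<rightarrow> carrier L"
      by auto
    have "\<phi> f (pure (x \<circ> inv' \<pi>)) = (\<Otimes>\<^bsub>K\<^esub>i\<in>\<pi> ` I. f i ((x \<circ> inv' \<pi>) i))"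
      using \<phi>_pure[OF f inv_comp_funcset(1)[OF \<pi> x]] by (simp add: permutes_image[OF \<pi>])
    also have "\<dots> = (\<Otimes>\<^bsub>K\<^esub>i\<in>I. f (\<pi> i) ((x \<circ> inv' \<pi>) (\<pi> i)))"
      using f x \<pi> inv_comp_funcset(1)[OF \<pi> x]
      by (intro K.finprod_reindex) (auto simp: permutes_image permutes_inj_on Pi_iff PiE_iff)
    also have "\<dots> = \<phi> g (pure x)"
      using \<phi>_pure[OF g x] permutes_inverses(2)[OF \<pi>] by (simp add: g_def)
    finally show ?case
      using pure.hyps x inv_comp_funcset(1)[OF \<pi> x] f g \<pi>
      by (simp add: act_pure act_s \<phi>_s)
  qed (use h.hom_zero h'.hom_zero a.hom_zero in auto)
  then show ?thesis
    by (simp add: g_def)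
qed

lemma \<phi>_invariants:
  assumes "f \<in> I \<rightarrow>\<^sub>E points" "\<pi> permutes I" "b \<in> invariants"
  shows "\<phi> (f \<circ> \<pi>) b = \<phi> f b"
  using \<phi>_act[OF assms(1,2), of b] assms(2,3) by (simp add: invariants_def)

lemma subring_invariants: "subring invariants B"
proof (rule B.subringI)
  show "invariants \<subseteq> carrier B"
    by (auto simp: invariants_def)
  show "\<one>\<^bsub>B\<^esub> \<in> invariants"
    using act_hom ring_hom_one by (fastforce simp: invariants_def)
next
  fix x y assume xy: "x \<in> invariants" "y \<in> invariants"
  then show "x \<otimes>\<^bsub>B\<^esub> y \<in> invariants" "x \<oplus>\<^bsub>B\<^esub> y \<in> invariants"
    using act_hom ring_hom_mult ring_hom_add by (fastforce simp: invariants_def)+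
next
  fix x assume x: "x \<in> invariants"
  have "act \<pi> (\<ominus>\<^bsub>B\<^esub> x) = \<ominus>\<^bsub>B\<^esub> x" if \<pi>: "\<pi> permutes I" for \<pi>
  proof -
    interpret h: ring_hom_cring B B "act \<pi>" using ring_hom_cring_act[OF \<pi>] .
    show ?thesis
      using x \<pi> by (simp add: invariants_def)
  qed
  then show "\<ominus>\<^bsub>B\<^esub> x \<in> invariants"
    using x by (simp add: invariants_def)
qed

lemma invariants_closed: "b \<in> invariants \<Longrightarrow> b \<in> carrier B"
  by (simp add: invariants_def)

lemma s_in_invariants: "c \<in> k \<Longrightarrow> s c \<in> invariants"
  by (simp add: invariants_def act_s)

lemma s_finprod:
  assumes "finite S" "t \<in> S \<rightarrow> k"
  shows "(\<Otimes>i\<in>S. t i) \<in> k" "s (\<Otimes>i\<in>S. t i) = (\<Otimes>\<^bsub>B\<^esub>i\<in>S. s (t i))"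
proof -
  have "(\<Otimes>i\<in>S. t i) \<in> k \<and> s (\<Otimes>i\<in>S. t i) = (\<Otimes>\<^bsub>B\<^esub>i\<in>S. s (t i))"
    using assms
  proof (induction S)
    case empty
    then show ?case
      using subringE(3)[OF k_subring] ring_hom_one[OF s_hom] by simp
  next
    case (insert i S)
    have t: "t j \<in> k" "t j \<in> carrier L" if "j \<in> insert i S" for j
      using insert.prems k_subset that by auto
    then show ?case
      using insert subringE(6)[OF k_subring] s_mult by (simp add: Pi_iff)
  qed
  then show "(\<Otimes>i\<in>S. t i) \<in> k" "s (\<Otimes>i\<in>S. t i) = (\<Otimes>\<^bsub>B\<^esub>i\<in>S. s (t i))"
    by auto
qed

lemma finite_multipoints: "finite (I \<rightarrow>\<^sub>E points)"
  using finite_I finite_points by (intro finite_PiE) auto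

end

section \<open>Coordinates with respect to a dual system\<close>

locale tensor_points_dual = tensor_points +
  fixes m :: nat and \<alpha> \<beta>
  assumes \<alpha>_closed: "j < m \<Longrightarrow> \<alpha> j \<in> carrier L"
    and \<beta>_closed: "j < m \<Longrightarrow> \<beta> j \<in> carrier L"
    and dual: "f \<in> points \<Longrightarrow> g \<in> points \<Longrightarrow>
      (\<Oplus>\<^bsub>K\<^esub>j\<in>{..<m}. g (\<alpha> j) \<otimes>\<^bsub>K\<^esub> f (\<beta> j)) = (if f = g then \<one>\<^bsub>K\<^esub> else \<zero>\<^bsub>K\<^esub>)"
begin

text \<open>The trace of the product of \<open>\<beta> j\<close> and \<open>x\<close>, as an element
  of \<open>k\<close>. It is known only through its image in \<open>K\<close>, which determines it
  as \<open>\<iota>\<close> is injective.\<close>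

definition coord
  where "coord j x = (SOME t. t \<in> k \<and> \<iota> t = (\<Oplus>\<^bsub>K\<^esub>f\<in>points. f (\<beta> j \<otimes> x)))"

lemma coord:
  assumes "j < m" "x \<in> carrier L"
  shows "coord j x \<in> k" "\<iota> (coord j x) = (\<Oplus>\<^bsub>K\<^esub>f\<in>points. f (\<beta> j \<otimes> x))"
proof -
  have "\<beta> j \<otimes> x \<in> carrier L"
    using assms \<beta>_closed by simp
  then have "\<exists>t. t \<in> k \<and> \<iota> t = (\<Oplus>\<^bsub>K\<^esub>f\<in>points. f (\<beta> j \<otimes> x))"
    by (rule trace_in_k) blast
  from someI_ex[OF this] show "coord j x \<in> k" "\<iota> (coord j x) = (\<Oplus>\<^bsub>K\<^esub>f\<in>points. f (\<beta> j \<otimes> x))"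
    unfolding coord_def by auto
qed

lemma point_mult: "f \<in> points \<Longrightarrow> x \<in> carrier L \<Longrightarrow> y \<in> carrier L \<Longrightarrow> f (x \<otimes> y) = f x \<otimes>\<^bsub>K\<^esub> f y"
  by (intro ring_hom_mult) (simp_all add: points_iff)

text \<open>After \<open>\<iota>\<close>, the right side is the sum over \<open>f\<close> of
  \<open>f x\<close> times the dual pairing of \<open>f\<close> with \<open>point0\<close>, so only
  \<open>f = point0\<close> contributes, with value \<open>\<iota> x\<close>.\<close>

lemma expand:
  assumes x: "x \<in> carrier L"
  shows "x = (\<Oplus>j\<in>{..<m}. \<alpha> j \<otimes> coord j x)"
proof -
  have c: "coord j x \<in> carrier L" if "j < m" for j
    using coord(1)[OF that x] k_subset by auto
  have "\<iota> (\<Oplus>j\<in>{..<m}. \<alpha> j \<otimes> coord j x) = (\<Oplus>\<^bsub>K\<^esub>j\<in>{..<m}. \<iota> (\<alpha> j) \<otimes>\<^bsub>K\<^esub> \<iota> (coord j x))"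
    using c \<alpha>_closed by (subst \<iota>.hom_finsum) (auto simp: Pi_iff intro!: K.finsum_cong')
  also have "\<dots> = (\<Oplus>\<^bsub>K\<^esub>j\<in>{..<m}. \<Oplus>\<^bsub>K\<^esub>f\<in>points. (\<iota> (\<alpha> j) \<otimes>\<^bsub>K\<^esub> f (\<beta> j)) \<otimes>\<^bsub>K\<^esub> f x)"
  proof (intro K.finsum_cong' refl)
    fix j assume "j \<in> {..<m}"
    then have j: "j < m" by simp
    have "\<iota> (\<alpha> j) \<otimes>\<^bsub>K\<^esub> \<iota> (coord j x) = (\<Oplus>\<^bsub>K\<^esub>f\<in>points. \<iota> (\<alpha> j) \<otimes>\<^bsub>K\<^esub> f (\<beta> j \<otimes> x))"
      unfolding coord(2)[OF j x] using j x \<alpha>_closed \<beta>_closed finite_points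
      by (intro K.finsum_rdistr) auto
    also have "\<dots> = (\<Oplus>\<^bsub>K\<^esub>f\<in>points. (\<iota> (\<alpha> j) \<otimes>\<^bsub>K\<^esub> f (\<beta> j)) \<otimes>\<^bsub>K\<^esub> f x)"
      using j x \<alpha>_closed \<beta>_closed by (intro K.finsum_cong') (auto simp: point_mult K.m_assoc)
    finally show "\<iota> (\<alpha> j) \<otimes>\<^bsub>K\<^esub> \<iota> (coord j x) = (\<Oplus>\<^bsub>K\<^esub>f\<in>points. (\<iota> (\<alpha> j) \<otimes>\<^bsub>K\<^esub> f (\<beta> j)) \<otimes>\<^bsub>K\<^esub> f x)" .
  qed (use x \<alpha>_closed \<beta>_closed in auto)
  also have "\<dots> = (\<Oplus>\<^bsub>K\<^esub>f\<in>points. \<Oplus>\<^bsub>K\<^esub>j\<in>{..<m}. (\<iota> (\<alpha> j) \<otimes>\<^bsub>K\<^esub> f (\<beta> j)) \<otimes>\<^bsub>K\<^esub> f x)"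
    using x \<alpha>_closed \<beta>_closed finite_points by (intro K.finsum_swap) auto
  also have "\<dots> = (\<Oplus>\<^bsub>K\<^esub>f\<in>points. if f = point0 then f x else \<zero>\<^bsub>K\<^esub>)"
  proof (intro K.finsum_cong' refl)
    fix f assume f: "f \<in> points"
    have "(\<Oplus>\<^bsub>K\<^esub>j\<in>{..<m}. (\<iota> (\<alpha> j) \<otimes>\<^bsub>K\<^esub> f (\<beta> j)) \<otimes>\<^bsub>K\<^esub> f x) = (\<Oplus>\<^bsub>K\<^esub>j\<in>{..<m}. \<iota> (\<alpha> j) \<otimes>\<^bsub>K\<^esub> f (\<beta> j)) \<otimes>\<^bsub>K\<^esub> f x"
      using f x \<alpha>_closed \<beta>_closed by (intro K.finsum_ldistr[symmetric]) auto
    also have "(\<Oplus>\<^bsub>K\<^esub>j\<in>{..<m}. \<iota> (\<alpha> j) \<otimes>\<^bsub>K\<^esub> f (\<beta> j)) = (\<Oplus>\<^bsub>K\<^esub>j\<in>{..<m}. point0 (\<alpha> j) \<otimes>\<^bsub>K\<^esub> f (\<beta> j))"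
      using f \<alpha>_closed \<beta>_closed point0 by (intro K.finsum_cong') auto
    also have "\<dots> = (if f = point0 then \<one>\<^bsub>K\<^esub> else \<zero>\<^bsub>K\<^esub>)"
      by (rule dual[OF f point0(1)])
    finally show "(\<Oplus>\<^bsub>K\<^esub>j\<in>{..<m}. (\<iota> (\<alpha> j) \<otimes>\<^bsub>K\<^esub> f (\<beta> j)) \<otimes>\<^bsub>K\<^esub> f x) = (if f = point0 then f x else \<zero>\<^bsub>K\<^esub>)"
      using point_closed[OF f x] by auto
  qed (use x in auto)
  also have "\<dots> = \<iota> x"
    using finite_points point0 x by (subst K.finsum_eq_single[of _ point0]) auto
  finally show ?thesis
    using c \<alpha>_closed x by (intro inj_onD[OF inj_on_\<iota>]) (auto intro!: finsum_closed)
qed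

abbreviation indices :: "(nat \<Rightarrow> nat) set"
  where "indices \<equiv> I \<rightarrow>\<^sub>E {..<m}"

text \<open>A generating family over \<open>k\<close>; the \<open>\<alpha> j\<close> may be
  dependent, so it need not be a basis.\<close>

definition basis
  where "basis J = pure (\<lambda>i. \<alpha> (J i))"

text \<open>The coefficients dual to \<open>basis\<close>: by duality at each place, the sum over
  \<open>J\<close> of \<open>weight f J\<close> times \<open>\<phi> g (basis J)\<close> is one for
  \<open>f = g\<close> and zero otherwise.\<close>

definition weight
  where "weight f J = (\<Otimes>\<^bsub>K\<^esub>i\<in>I. f i (\<beta> (J i)))"

lemma finite_indices: "finite indices"
  using finite_I by (intro finite_PiE) auto

lemma indices_less: "J \<in> indices \<Longrightarrow> i \<in> I \<Longrightarrow> J i < m"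
  by (auto simp: PiE_iff)

lemma multipoint: "f \<in> I \<rightarrow>\<^sub>E points \<Longrightarrow> i \<in> I \<Longrightarrow> f i \<in> points"
  by (auto simp: PiE_iff)

lemma basis_closed [simp]: "J \<in> indices \<Longrightarrow> basis J \<in> carrier B"
  unfolding basis_def using indices_less \<alpha>_closed by (intro pure_closed) auto

lemma weight_closed [simp]: "f \<in> I \<rightarrow>\<^sub>E points \<Longrightarrow> J \<in> indices \<Longrightarrow> weight f J \<in> carrier K"
  unfolding weight_def using indices_less \<beta>_closed multipoint by (intro K.finprod_closed) auto

lemma \<phi>_closed [simp]: "f \<in> I \<rightarrow>\<^sub>E points \<Longrightarrow> b \<in> carrier B \<Longrightarrow> \<phi> f b \<in> carrier K"
  using ring_hom_closed[OF \<phi>_hom] .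

text \<open>A product of traces, one per place, is multiplied out over all tuples of points;
  multiplicativity of points then splits off the factor that contains the
  \<open>\<beta> j\<close>.\<close>

lemma pure_coordinates:
  assumes x: "x \<in> I \<rightarrow> carrier L" and c: "c \<in> k" and J: "J \<in> indices"
  shows "\<iota> (c \<otimes> (\<Otimes>i\<in>I. coord (J i) (x i))) =
    (\<Oplus>\<^bsub>K\<^esub>f\<in>I \<rightarrow>\<^sub>E points. weight f J \<otimes>\<^bsub>K\<^esub> \<phi> f (s c \<otimes>\<^bsub>B\<^esub> pure x))"
proof -
  have x': "x i \<in> carrier L" if "i \<in> I" for i
    using x that by auto
  have J': "J i < m" if "i \<in> I" for i
    using indices_less[OF J that] .
  have t: "coord (J i) (x i) \<in> k" "coord (J i) (x i) \<in> carrier L" if "i \<in> I" for i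
    using coord(1)[OF J' x'] that k_subset by auto
  have bx: "f (\<beta> (J i) \<otimes> x i) \<in> carrier K" if "f \<in> points" "i \<in> I" for f i
    using that x' J' \<beta>_closed by auto
  have "\<iota> (c \<otimes> (\<Otimes>i\<in>I. coord (J i) (x i))) = \<iota> c \<otimes>\<^bsub>K\<^esub> (\<Otimes>\<^bsub>K\<^esub>i\<in>I. \<iota> (coord (J i) (x i)))"
    using c k_subset t by (subst \<iota>.hom_mult) (auto simp: \<iota>.hom_finprod Pi_iff o_def intro!: finprod_closed)
  also have "(\<Otimes>\<^bsub>K\<^esub>i\<in>I. \<iota> (coord (J i) (x i))) = (\<Otimes>\<^bsub>K\<^esub>i\<in>I. \<Oplus>\<^bsub>K\<^esub>f\<in>points. f (\<beta> (J i) \<otimes> x i))"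
    using J' x' bx by (intro K.finprod_cong' coord(2)) (auto intro!: K.finsum_closed)
  also have "\<dots> = (\<Oplus>\<^bsub>K\<^esub>f\<in>I \<rightarrow>\<^sub>E points. \<Otimes>\<^bsub>K\<^esub>i\<in>I. f i (\<beta> (J i) \<otimes> x i))"
    using finite_I finite_points bx by (intro K.finprod_finsum) auto
  also have "\<iota> c \<otimes>\<^bsub>K\<^esub> \<dots> = (\<Oplus>\<^bsub>K\<^esub>f\<in>I \<rightarrow>\<^sub>E points. \<iota> c \<otimes>\<^bsub>K\<^esub> (\<Otimes>\<^bsub>K\<^esub>i\<in>I. f i (\<beta> (J i) \<otimes> x i)))"
    using c k_subset finite_multipoints bx multipoint
    by (intro K.finsum_rdistr) (auto intro!: K.finprod_closed)
  also have "\<dots> = (\<Oplus>\<^bsub>K\<^esub>f\<in>I \<rightarrow>\<^sub>E points. weight f J \<otimes>\<^bsub>K\<^esub> \<phi> f (s c \<otimes>\<^bsub>B\<^esub> pure x))"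
  proof (intro K.finsum_cong' refl)
    fix f assume f: "f \<in> I \<rightarrow>\<^sub>E points"
    interpret h: ring_hom_cring B K "\<phi> f" using ring_hom_cring_\<phi>[OF f] .
    have fx: "(\<Otimes>\<^bsub>K\<^esub>i\<in>I. f i (x i)) \<in> carrier K"
      using f x' multipoint by (intro K.finprod_closed) auto
    have "(\<Otimes>\<^bsub>K\<^esub>i\<in>I. f i (\<beta> (J i) \<otimes> x i)) = (\<Otimes>\<^bsub>K\<^esub>i\<in>I. f i (\<beta> (J i)) \<otimes>\<^bsub>K\<^esub> f i (x i))"
      using f x' J' \<beta>_closed multipoint by (intro K.finprod_cong') (auto simp: point_mult)
    also have "\<dots> = weight f J \<otimes>\<^bsub>K\<^esub> (\<Otimes>\<^bsub>K\<^esub>i\<in>I. f i (x i))"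
      unfolding weight_def using f x' J' \<beta>_closed multipoint by (intro K.finprod_multf) auto
    finally show "\<iota> c \<otimes>\<^bsub>K\<^esub> (\<Otimes>\<^bsub>K\<^esub>i\<in>I. f i (\<beta> (J i) \<otimes> x i)) = weight f J \<otimes>\<^bsub>K\<^esub> \<phi> f (s c \<otimes>\<^bsub>B\<^esub> pure x)"
      using f c k_subset x \<phi>_pure[OF f x] \<phi>_s[OF f c] weight_closed[OF f J] fx
      by (simp add: K.m_lcomm subset_iff)
  qed (use J x c in auto)
  finally show ?thesis .
qed

text \<open>Each entry is expanded by the dual system and the product is multiplied out. The
  coordinates lie in \<open>k\<close>, so by \<open>\<epsilon>_k\<close> they are scalars of
  \<open>B\<close> at every place and can be collected.\<close>

lemma pure_expand:
  assumes x: "x \<in> I \<rightarrow> carrier L" and c: "c \<in> k"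
  shows "s c \<otimes>\<^bsub>B\<^esub> pure x = (\<Oplus>\<^bsub>B\<^esub>J\<in>indices. s (c \<otimes> (\<Otimes>i\<in>I. coord (J i) (x i))) \<otimes>\<^bsub>B\<^esub> basis J)"
proof -
  have x': "x i \<in> carrier L" if "i \<in> I" for i
    using x that by auto
  have t: "coord j (x i) \<in> k" "coord j (x i) \<in> carrier L" if "i \<in> I" "j < m" for i j
    using coord(1)[OF _ x'] that k_subset by auto
  have "pure x = (\<Otimes>\<^bsub>B\<^esub>i\<in>I. \<Oplus>\<^bsub>B\<^esub>j\<in>{..<m}. \<epsilon> i (\<alpha> j) \<otimes>\<^bsub>B\<^esub> s (coord j (x i)))"
    unfolding pure_def
  proof (intro B.finprod_cong' refl)
    fix i assume i: "i \<in> I"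
    interpret h: ring_hom_cring L B "\<epsilon> i" using ring_hom_cring_\<epsilon>[OF i] .
    have "\<epsilon> i (x i) = \<epsilon> i (\<Oplus>j\<in>{..<m}. \<alpha> j \<otimes> coord j (x i))"
      using expand[OF x'[OF i]] by simp
    also have "\<dots> = (\<Oplus>\<^bsub>B\<^esub>j\<in>{..<m}. \<epsilon> i (\<alpha> j) \<otimes>\<^bsub>B\<^esub> s (coord j (x i)))"
      using i t \<alpha>_closed \<epsilon>_k[OF i] by (subst h.hom_finsum) (auto simp: Pi_iff intro!: B.finsum_cong')
    finally show "\<epsilon> i (x i) = (\<Oplus>\<^bsub>B\<^esub>j\<in>{..<m}. \<epsilon> i (\<alpha> j) \<otimes>\<^bsub>B\<^esub> s (coord j (x i)))" .
  qed (use t \<alpha>_closed in \<open>auto intro!: B.finsum_closed\<close>)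
  also have "\<dots> = (\<Oplus>\<^bsub>B\<^esub>J\<in>indices. \<Otimes>\<^bsub>B\<^esub>i\<in>I. \<epsilon> i (\<alpha> (J i)) \<otimes>\<^bsub>B\<^esub> s (coord (J i) (x i)))"
    using finite_I t \<alpha>_closed by (intro B.finprod_finsum) auto
  also have "s c \<otimes>\<^bsub>B\<^esub> \<dots> = (\<Oplus>\<^bsub>B\<^esub>J\<in>indices. s c \<otimes>\<^bsub>B\<^esub> (\<Otimes>\<^bsub>B\<^esub>i\<in>I. \<epsilon> i (\<alpha> (J i)) \<otimes>\<^bsub>B\<^esub> s (coord (J i) (x i))))"
    using finite_indices c t \<alpha>_closed indices_less by (intro B.finsum_rdistr) (auto intro!: B.finprod_closed)
  also have "\<dots> = (\<Oplus>\<^bsub>B\<^esub>J\<in>indices. s (c \<otimes> (\<Otimes>i\<in>I. coord (J i) (x i))) \<otimes>\<^bsub>B\<^esub> basis J)"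
  proof (intro B.finsum_cong' refl)
    fix J assume J: "J \<in> indices"
    have J': "J i < m" if "i \<in> I" for i
      using indices_less[OF J that] .
    have "(\<Otimes>\<^bsub>B\<^esub>i\<in>I. \<epsilon> i (\<alpha> (J i)) \<otimes>\<^bsub>B\<^esub> s (coord (J i) (x i))) =
        basis J \<otimes>\<^bsub>B\<^esub> (\<Otimes>\<^bsub>B\<^esub>i\<in>I. s (coord (J i) (x i)))"
      unfolding basis_def pure_def using t J' \<alpha>_closed by (intro B.finprod_multf) auto
    also have "(\<Otimes>\<^bsub>B\<^esub>i\<in>I. s (coord (J i) (x i))) = s (\<Otimes>i\<in>I. coord (J i) (x i))"
      using s_finprod(2)[OF finite_I, of "\<lambda>i. coord (J i) (x i)"] t J' by simp
    finally show "s c \<otimes>\<^bsub>B\<^esub> (\<Otimes>\<^bsub>B\<^esub>i\<in>I. \<epsilon> i (\<alpha> (J i)) \<otimes>\<^bsub>B\<^esub> s (coord (J i) (x i))) =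
        s (c \<otimes> (\<Otimes>i\<in>I. coord (J i) (x i))) \<otimes>\<^bsub>B\<^esub> basis J"
      using c J s_finprod(1)[OF finite_I, of "\<lambda>i. coord (J i) (x i)"] t J'
      by (simp add: s_mult B.m_ac)
  next
    show "(\<lambda>J. s (c \<otimes> (\<Otimes>i\<in>I. coord (J i) (x i))) \<otimes>\<^bsub>B\<^esub> basis J) \<in> indices \<rightarrow> carrier B"
    proof
      fix J assume J: "J \<in> indices"
      then have "c \<otimes> (\<Otimes>i\<in>I. coord (J i) (x i)) \<in> k"
        using c t indices_less by (intro subringE(6)[OF k_subring] s_finprod(1) finite_I) auto
      then show "s (c \<otimes> (\<Otimes>i\<in>I. coord (J i) (x i))) \<otimes>\<^bsub>B\<^esub> basis J \<in> carrier B"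
        using J by simp
    qed
  qed
  finally show ?thesis .
qed

text \<open>Both formulas are additive in \<open>b\<close>, so pure tensors suffice. The second one
  is the point: it ties the coefficients to the values \<open>\<phi> f b\<close>, whatever
  representation of \<open>b\<close> the induction went through.\<close>

lemma coordinates:
  assumes "b \<in> carrier B"
  shows "\<exists>q \<in> indices \<rightarrow> k. b = (\<Oplus>\<^bsub>B\<^esub>J\<in>indices. s (q J) \<otimes>\<^bsub>B\<^esub> basis J) \<and>
    (\<forall>J\<in>indices. \<iota> (q J) = (\<Oplus>\<^bsub>K\<^esub>f\<in>I \<rightarrow>\<^sub>E points. weight f J \<otimes>\<^bsub>K\<^esub> \<phi> f b))"
  using assms
proof (induction rule: pure_induct)
  case (pure c x)
  then have x: "x \<in> I \<rightarrow> carrier L"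
    by auto
  let ?q = "\<lambda>J. c \<otimes> (\<Otimes>i\<in>I. coord (J i) (x i))"
  have "?q \<in> indices \<rightarrow> k"
    using pure.hyps funcset_mem[OF x] coord(1) indices_less
    by (intro funcsetI subringE(6)[OF k_subring] s_finprod(1) finite_I) auto
  then show ?case
    using pure_expand[OF x pure.hyps(1)] pure_coordinates[OF x pure.hyps(1)]
    by (intro bexI[of _ ?q] conjI ballI)
next
  case zero
  have "\<iota> \<zero> = (\<Oplus>\<^bsub>K\<^esub>f\<in>I \<rightarrow>\<^sub>E points. weight f J \<otimes>\<^bsub>K\<^esub> \<phi> f \<zero>\<^bsub>B\<^esub>)" if "J \<in> indices" for J
  proof -
    have "(\<Oplus>\<^bsub>K\<^esub>f\<in>I \<rightarrow>\<^sub>E points. weight f J \<otimes>\<^bsub>K\<^esub> \<phi> f \<zero>\<^bsub>B\<^esub>) = (\<Oplus>\<^bsub>K\<^esub>f\<in>I \<rightarrow>\<^sub>E points. \<zero>\<^bsub>K\<^esub>)"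
      using that ring_hom_zero[OF \<phi>_hom B.ring_axioms K.ring_axioms] by (intro K.finsum_cong') auto
    then show ?thesis
      using \<iota>.hom_zero by simp
  qed
  moreover have "(\<Oplus>\<^bsub>B\<^esub>J\<in>indices. s \<zero> \<otimes>\<^bsub>B\<^esub> basis J) = (\<Oplus>\<^bsub>B\<^esub>J\<in>indices. \<zero>\<^bsub>B\<^esub>)"
    using ring_hom_zero[OF s_hom subring_is_ring[OF k_subring] B.ring_axioms]
    by (intro B.finsum_cong') auto
  ultimately show ?case
    using subringE(2)[OF k_subring] by (intro bexI[of _ "\<lambda>_. \<zero>"]) auto
next
  case (add u v)
  then obtain q r where q: "q \<in> indices \<rightarrow> k" "u = (\<Oplus>\<^bsub>B\<^esub>J\<in>indices. s (q J) \<otimes>\<^bsub>B\<^esub> basis J)"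
      "\<And>J. J \<in> indices \<Longrightarrow> \<iota> (q J) = (\<Oplus>\<^bsub>K\<^esub>f\<in>I \<rightarrow>\<^sub>E points. weight f J \<otimes>\<^bsub>K\<^esub> \<phi> f u)"
    and r: "r \<in> indices \<rightarrow> k" "v = (\<Oplus>\<^bsub>B\<^esub>J\<in>indices. s (r J) \<otimes>\<^bsub>B\<^esub> basis J)"
      "\<And>J. J \<in> indices \<Longrightarrow> \<iota> (r J) = (\<Oplus>\<^bsub>K\<^esub>f\<in>I \<rightarrow>\<^sub>E points. weight f J \<otimes>\<^bsub>K\<^esub> \<phi> f v)"
    by blast
  have qr: "q J \<in> k" "r J \<in> k" "q J \<in> carrier L" "r J \<in> carrier L" if "J \<in> indices" for J
    using q(1) r(1) that k_subset by auto
  let ?q = "\<lambda>J. q J \<oplus> r J"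
  have "?q \<in> indices \<rightarrow> k"
    using qr subringE(7)[OF k_subring] by auto
  moreover have "u \<oplus>\<^bsub>B\<^esub> v = (\<Oplus>\<^bsub>B\<^esub>J\<in>indices. s (?q J) \<otimes>\<^bsub>B\<^esub> basis J)"
  proof -
    have "u \<oplus>\<^bsub>B\<^esub> v = (\<Oplus>\<^bsub>B\<^esub>J\<in>indices. s (q J) \<otimes>\<^bsub>B\<^esub> basis J \<oplus>\<^bsub>B\<^esub> s (r J) \<otimes>\<^bsub>B\<^esub> basis J)"
      unfolding q(2) r(2) using qr by (intro B.finsum_addf[symmetric]) auto
    also have "\<dots> = (\<Oplus>\<^bsub>B\<^esub>J\<in>indices. s (?q J) \<otimes>\<^bsub>B\<^esub> basis J)"
      using qr subringE(7)[OF k_subring] by (intro B.finsum_cong') (auto simp: s_add B.l_distr)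
    finally show ?thesis .
  qed
  moreover have "\<iota> (?q J) = (\<Oplus>\<^bsub>K\<^esub>f\<in>I \<rightarrow>\<^sub>E points. weight f J \<otimes>\<^bsub>K\<^esub> \<phi> f (u \<oplus>\<^bsub>B\<^esub> v))"
    if J: "J \<in> indices" for J
  proof -
    have "\<iota> (?q J) = (\<Oplus>\<^bsub>K\<^esub>f\<in>I \<rightarrow>\<^sub>E points. weight f J \<otimes>\<^bsub>K\<^esub> \<phi> f u \<oplus>\<^bsub>K\<^esub> weight f J \<otimes>\<^bsub>K\<^esub> \<phi> f v)"
      using qr[OF J] q(3)[OF J] r(3)[OF J] J add.hyps by (subst K.finsum_addf) auto
    also have "\<dots> = (\<Oplus>\<^bsub>K\<^esub>f\<in>I \<rightarrow>\<^sub>E points. weight f J \<otimes>\<^bsub>K\<^esub> \<phi> f (u \<oplus>\<^bsub>B\<^esub> v))"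
      using J add.hyps ring_hom_add[OF \<phi>_hom] by (intro K.finsum_cong') (auto simp: K.r_distr)
    finally show ?thesis .
  qed
  ultimately show ?case
    by (intro bexI[of _ ?q] conjI ballI)
qed

section \<open>Permutation orbits and orbit sums\<close>

definition perm_orbit
  where "perm_orbit x = {x \<circ> \<pi> | \<pi>. \<pi> permutes I}"

lemma perm_orbit_self: "x \<in> perm_orbit x"
  unfolding perm_orbit_def by (intro CollectI exI[of _ id]) (simp add: permutes_id)

lemma perm_orbit_comp:
  assumes \<pi>: "\<pi> permutes I"
  shows "perm_orbit (x \<circ> \<pi>) = perm_orbit x"
proof (intro equalityI subsetI)
  fix y assume "y \<in> perm_orbit (x \<circ> \<pi>)"
  then obtain \<rho> where \<rho>: "\<rho> permutes I" "y = x \<circ> \<pi> \<circ> \<rho>"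
    by (auto simp: perm_orbit_def)
  then show "y \<in> perm_orbit x"
    using permutes_compose[OF \<rho>(1) \<pi>] unfolding perm_orbit_def by (metis (mono_tags, lifting) mem_Collect_eq o_assoc)
next
  fix y assume "y \<in> perm_orbit x"
  then obtain \<rho> where \<rho>: "\<rho> permutes I" "y = x \<circ> \<rho>"
    by (auto simp: perm_orbit_def)
  then have "y = x \<circ> \<pi> \<circ> (inv' \<pi> \<circ> \<rho>)"
    using permutes_inv_o(1)[OF \<pi>] by (metis comp_id o_assoc)
  then show "y \<in> perm_orbit (x \<circ> \<pi>)"
    using permutes_compose[OF \<rho>(1) permutes_inv[OF \<pi>]] unfolding perm_orbit_def by blast
qed

lemma finite_perm_orbit: "finite (perm_orbit x)"
proof -
  have "perm_orbit x = (\<lambda>\<pi>. x \<circ> \<pi>) ` {\<pi>. \<pi> permutes I}"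
    by (auto simp: perm_orbit_def)
  then show ?thesis
    using finite_permutations[OF finite_I] by simp
qed

lemma perm_orbit_eqD:
  assumes "perm_orbit x = perm_orbit y"
  obtains \<pi> where "\<pi> permutes I" "y = x \<circ> \<pi>"
  using perm_orbit_self[of y] assms by (auto simp: perm_orbit_def)

text \<open>For an orbit \<open>M\<close> of index tuples this is \<open>M\<close> itself; written
  as a fibre of \<open>perm_orbit\<close> it fits the regrouping of sums by fibres.\<close>

definition orbit_indices
  where "orbit_indices M = {J \<in> indices. perm_orbit J = M}"

text \<open>Each member of the orbit occurs once. Summing over all permutations would add the order
  of a stabilizer as a factor, which may be zero in \<open>k\<close>.\<close>

definition orbit_sum
  where "orbit_sum M = (\<Oplus>\<^bsub>B\<^esub>J\<in>orbit_indices M. basis J)"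

definition representative
  where "representative M = (SOME J. J \<in> orbit_indices M)"

lemma representative:
  assumes "M \<in> perm_orbit ` indices"
  shows "representative M \<in> indices" "perm_orbit (representative M) = M"
proof -
  have "\<exists>J. J \<in> orbit_indices M"
    using assms by (auto simp: orbit_indices_def)
  from someI_ex[OF this] show "representative M \<in> indices" "perm_orbit (representative M) = M"
    unfolding representative_def by (auto simp: orbit_indices_def)
qed

lemma finite_orbit_indices: "finite (orbit_indices M)"
  using finite_indices by (simp add: orbit_indices_def)

text \<open>A permutation of the factors permutes the summands, since an orbit is closed under
  composition with permutations.\<close>

lemma orbit_sum_invariant: "orbit_sum M \<in> invariants"
proof -
  have b: "basis \<in> orbit_indices M \<rightarrow> carrier B"
    by (auto simp: orbit_indices_def)
  have "act \<pi> (orbit_sum M) = orbit_sum M" if \<pi>: "\<pi> permutes I" for \<pi>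
  proof -
    interpret h: ring_hom_cring B B "act \<pi>" using ring_hom_cring_act[OF \<pi>] .
    have im: "(\<lambda>J. J \<circ> inv' \<pi>) ` orbit_indices M = orbit_indices M"
    proof (intro equalityI subsetI)
      fix J assume "J \<in> (\<lambda>J. J \<circ> inv' \<pi>) ` orbit_indices M"
      then obtain J' where "J' \<in> orbit_indices M" "J = J' \<circ> inv' \<pi>"
        by blast
      then show "J \<in> orbit_indices M"
        using comp_PiE[OF permutes_inv[OF \<pi>], of J'] perm_orbit_comp[OF permutes_inv[OF \<pi>], of J']
        by (simp only: orbit_indices_def mem_Collect_eq)
    next
      fix J assume "J \<in> orbit_indices M"
      then have "J \<circ> \<pi> \<in> orbit_indices M"
        using comp_PiE[OF \<pi>, of J] perm_orbit_comp[OF \<pi>, of J]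
        by (simp only: orbit_indices_def mem_Collect_eq)
      moreover have "J = J \<circ> \<pi> \<circ> inv' \<pi>"
        using permutes_inv_o(1)[OF \<pi>] by (metis comp_id o_assoc)
      ultimately show "J \<in> (\<lambda>J. J \<circ> inv' \<pi>) ` orbit_indices M"
        using image_eqI[of J "\<lambda>J. J \<circ> inv' \<pi>"] by blast
    qed
    have "act \<pi> (orbit_sum M) = (\<Oplus>\<^bsub>B\<^esub>J\<in>orbit_indices M. basis (J \<circ> inv' \<pi>))"
      unfolding orbit_sum_def h.hom_finsum[OF b]
    proof (intro B.finsum_cong' refl)
      fix J assume J: "J \<in> orbit_indices M"
      then have "J \<in> indices"
        by (simp add: orbit_indices_def)
      then show "(act \<pi> \<circ> basis) J = basis (J \<circ> inv' \<pi>)"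
        using act_pure[OF \<pi>, of "\<lambda>i. \<alpha> (J i)"] \<alpha>_closed indices_less
        by (simp add: basis_def o_def Pi_iff)
    next
      show "(\<lambda>J. basis (J \<circ> inv' \<pi>)) \<in> orbit_indices M \<rightarrow> carrier B"
        using im b by blast
    qed
    also have "\<dots> = (\<Oplus>\<^bsub>B\<^esub>J\<in>(\<lambda>J. J \<circ> inv' \<pi>) ` orbit_indices M. basis J)"
      by (intro B.finsum_reindex[symmetric]) (simp_all only: im b comp_inj_on[OF permutes_inv[OF \<pi>]])
    finally show ?thesis
      by (simp add: im orbit_sum_def)
  qed
  moreover have "orbit_sum M \<in> carrier B"
    unfolding orbit_sum_def using b by (intro B.finsum_closed)
  ultimately show ?thesis
    by (simp add: invariants_def)
qed

text \<open>Coefficients that are constant on orbits are pulled out of the sum over each orbit. The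
  ring is arbitrary because the regrouping is done in \<open>K\<close> for values at points and in
  \<open>B\<close> for invariants.\<close>

lemma sum_over_orbits:
  fixes R :: "('x, 'y) ring_scheme"
  assumes "cring R" and w: "w \<in> indices \<rightarrow> carrier R" and E: "E \<in> indices \<rightarrow> carrier R"
    and sym: "\<And>J \<pi>. J \<in> indices \<Longrightarrow> \<pi> permutes I \<Longrightarrow> w (J \<circ> \<pi>) = w J"
  shows "(\<Oplus>\<^bsub>R\<^esub>J\<in>indices. w J \<otimes>\<^bsub>R\<^esub> E J) =
    (\<Oplus>\<^bsub>R\<^esub>M\<in>perm_orbit ` indices. w (representative M) \<otimes>\<^bsub>R\<^esub> (\<Oplus>\<^bsub>R\<^esub>J\<in>orbit_indices M. E J))"
proof -
  interpret R: cring R by fact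
  have "(\<Oplus>\<^bsub>R\<^esub>J\<in>indices. w J \<otimes>\<^bsub>R\<^esub> E J) =
      (\<Oplus>\<^bsub>R\<^esub>M\<in>perm_orbit ` indices. \<Oplus>\<^bsub>R\<^esub>J\<in>orbit_indices M. w J \<otimes>\<^bsub>R\<^esub> E J)"
    using w E finite_indices unfolding orbit_indices_def by (intro R.finsum_fibers) auto
  also have "\<dots> = (\<Oplus>\<^bsub>R\<^esub>M\<in>perm_orbit ` indices. w (representative M) \<otimes>\<^bsub>R\<^esub> (\<Oplus>\<^bsub>R\<^esub>J\<in>orbit_indices M. E J))"
  proof (intro R.finsum_cong' refl)
    fix M assume M: "M \<in> perm_orbit ` indices"
    note rep = representative[OF M]
    have w_rep: "w (representative M) \<in> carrier R"
      using w rep(1) by blast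
    have "w J = w (representative M)" if J: "J \<in> orbit_indices M" for J
    proof -
      have "perm_orbit (representative M) = perm_orbit J"
        using J rep by (simp add: orbit_indices_def)
      then obtain \<pi> where "\<pi> permutes I" "J = representative M \<circ> \<pi>"
        by (rule perm_orbit_eqD)
      then show ?thesis
        using sym rep(1) by metis
    qed
    then have "(\<Oplus>\<^bsub>R\<^esub>J\<in>orbit_indices M. w J \<otimes>\<^bsub>R\<^esub> E J) = (\<Oplus>\<^bsub>R\<^esub>J\<in>orbit_indices M. w (representative M) \<otimes>\<^bsub>R\<^esub> E J)"
      using E w_rep by (intro R.finsum_cong') (auto simp: orbit_indices_def)
    also have "\<dots> = w (representative M) \<otimes>\<^bsub>R\<^esub> (\<Oplus>\<^bsub>R\<^esub>J\<in>orbit_indices M. E J)"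
      using E w_rep finite_orbit_indices by (intro R.finsum_rdistr[symmetric]) (auto simp: orbit_indices_def)
    finally show "(\<Oplus>\<^bsub>R\<^esub>J\<in>orbit_indices M. w J \<otimes>\<^bsub>R\<^esub> E J) =
        w (representative M) \<otimes>\<^bsub>R\<^esub> (\<Oplus>\<^bsub>R\<^esub>J\<in>orbit_indices M. E J)" .
  next
    show "(\<lambda>M. w (representative M) \<otimes>\<^bsub>R\<^esub> (\<Oplus>\<^bsub>R\<^esub>J\<in>orbit_indices M. E J)) \<in> perm_orbit ` indices \<rightarrow> carrier R"
    proof
      fix M assume M: "M \<in> perm_orbit ` indices"
      have "w (representative M) \<in> carrier R"
        using w representative(1)[OF M] by blast
      then show "w (representative M) \<otimes>\<^bsub>R\<^esub> (\<Oplus>\<^bsub>R\<^esub>J\<in>orbit_indices M. E J) \<in> carrier R"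
        using E by (intro R.m_closed R.finsum_closed) (auto simp: orbit_indices_def)
    qed
  qed
  finally show ?thesis .
qed

lemma weight_comp:
  assumes f: "f \<in> I \<rightarrow>\<^sub>E points" and J: "J \<in> indices" and \<pi>: "\<pi> permutes I"
  shows "weight (f \<circ> \<pi>) (J \<circ> \<pi>) = weight f J"
proof -
  have "weight f J = (\<Otimes>\<^bsub>K\<^esub>i\<in>\<pi> ` I. f i (\<beta> (J i)))"
    by (simp add: weight_def permutes_image[OF \<pi>])
  also have "\<dots> = (\<Otimes>\<^bsub>K\<^esub>i\<in>I. f (\<pi> i) (\<beta> (J (\<pi> i))))"
    using f J \<beta>_closed indices_less multipoint \<pi>
    by (intro K.finprod_reindex) (auto simp: permutes_image permutes_inj_on)
  finally show ?thesis
    by (simp add: weight_def)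
qed

text \<open>
  For points \<open>f\<close> and \<open>g\<close> in different orbits, the element \<open>\<Sum>\<^sub>J (\<Sum>\<^sub>h weight h J) \<cdot> basis J\<close> of the
  invariants with scalars extended to \<open>K\<close>, where \<open>h\<close> runs over the orbit of \<open>f\<close>, is mapped
  to \<open>1\<close> by \<open>\<phi> f\<close> and to \<open>0\<close> by \<open>\<phi> g\<close>.
\<close>

lemma \<phi>_eq_imp_same_orbit:
  assumes f: "f \<in> I \<rightarrow>\<^sub>E points" and g: "g \<in> I \<rightarrow>\<^sub>E points"
    and eq: "\<And>b. b \<in> invariants \<Longrightarrow> \<phi> f b = \<phi> g b"
  shows "g \<in> perm_orbit f"
proof -
  have orb: "h \<in> I \<rightarrow>\<^sub>E points" if "h \<in> perm_orbit f" for h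
    using that comp_PiE[OF _ f] by (auto simp: perm_orbit_def simp del: o_apply)
  \<comment> \<open>Only the coefficient function of the element over \<open>K\<close> is kept.
    Summing over the whole orbit of \<open>f\<close> makes it symmetric in \<open>J\<close>, because
    \<open>weight\<close> is unchanged when both arguments are permuted.\<close>
  define w where "w J = (\<Oplus>\<^bsub>K\<^esub>h\<in>perm_orbit f. weight h J)" for J
  have w: "w \<in> indices \<rightarrow> carrier K"
    unfolding w_def using orb by (intro funcsetI K.finsum_closed) auto
  have w_sym: "w (J \<circ> \<pi>) = w J" if J: "J \<in> indices" and \<pi>: "\<pi> permutes I" for J \<pi>
  proof -
    have im: "(\<lambda>h. h \<circ> \<pi>) ` perm_orbit f = perm_orbit f"
    proof (intro equalityI subsetI)
      fix h assume "h \<in> (\<lambda>h. h \<circ> \<pi>) ` perm_orbit f"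
      then obtain \<rho> where "\<rho> permutes I" "h = f \<circ> \<rho> \<circ> \<pi>"
        by (auto simp: perm_orbit_def)
      then show "h \<in> perm_orbit f"
        using perm_orbit_self[of h] perm_orbit_comp \<pi> by metis
    next
      fix h assume "h \<in> perm_orbit f"
      then obtain \<rho> where \<rho>: "\<rho> permutes I" "h = f \<circ> \<rho>"
        by (auto simp: perm_orbit_def)
      then have "h \<circ> inv' \<pi> \<in> perm_orbit f"
        using perm_orbit_self[of "h \<circ> inv' \<pi>"] perm_orbit_comp permutes_inv[OF \<pi>] by metis
      moreover have "h = h \<circ> inv' \<pi> \<circ> \<pi>"
        using permutes_inv_o(2)[OF \<pi>] by (metis comp_id o_assoc)
      ultimately show "h \<in> (\<lambda>h. h \<circ> \<pi>) ` perm_orbit f"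
        using image_eqI[of h "\<lambda>h. h \<circ> \<pi>"] by blast
    qed
    have "w (J \<circ> \<pi>) = (\<Oplus>\<^bsub>K\<^esub>h\<in>(\<lambda>h. h \<circ> \<pi>) ` perm_orbit f. weight h (J \<circ> \<pi>))"
      by (simp add: w_def im)
    also have "\<dots> = (\<Oplus>\<^bsub>K\<^esub>h\<in>perm_orbit f. weight (h \<circ> \<pi>) (J \<circ> \<pi>))"
      using im orb comp_PiE[OF \<pi> J] comp_inj_on[OF \<pi>] by (intro K.finsum_reindex) auto
    also have "\<dots> = w J"
      unfolding w_def using orb J \<pi> by (intro K.finsum_cong') (auto simp: weight_comp)
    finally show ?thesis .
  qed
  have val: "(\<Oplus>\<^bsub>K\<^esub>J\<in>indices. w J \<otimes>\<^bsub>K\<^esub> \<phi> g (basis J)) = (if g \<in> perm_orbit f then \<one>\<^bsub>K\<^esub> else \<zero>\<^bsub>K\<^esub>)"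
    if g: "g \<in> I \<rightarrow>\<^sub>E points" for g
  proof -
    have gb: "\<phi> g (basis J) = (\<Otimes>\<^bsub>K\<^esub>i\<in>I. g i (\<alpha> (J i)))" if "J \<in> indices" for J
      using that \<phi>_pure[OF g] indices_less \<alpha>_closed by (simp add: basis_def Pi_iff)
    have "(\<Oplus>\<^bsub>K\<^esub>J\<in>indices. w J \<otimes>\<^bsub>K\<^esub> \<phi> g (basis J)) =
        (\<Oplus>\<^bsub>K\<^esub>J\<in>indices. \<Oplus>\<^bsub>K\<^esub>h\<in>perm_orbit f. weight h J \<otimes>\<^bsub>K\<^esub> \<phi> g (basis J))"
      unfolding w_def using g orb finite_perm_orbit
      by (intro K.finsum_cong' refl K.finsum_ldistr) (auto intro!: K.finsum_closed)
    also have "\<dots> = (\<Oplus>\<^bsub>K\<^esub>h\<in>perm_orbit f. \<Oplus>\<^bsub>K\<^esub>J\<in>indices. weight h J \<otimes>\<^bsub>K\<^esub> \<phi> g (basis J))"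
      using g orb finite_perm_orbit finite_indices by (intro K.finsum_swap) auto
    also have "\<dots> = (\<Oplus>\<^bsub>K\<^esub>h\<in>perm_orbit f. if h = g then \<one>\<^bsub>K\<^esub> else \<zero>\<^bsub>K\<^esub>)"
    proof (intro K.finsum_cong' refl)
      fix h assume "h \<in> perm_orbit f"
      then have h: "h \<in> I \<rightarrow>\<^sub>E points"
        using orb by blast
      have hi: "h i \<in> points" "g i \<in> points" if "i \<in> I" for i
        using h g multipoint that by auto
      have "(\<Oplus>\<^bsub>K\<^esub>J\<in>indices. weight h J \<otimes>\<^bsub>K\<^esub> \<phi> g (basis J)) =
          (\<Oplus>\<^bsub>K\<^esub>J\<in>indices. \<Otimes>\<^bsub>K\<^esub>i\<in>I. g i (\<alpha> (J i)) \<otimes>\<^bsub>K\<^esub> h i (\<beta> (J i)))"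
      proof (intro K.finsum_cong' refl)
        fix J assume J: "J \<in> indices"
        have "(\<Otimes>\<^bsub>K\<^esub>i\<in>I. g i (\<alpha> (J i)) \<otimes>\<^bsub>K\<^esub> h i (\<beta> (J i))) =
            (\<Otimes>\<^bsub>K\<^esub>i\<in>I. g i (\<alpha> (J i))) \<otimes>\<^bsub>K\<^esub> weight h J"
          unfolding weight_def using hi indices_less[OF J] \<alpha>_closed \<beta>_closed by (intro K.finprod_multf) auto
        then show "weight h J \<otimes>\<^bsub>K\<^esub> \<phi> g (basis J) = (\<Otimes>\<^bsub>K\<^esub>i\<in>I. g i (\<alpha> (J i)) \<otimes>\<^bsub>K\<^esub> h i (\<beta> (J i)))"
          using gb[OF J] weight_closed[OF h J] \<phi>_closed[OF g basis_closed[OF J]] by (simp add: K.m_comm)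
      next
        show "(\<lambda>J. \<Otimes>\<^bsub>K\<^esub>i\<in>I. g i (\<alpha> (J i)) \<otimes>\<^bsub>K\<^esub> h i (\<beta> (J i))) \<in> indices \<rightarrow> carrier K"
          using hi indices_less \<alpha>_closed \<beta>_closed by (intro funcsetI K.finprod_closed) auto
      qed
      also have "\<dots> = (\<Otimes>\<^bsub>K\<^esub>i\<in>I. \<Oplus>\<^bsub>K\<^esub>j\<in>{..<m}. g i (\<alpha> j) \<otimes>\<^bsub>K\<^esub> h i (\<beta> j))"
        using hi \<alpha>_closed \<beta>_closed finite_I by (intro K.finprod_finsum[symmetric]) auto
      also have "\<dots> = (\<Otimes>\<^bsub>K\<^esub>i\<in>I. if h i = g i then \<one>\<^bsub>K\<^esub> else \<zero>\<^bsub>K\<^esub>)"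
        using hi by (intro K.finprod_cong' dual) auto
      also have "\<dots> = (if h = g then \<one>\<^bsub>K\<^esub> else \<zero>\<^bsub>K\<^esub>)"
      proof (cases "h = g")
        case True
        then show ?thesis by simp
      next
        case False
        then obtain i where i: "i \<in> I" "h i \<noteq> g i"
          using h g by (metis PiE_ext)
        then have "(\<Otimes>\<^bsub>K\<^esub>i\<in>insert i (I - {i}). if h i = g i then \<one>\<^bsub>K\<^esub> else \<zero>\<^bsub>K\<^esub>) = \<zero>\<^bsub>K\<^esub>"
          using finite_I by (subst K.finprod_insert) (auto intro!: K.finprod_closed K.l_null)
        then show ?thesis
          using i False by (simp add: insert_absorb)
      qed
      finally show "(\<Oplus>\<^bsub>K\<^esub>J\<in>indices. weight h J \<otimes>\<^bsub>K\<^esub> \<phi> g (basis J)) = (if h = g then \<one>\<^bsub>K\<^esub> else \<zero>\<^bsub>K\<^esub>)" .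
    qed auto
    also have "\<dots> = (if g \<in> perm_orbit f then \<one>\<^bsub>K\<^esub> else \<zero>\<^bsub>K\<^esub>)"
    proof (cases "g \<in> perm_orbit f")
      case True
      then show ?thesis
        using finite_perm_orbit by (subst K.finsum_eq_single[of _ g]) auto
    next
      case False
      then have "(\<Oplus>\<^bsub>K\<^esub>h\<in>perm_orbit f. if h = g then \<one>\<^bsub>K\<^esub> else \<zero>\<^bsub>K\<^esub>) = (\<Oplus>\<^bsub>K\<^esub>h\<in>perm_orbit f. \<zero>\<^bsub>K\<^esub>)"
        by (intro K.finsum_cong') auto
      then show ?thesis
        using False by simp
    qed
    finally show ?thesis .
  qed
  \<comment> \<open>Regrouped by orbits, the value depends only on \<open>\<phi> g\<close> at the
    orbit sums. These are invariants, so the assumption on \<open>\<phi> f\<close> and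
    \<open>\<phi> g\<close> applies to them.\<close>
  have orbits: "(\<Oplus>\<^bsub>K\<^esub>J\<in>indices. w J \<otimes>\<^bsub>K\<^esub> \<phi> g (basis J)) =
      (\<Oplus>\<^bsub>K\<^esub>M\<in>perm_orbit ` indices. w (representative M) \<otimes>\<^bsub>K\<^esub> \<phi> g (orbit_sum M))"
    if g: "g \<in> I \<rightarrow>\<^sub>E points" for g
  proof -
    interpret h: ring_hom_cring B K "\<phi> g" using ring_hom_cring_\<phi>[OF g] .
    have "\<phi> g (orbit_sum M) = (\<Oplus>\<^bsub>K\<^esub>J\<in>orbit_indices M. \<phi> g (basis J))" for M
      unfolding orbit_sum_def by (subst h.hom_finsum) (auto simp: orbit_indices_def o_def)
    then show ?thesis
      using sum_over_orbits[OF K.is_cring w, of "\<lambda>J. \<phi> g (basis J)"] w_sym g by simp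
  qed
  have "(if g \<in> perm_orbit f then \<one>\<^bsub>K\<^esub> else \<zero>\<^bsub>K\<^esub>) = (if f \<in> perm_orbit f then \<one>\<^bsub>K\<^esub> else \<zero>\<^bsub>K\<^esub>)"
    unfolding val[OF f, symmetric] val[OF g, symmetric] orbits[OF f] orbits[OF g]
    using eq[OF orbit_sum_invariant] by simp
  then show ?thesis
    using perm_orbit_self[of f] by (auto split: if_splits)
qed

text \<open>Exchanging the sums over orbits and over tuples of points in the expression for
  \<open>\<chi> b\<close> isolates coefficients that do not depend on \<open>b\<close>, as
  independence of characters requires.\<close>

lemma invariants_hom_eq_\<phi>:
  assumes \<chi>: "\<chi> \<in> ring_hom (B\<lparr>carrier := invariants\<rparr>) K" and \<chi>_s: "\<And>c. c \<in> k \<Longrightarrow> \<chi> (s c) = \<iota> c"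
  obtains f where "f \<in> I \<rightarrow>\<^sub>E points" "\<And>b. b \<in> invariants \<Longrightarrow> \<chi> b = \<phi> f b"
proof -
  let ?M = "perm_orbit ` indices"
  let ?A = "B\<lparr>carrier := invariants\<rparr>"
  note inv = subringE[OF subring_invariants]
  have \<chi>_closed: "\<chi> b \<in> carrier K" if "b \<in> invariants" for b
    using ring_hom_closed[OF \<chi>] that by simp
  have \<chi>_mult: "\<chi> (a \<otimes>\<^bsub>B\<^esub> b) = \<chi> a \<otimes>\<^bsub>K\<^esub> \<chi> b" if "a \<in> invariants" "b \<in> invariants" for a b
    using ring_hom_mult[OF \<chi>] that by simp
  \<comment> \<open>\<open>\<chi>\<close> is additive on invariants only, so membership of the
    partial sums is carried through the induction.\<close>
  have \<chi>_sum: "(\<Oplus>\<^bsub>B\<^esub>M\<in>S. x M) \<in> invariants \<and> \<chi> (\<Oplus>\<^bsub>B\<^esub>M\<in>S. x M) = (\<Oplus>\<^bsub>K\<^esub>M\<in>S. \<chi> (x M))"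
    if "finite S" "x \<in> S \<rightarrow> invariants" for S :: "(nat \<Rightarrow> nat) set set" and x
    using that
  proof (induction S)
    case empty
    then show ?case
      using inv(2) ring_hom_zero[OF \<chi> B.subring_is_ring[OF subring_invariants] K.ring_axioms] by simp
  next
    case (insert M S)
    have "(\<Oplus>\<^bsub>B\<^esub>M\<in>insert M S. x M) = x M \<oplus>\<^bsub>B\<^esub> (\<Oplus>\<^bsub>B\<^esub>M\<in>S. x M)"
      using insert invariants_closed by (intro B.finsum_insert) auto
    moreover have "(\<Oplus>\<^bsub>K\<^esub>M\<in>insert M S. \<chi> (x M)) = \<chi> (x M) \<oplus>\<^bsub>K\<^esub> (\<Oplus>\<^bsub>K\<^esub>M\<in>S. \<chi> (x M))"
      using insert \<chi>_closed by (intro K.finsum_insert) auto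
    ultimately show ?case
      using insert inv(7) ring_hom_add[OF \<chi>] by auto
  qed
  \<comment> \<open>What collects in front of \<open>\<phi> f b\<close> once the coordinates of
    \<open>b\<close> are written in these values and the two sums are exchanged.\<close>
  define d where "d f = (\<Oplus>\<^bsub>K\<^esub>M\<in>?M. \<chi> (orbit_sum M) \<otimes>\<^bsub>K\<^esub> weight f (representative M))" for f
  have weight_rep_closed: "\<chi> (orbit_sum M) \<otimes>\<^bsub>K\<^esub> weight f (representative M) \<in> carrier K"
    if "M \<in> ?M" "f \<in> I \<rightarrow>\<^sub>E points" for M f
    using \<chi>_closed[OF orbit_sum_invariant[of M]] weight_closed[OF that(2) representative(1)[OF that(1)]] by simp
  have d: "d f \<in> carrier K" if "f \<in> I \<rightarrow>\<^sub>E points" for f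
    unfolding d_def using that weight_rep_closed by (intro K.finsum_closed funcsetI)
  have "\<chi> b = (\<Oplus>\<^bsub>K\<^esub>f\<in>I \<rightarrow>\<^sub>E points. d f \<otimes>\<^bsub>K\<^esub> \<phi> f b)" if b: "b \<in> invariants" for b
  proof -
    have b': "b \<in> carrier B"
      using invariants_closed[OF b] .
    obtain q where q: "q \<in> indices \<rightarrow> k" and b_eq: "b = (\<Oplus>\<^bsub>B\<^esub>J\<in>indices. s (q J) \<otimes>\<^bsub>B\<^esub> basis J)"
      and \<iota>q: "\<And>J. J \<in> indices \<Longrightarrow> \<iota> (q J) = (\<Oplus>\<^bsub>K\<^esub>f\<in>I \<rightarrow>\<^sub>E points. weight f J \<otimes>\<^bsub>K\<^esub> \<phi> f b)"
      using coordinates[OF b'] by blast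
    have term_closed: "\<chi> (orbit_sum M) \<otimes>\<^bsub>K\<^esub> weight f (representative M) \<otimes>\<^bsub>K\<^esub> \<phi> f b \<in> carrier K"
      if "M \<in> ?M" "f \<in> I \<rightarrow>\<^sub>E points" for M f
      using weight_rep_closed[OF that] \<phi>_closed[OF that(2) b'] by simp
    \<comment> \<open>Another choice of coefficients need not be symmetric; this one is by its
      formula. Reindexing the tuples of points by \<open>\<pi>\<close> leaves the weights unchanged
      by \<open>weight_comp\<close> and the values at \<open>b\<close> by invariance.\<close>
    have q_sym: "q (J \<circ> \<pi>) = q J" if J: "J \<in> indices" and \<pi>: "\<pi> permutes I" for J \<pi>
    proof -
      note J\<pi> = comp_PiE[OF \<pi> J]
      have "\<iota> (q (J \<circ> \<pi>)) = (\<Oplus>\<^bsub>K\<^esub>f\<in>(\<lambda>f. f \<circ> \<pi>) ` (I \<rightarrow>\<^sub>E points). weight f (J \<circ> \<pi>) \<otimes>\<^bsub>K\<^esub> \<phi> f b)"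
        using \<iota>q[OF J\<pi>] by (simp add: comp_PiE_image[OF \<pi>])
      also have "\<dots> = (\<Oplus>\<^bsub>K\<^esub>f\<in>I \<rightarrow>\<^sub>E points. weight (f \<circ> \<pi>) (J \<circ> \<pi>) \<otimes>\<^bsub>K\<^esub> \<phi> (f \<circ> \<pi>) b)"
      proof (rule K.finsum_reindex)
        show "(\<lambda>f. weight f (J \<circ> \<pi>) \<otimes>\<^bsub>K\<^esub> \<phi> f b) \<in> (\<lambda>f. f \<circ> \<pi>) ` (I \<rightarrow>\<^sub>E points) \<rightarrow> carrier K"
          unfolding comp_PiE_image[OF \<pi>] using J\<pi> b' by auto
      qed (rule comp_inj_on[OF \<pi>])
      also have "\<dots> = \<iota> (q J)"
        unfolding \<iota>q[OF J] using J \<pi> b b' by (intro K.finsum_cong') (auto simp: weight_comp \<phi>_invariants)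
      finally show ?thesis
        using q J J\<pi> k_subset by (intro inj_onD[OF inj_on_\<iota>]) auto
    qed
    have qr: "q (representative M) \<in> k" if "M \<in> ?M" for M
      using q representative(1)[OF that] by blast
    have sM: "s (q (representative M)) \<otimes>\<^bsub>B\<^esub> orbit_sum M \<in> invariants" if "M \<in> ?M" for M
      using inv(6) s_in_invariants[OF qr[OF that]] orbit_sum_invariant by blast
    have "b = (\<Oplus>\<^bsub>B\<^esub>M\<in>?M. s (q (representative M)) \<otimes>\<^bsub>B\<^esub> orbit_sum M)"
      unfolding orbit_sum_def using q q_sym
      by (subst b_eq, intro sum_over_orbits B.is_cring) (auto simp: Pi_iff)
    then have "\<chi> b = (\<Oplus>\<^bsub>K\<^esub>M\<in>?M. \<chi> (s (q (representative M)) \<otimes>\<^bsub>B\<^esub> orbit_sum M))"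
      using \<chi>_sum[of ?M "\<lambda>M. s (q (representative M)) \<otimes>\<^bsub>B\<^esub> orbit_sum M"] sM finite_indices by simp
    also have "\<dots> = (\<Oplus>\<^bsub>K\<^esub>M\<in>?M. \<Oplus>\<^bsub>K\<^esub>f\<in>I \<rightarrow>\<^sub>E points.
        \<chi> (orbit_sum M) \<otimes>\<^bsub>K\<^esub> weight f (representative M) \<otimes>\<^bsub>K\<^esub> \<phi> f b)"
    proof (intro K.finsum_cong' refl)
      fix M assume M: "M \<in> ?M"
      note rep = representative(1)[OF M] and oc = \<chi>_closed[OF orbit_sum_invariant[of M]]
      have "\<chi> (s (q (representative M)) \<otimes>\<^bsub>B\<^esub> orbit_sum M) = \<chi> (orbit_sum M) \<otimes>\<^bsub>K\<^esub> \<iota> (q (representative M))"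
        using \<chi>_mult[OF s_in_invariants[OF qr[OF M]] orbit_sum_invariant] \<chi>_s[OF qr[OF M]] oc
          qr[OF M] k_subset by (simp add: K.m_comm subset_iff)
      also have "\<dots> = (\<Oplus>\<^bsub>K\<^esub>f\<in>I \<rightarrow>\<^sub>E points. \<chi> (orbit_sum M) \<otimes>\<^bsub>K\<^esub> (weight f (representative M) \<otimes>\<^bsub>K\<^esub> \<phi> f b))"
        unfolding \<iota>q[OF rep] using oc rep b' finite_multipoints by (intro K.finsum_rdistr) auto
      also have "\<dots> = (\<Oplus>\<^bsub>K\<^esub>f\<in>I \<rightarrow>\<^sub>E points. \<chi> (orbit_sum M) \<otimes>\<^bsub>K\<^esub> weight f (representative M) \<otimes>\<^bsub>K\<^esub> \<phi> f b)"
        using oc rep b' by (intro K.finsum_cong') (auto simp: K.m_assoc)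
      finally show "\<chi> (s (q (representative M)) \<otimes>\<^bsub>B\<^esub> orbit_sum M) =
        (\<Oplus>\<^bsub>K\<^esub>f\<in>I \<rightarrow>\<^sub>E points. \<chi> (orbit_sum M) \<otimes>\<^bsub>K\<^esub> weight f (representative M) \<otimes>\<^bsub>K\<^esub> \<phi> f b)" .
    next
      show "(\<lambda>M. \<Oplus>\<^bsub>K\<^esub>f\<in>I \<rightarrow>\<^sub>E points. \<chi> (orbit_sum M) \<otimes>\<^bsub>K\<^esub> weight f (representative M) \<otimes>\<^bsub>K\<^esub> \<phi> f b)
          \<in> ?M \<rightarrow> carrier K"
        using term_closed by (intro funcsetI K.finsum_closed)
    qed
    also have "\<dots> = (\<Oplus>\<^bsub>K\<^esub>f\<in>I \<rightarrow>\<^sub>E points. \<Oplus>\<^bsub>K\<^esub>M\<in>?M.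
        \<chi> (orbit_sum M) \<otimes>\<^bsub>K\<^esub> weight f (representative M) \<otimes>\<^bsub>K\<^esub> \<phi> f b)"
      using term_closed by (intro K.finsum_swap finite_imageI finite_indices finite_multipoints)
    also have "\<dots> = (\<Oplus>\<^bsub>K\<^esub>f\<in>I \<rightarrow>\<^sub>E points. d f \<otimes>\<^bsub>K\<^esub> \<phi> f b)"
    proof (intro K.finsum_cong' refl)
      fix f assume f: "f \<in> I \<rightarrow>\<^sub>E points"
      show "(\<Oplus>\<^bsub>K\<^esub>M\<in>?M. \<chi> (orbit_sum M) \<otimes>\<^bsub>K\<^esub> weight f (representative M) \<otimes>\<^bsub>K\<^esub> \<phi> f b) = d f \<otimes>\<^bsub>K\<^esub> \<phi> f b"
        unfolding d_def using f b' weight_rep_closed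
        by (intro K.finsum_ldistr[symmetric] finite_imageI finite_indices funcsetI \<phi>_closed)
    qed (use d b' in auto)
    finally show ?thesis .
  qed
  moreover have "\<phi> f \<in> ring_hom ?A K" if "f \<in> I \<rightarrow>\<^sub>E points" for f
    using \<phi>_hom[OF that] inv(1) by (auto simp: ring_hom_def Pi_iff subset_iff)
  ultimately obtain f where "f \<in> I \<rightarrow>\<^sub>E points" "\<And>b. b \<in> carrier ?A \<Longrightarrow> \<chi> b = \<phi> f b"
    using K.character_in_span[of "I \<rightarrow>\<^sub>E points" ?A \<phi> \<chi> d] finite_multipoints inv(3,6) \<chi> d by auto
  then show thesis
    using that by simp
qed

end

context tensor_points
begin

text \<open>A dual system exists by \<open>dual_bases\<close>, which removes it from the
  assumptions. The two claims are injectivity and surjectivity of the comparison map, stated for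
  representatives.\<close>

theorem points_of_invariants:
  shows "f \<in> I \<rightarrow>\<^sub>E points \<Longrightarrow> g \<in> I \<rightarrow>\<^sub>E points \<Longrightarrow> (\<And>b. b \<in> invariants \<Longrightarrow> \<phi> f b = \<phi> g b) \<Longrightarrow>
      \<exists>\<pi>. \<pi> permutes I \<and> g = f \<circ> \<pi>"
    and "\<chi> \<in> ring_hom (B\<lparr>carrier := invariants\<rparr>) K \<Longrightarrow> (\<And>c. c \<in> k \<Longrightarrow> \<chi> (s c) = \<iota> c) \<Longrightarrow>
      \<exists>f \<in> I \<rightarrow>\<^sub>E points. \<forall>b\<in>invariants. \<chi> b = \<phi> f b"
proof -
  obtain m :: nat and \<alpha> \<beta>
    where dual: "\<And>j. j < m \<Longrightarrow> \<alpha> j \<in> carrier L" "\<And>j. j < m \<Longrightarrow> \<beta> j \<in> carrier L"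
      "\<And>f g. f \<in> points \<Longrightarrow> g \<in> points \<Longrightarrow>
        (\<Oplus>\<^bsub>K\<^esub>j\<in>{..<m}. g (\<alpha> j) \<otimes>\<^bsub>K\<^esub> f (\<beta> j)) = (if f = g then \<one>\<^bsub>K\<^esub> else \<zero>\<^bsub>K\<^esub>)"
    using dual_bases by blast
  interpret tensor_points_dual k L K \<iota> B I s \<epsilon> act \<phi> m \<alpha> \<beta>
    using dual by unfold_locales
  show "\<exists>\<pi>. \<pi> permutes I \<and> g = f \<circ> \<pi>"
    if "f \<in> I \<rightarrow>\<^sub>E points" "g \<in> I \<rightarrow>\<^sub>E points" "\<And>b. b \<in> invariants \<Longrightarrow> \<phi> f b = \<phi> g b"
    using \<phi>_eq_imp_same_orbit[OF that] by (auto simp: perm_orbit_def)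
  show "\<exists>f \<in> I \<rightarrow>\<^sub>E points. \<forall>b\<in>invariants. \<chi> b = \<phi> f b"
    if "\<chi> \<in> ring_hom (B\<lparr>carrier := invariants\<rparr>) K" "\<And>c. c \<in> k \<Longrightarrow> \<chi> (s c) = \<iota> c"
    using invariants_hom_eq_\<phi>[OF that] by metis
qed

end

section \<open>The algebra of tuples\<close>

definition finitely_supported :: "('a, 'm) ring_scheme \<Rightarrow> ('t \<Rightarrow> 'a) set"
  where "finitely_supported R = {c. range c \<subseteq> carrier R \<and> finite (supp R c)}"

lemma finitely_supported_closed [simp]: "c \<in> finitely_supported R \<Longrightarrow> c x \<in> carrier R"
  by (auto simp: finitely_supported_def)

lemma finitely_supported_finite: "c \<in> finitely_supported R \<Longrightarrow> finite (supp R c)"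
  by (simp add: finitely_supported_def)

section \<open>Linear extension of functions to finitely supported coefficients\<close>

context ring_hom_cring
begin

text \<open>The linear extension of \<open>F\<close> at \<open>c\<close>, with coefficients moved
  along \<open>h\<close>. For the identity it describes the product of the tuple algebra, for
  \<open>\<iota>\<close> it yields \<open>tuple_hom\<close>.\<close>

definition pairing :: "('t \<Rightarrow> 'a) \<Rightarrow> ('t \<Rightarrow> 'c) \<Rightarrow> 'c"
  where "pairing c F = (\<Oplus>\<^bsub>S\<^esub>x\<in>supp R c. h (c x) \<otimes>\<^bsub>S\<^esub> F x)"

text \<open>Outside the support the summands vanish; this brings sums with different supports to a
  common index set.\<close>

lemma pairing_superset:
  assumes "c \<in> finitely_supported R" "finite T" "supp R c \<subseteq> T" "F \<in> T \<rightarrow> carrier S"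
  shows "pairing c F = (\<Oplus>\<^bsub>S\<^esub>x\<in>T. h (c x) \<otimes>\<^bsub>S\<^esub> F x)"
  unfolding pairing_def using assms
  by (intro S.finsum_mono_neutral_left) (auto simp: supp_def Pi_iff)

lemma pairing_closed:
  assumes "c \<in> finitely_supported R" "F \<in> supp R c \<rightarrow> carrier S"
  shows "pairing c F \<in> carrier S"
  unfolding pairing_def using assms by (intro S.finsum_closed) auto

lemma pairing_cong:
  assumes "c \<in> finitely_supported R" "G \<in> supp R c \<rightarrow> carrier S" "\<And>x. x \<in> supp R c \<Longrightarrow> F x = G x"
  shows "pairing c F = pairing c G"
  unfolding pairing_def using assms by (intro S.finsum_cong') auto

lemma pairing_add:
  assumes c: "c \<in> finitely_supported R" and d: "d \<in> finitely_supported R"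
    and F: "F \<in> supp R c \<union> supp R d \<rightarrow> carrier S"
  shows "pairing (\<lambda>x. c x \<oplus> d x) F = pairing c F \<oplus>\<^bsub>S\<^esub> pairing d F"
proof -
  let ?T = "supp R c \<union> supp R d"
  have fin: "finite ?T"
    using c d finitely_supported_finite by blast
  have sub: "supp R (\<lambda>x. c x \<oplus> d x) \<subseteq> ?T"
    by (auto simp: supp_def)
  then have "(\<lambda>x. c x \<oplus> d x) \<in> finitely_supported R"
    using c d fin finite_subset by (auto simp: finitely_supported_def)
  then have "pairing (\<lambda>x. c x \<oplus> d x) F = (\<Oplus>\<^bsub>S\<^esub>x\<in>?T. h (c x \<oplus> d x) \<otimes>\<^bsub>S\<^esub> F x)"
    using fin sub F by (rule pairing_superset)
  also have "\<dots> = (\<Oplus>\<^bsub>S\<^esub>x\<in>?T. h (c x) \<otimes>\<^bsub>S\<^esub> F x \<oplus>\<^bsub>S\<^esub> h (d x) \<otimes>\<^bsub>S\<^esub> F x)"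
    using c d F by (intro S.finsum_cong' refl) (auto simp: S.l_distr Pi_iff)
  also have "\<dots> = (\<Oplus>\<^bsub>S\<^esub>x\<in>?T. h (c x) \<otimes>\<^bsub>S\<^esub> F x) \<oplus>\<^bsub>S\<^esub> (\<Oplus>\<^bsub>S\<^esub>x\<in>?T. h (d x) \<otimes>\<^bsub>S\<^esub> F x)"
    using c d F by (intro S.finsum_addf) auto
  also have "\<dots> = pairing c F \<oplus>\<^bsub>S\<^esub> pairing d F"
    using pairing_superset[OF c fin _ F] pairing_superset[OF d fin _ F] by simp
  finally show ?thesis .
qed

lemma pairing_single:
  assumes "a \<in> carrier R" "F x \<in> carrier S"
  shows "pairing (single R a x) F = h a \<otimes>\<^bsub>S\<^esub> F x"
proof -
  have "pairing (single R a x) F = (\<Oplus>\<^bsub>S\<^esub>y\<in>{x}. h (single R a x y) \<otimes>\<^bsub>S\<^esub> F y)"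
    using assms by (intro pairing_superset) (auto simp: finitely_supported_def supp_def single_def)
  then show ?thesis
    using assms by (simp add: single_def)
qed

lemma pairing_times:
  assumes "c \<in> finitely_supported R" "F \<in> supp R c \<rightarrow> carrier S" "r \<in> carrier S"
  shows "pairing c (\<lambda>x. F x \<otimes>\<^bsub>S\<^esub> r) = pairing c F \<otimes>\<^bsub>S\<^esub> r"
proof -
  have "pairing c (\<lambda>x. F x \<otimes>\<^bsub>S\<^esub> r) = (\<Oplus>\<^bsub>S\<^esub>x\<in>supp R c. (h (c x) \<otimes>\<^bsub>S\<^esub> F x) \<otimes>\<^bsub>S\<^esub> r)"
    unfolding pairing_def using assms by (intro S.finsum_cong') (auto simp: S.m_assoc Pi_iff)
  also have "\<dots> = pairing c F \<otimes>\<^bsub>S\<^esub> r"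
    unfolding pairing_def using assms finitely_supported_finite
    by (intro S.finsum_ldistr[symmetric]) auto
  finally show ?thesis .
qed

lemma pairing_reindex:
  assumes c: "c \<in> finitely_supported R" and p: "bij p" and F: "F \<circ> inv' p \<in> supp R c \<rightarrow> carrier S"
  shows "pairing (\<lambda>x. c (p x)) F = pairing c (\<lambda>x. F (inv' p x))"
proof -
  have im: "p ` supp R (\<lambda>x. c (p x)) = supp R c"
    using bij_is_surj[OF p] by (auto simp: supp_def)
  have "pairing c (\<lambda>x. F (inv' p x)) = (\<Oplus>\<^bsub>S\<^esub>x\<in>p ` supp R (\<lambda>x. c (p x)). h (c x) \<otimes>\<^bsub>S\<^esub> F (inv' p x))"
    by (simp add: pairing_def im)
  also have "\<dots> = (\<Oplus>\<^bsub>S\<^esub>x\<in>supp R (\<lambda>x. c (p x)). h (c (p x)) \<otimes>\<^bsub>S\<^esub> F (inv' p (p x)))"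
    using c F im p by (intro S.finsum_reindex) (auto simp: Pi_iff inj_on_subset[OF bij_is_inj])
  finally show ?thesis
    using p by (simp add: pairing_def bij_is_inj inv_f_f)
qed

end

section \<open>Ring structure of the tuple algebra\<close>

locale tuple_ring = cring L + subring k L for k and L :: "('a, 'm) ring_scheme" (structure) +
  fixes n :: nat
begin

abbreviation TA where "TA \<equiv> tuple_algebra k L n"
abbreviation tmult where "tmult \<equiv> tuple_mult L n"
abbreviation tone where "tone \<equiv> tuple_one L n"
abbreviation tup where "tup \<equiv> tuples L n"

lemma is_subring: "subring k L"
  by (rule subring_axioms)

lemma k_subset: "k \<subseteq> carrier L"
  using subringE(1)[OF is_subring] .

lemma tmult_closed [simp]: "x \<in> tup \<Longrightarrow> y \<in> tup \<Longrightarrow> tmult x y \<in> tup"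
  by (auto simp: tuple_mult_def tuples_def PiE_iff)

lemma tone_closed [simp]: "tone \<in> tup"
  by (auto simp: tuple_one_def tuples_def)

lemma tmult_assoc: "x \<in> tup \<Longrightarrow> y \<in> tup \<Longrightarrow> z \<in> tup \<Longrightarrow> tmult (tmult x y) z = tmult x (tmult y z)"
  by (auto simp: tuple_mult_def tuples_def PiE_iff m_assoc)

lemma tmult_comm: "x \<in> tup \<Longrightarrow> y \<in> tup \<Longrightarrow> tmult x y = tmult y x"
  by (auto simp: tuple_mult_def tuples_def PiE_iff m_comm)

lemma tmult_one: "x \<in> tup \<Longrightarrow> tmult tone x = x"
  by (auto simp: tuple_mult_def tuple_one_def tuples_def PiE_iff extensional_def)

lemma TA_carrier: "c \<in> carrier TA \<longleftrightarrow> range c \<subseteq> k \<and> finite (supp L c) \<and> supp L c \<subseteq> tup"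
  by (simp add: tuple_algebra_def)

lemma TA_finitely_supported: "c \<in> carrier TA \<Longrightarrow> c \<in> finitely_supported L"
  using k_subset by (auto simp: TA_carrier finitely_supported_def)

lemma TA_supp: "c \<in> carrier TA \<Longrightarrow> finite (supp L c)" "c \<in> carrier TA \<Longrightarrow> x \<in> supp L c \<Longrightarrow> x \<in> tup"
  by (auto simp: TA_carrier)

lemma TA_values: "c \<in> carrier TA \<Longrightarrow> c x \<in> k" "c \<in> carrier TA \<Longrightarrow> c x \<in> carrier L"
  using k_subset by (auto simp: TA_carrier)

lemma TA_add: "c \<oplus>\<^bsub>TA\<^esub> d = (\<lambda>z. c z \<oplus> d z)"
  by (simp add: tuple_algebra_def)

lemma TA_zero: "\<zero>\<^bsub>TA\<^esub> = (\<lambda>z. \<zero>)"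
  by (simp add: tuple_algebra_def)

lemma TA_one: "\<one>\<^bsub>TA\<^esub> = single L \<one> tone"
  by (auto simp: tuple_algebra_def single_def)

lemma single_closed: "a \<in> k \<Longrightarrow> x \<in> tup \<Longrightarrow> single L a x \<in> carrier TA"
  using subringE(2)[OF is_subring] by (auto simp: TA_carrier single_def supp_def)

lemma TA_mult_eq:
  assumes c: "c \<in> carrier TA" and d: "d \<in> carrier TA"
  shows "(c \<otimes>\<^bsub>TA\<^esub> d) z =
    (\<Oplus>p\<in>{p \<in> supp L c \<times> supp L d. tmult (fst p) (snd p) = z}. c (fst p) \<otimes> d (snd p))"
proof -
  note cl = TA_values(2)[OF c] TA_values(2)[OF d]
  note fin = TA_supp(1)[OF c] TA_supp(1)[OF d]
  have "(c \<otimes>\<^bsub>TA\<^esub> d) z = (\<Oplus>x\<in>supp L c. \<Oplus>y\<in>{y \<in> supp L d. tmult x y = z}. c x \<otimes> d y)"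
    by (simp add: tuple_algebra_def)
  also have "\<dots> = (\<Oplus>x\<in>supp L c. \<Oplus>y\<in>supp L d. if tmult x y = z then c x \<otimes> d y else \<zero>)"
    using cl fin by (intro finsum_cong' refl finsum_mono_neutral_left) (auto intro!: finsum_closed)
  also have "\<dots> = (\<Oplus>p\<in>supp L c \<times> supp L d. if tmult (fst p) (snd p) = z then c (fst p) \<otimes> d (snd p) else \<zero>)"
    using cl fin by (intro finsum_cartesian) auto
  also have "\<dots> = (\<Oplus>p\<in>{p \<in> supp L c \<times> supp L d. tmult (fst p) (snd p) = z}. c (fst p) \<otimes> d (snd p))"
    using cl fin by (intro finsum_mono_neutral_right) auto
  finally show ?thesis .
qed

lemma TA_mult_supp:
  assumes c: "c \<in> carrier TA" and d: "d \<in> carrier TA"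
  shows "supp L (c \<otimes>\<^bsub>TA\<^esub> d) \<subseteq> (\<lambda>p. tmult (fst p) (snd p)) ` (supp L c \<times> supp L d)"
proof
  fix z assume z: "z \<in> supp L (c \<otimes>\<^bsub>TA\<^esub> d)"
  show "z \<in> (\<lambda>p. tmult (fst p) (snd p)) ` (supp L c \<times> supp L d)"
  proof (rule ccontr)
    assume "z \<notin> (\<lambda>p. tmult (fst p) (snd p)) ` (supp L c \<times> supp L d)"
    then have "{p \<in> supp L c \<times> supp L d. tmult (fst p) (snd p) = z} = {}"
      by blast
    then show False
      using z TA_mult_eq[OF c d, of z] by (simp add: supp_def del: Collect_empty_eq)
  qed
qed

lemma finsum_in_k:
  assumes "f \<in> A \<rightarrow> k"
  shows "(\<Oplus>x\<in>A. f x) \<in> k"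
  using assms
proof (induction A rule: infinite_finite_induct)
  case (insert x A)
  then have "f \<in> insert x A \<rightarrow> carrier L"
    using k_subset by auto
  then show ?case
    using insert subringE(7)[OF is_subring] by simp
qed (use subringE(2)[OF is_subring] in auto)

lemma TA_mult_closed:
  assumes c: "c \<in> carrier TA" and d: "d \<in> carrier TA"
  shows "c \<otimes>\<^bsub>TA\<^esub> d \<in> carrier TA"
proof -
  have "(c \<otimes>\<^bsub>TA\<^esub> d) z \<in> k" for z
    unfolding TA_mult_eq[OF c d] using TA_values(1)[OF c] TA_values(1)[OF d] subringE(6)[OF is_subring]
    by (intro finsum_in_k) auto
  moreover have "finite (supp L (c \<otimes>\<^bsub>TA\<^esub> d))"
    using finite_subset[OF TA_mult_supp[OF c d]] TA_supp(1)[OF c] TA_supp(1)[OF d] by simp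
  moreover have "supp L (c \<otimes>\<^bsub>TA\<^esub> d) \<subseteq> tup"
    using TA_mult_supp[OF c d] TA_supp(2)[OF c] TA_supp(2)[OF d] by fastforce
  ultimately show ?thesis
    by (auto simp: TA_carrier)
qed

text \<open>Products are convolutions along \<open>tmult\<close>: grouping the pairs of tuples by
  their product turns a sum over products into a double sum. With \<open>delta z\<close> for
  \<open>F\<close> this serves the ring axioms, with products of values of points it makes
  \<open>tuple_hom\<close> multiplicative.\<close>

lemma pairing_mult:
  assumes "ring_hom_cring L S h" and c: "c \<in> carrier TA" and d: "d \<in> carrier TA"
    and F: "F \<in> tup \<rightarrow> carrier S"
  shows "ring_hom_cring.pairing L S h (c \<otimes>\<^bsub>TA\<^esub> d) F =
    ring_hom_cring.pairing L S h c (\<lambda>x. ring_hom_cring.pairing L S h d (\<lambda>y. F (tmult x y)))"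
proof -
  interpret h: ring_hom_cring L S h by fact
  let ?P = "supp L c \<times> supp L d" and ?m = "\<lambda>p. tmult (fst p) (snd p)"
  let ?g = "\<lambda>p. (h (c (fst p)) \<otimes>\<^bsub>S\<^esub> h (d (snd p))) \<otimes>\<^bsub>S\<^esub> F (?m p)"
  have fin: "finite ?P"
    using TA_supp(1)[OF c] TA_supp(1)[OF d] by simp
  have cl: "h (c x) \<in> carrier S" "h (d x) \<in> carrier S" for x
    using TA_values(2)[OF c] TA_values(2)[OF d] by auto
  have Fm: "F (tmult x y) \<in> carrier S" if "x \<in> supp L c" "y \<in> supp L d" for x y
    using F TA_supp(2)[OF c that(1)] TA_supp(2)[OF d that(2)] tmult_closed by blast
  have "h.pairing (c \<otimes>\<^bsub>TA\<^esub> d) F = (\<Oplus>\<^bsub>S\<^esub>z\<in>?m ` ?P. h ((c \<otimes>\<^bsub>TA\<^esub> d) z) \<otimes>\<^bsub>S\<^esub> F z)"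
    using TA_finitely_supported[OF TA_mult_closed[OF c d]] TA_mult_supp[OF c d] fin Fm
    by (intro h.pairing_superset) auto
  also have "\<dots> = (\<Oplus>\<^bsub>S\<^esub>z\<in>?m ` ?P. \<Oplus>\<^bsub>S\<^esub>p\<in>{p \<in> ?P. ?m p = z}. ?g p)"
  proof (intro h.S.finsum_cong' refl)
    fix z assume z: "z \<in> ?m ` ?P"
    then have Fz: "F z \<in> carrier S"
      using Fm by auto
    have "h ((c \<otimes>\<^bsub>TA\<^esub> d) z) = (\<Oplus>\<^bsub>S\<^esub>p\<in>{p \<in> ?P. ?m p = z}. h (c (fst p)) \<otimes>\<^bsub>S\<^esub> h (d (snd p)))"
      unfolding TA_mult_eq[OF c d] using TA_values(2)[OF c] TA_values(2)[OF d]
      by (subst h.hom_finsum) (auto intro!: h.S.finsum_cong')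
    then have "h ((c \<otimes>\<^bsub>TA\<^esub> d) z) \<otimes>\<^bsub>S\<^esub> F z =
        (\<Oplus>\<^bsub>S\<^esub>p\<in>{p \<in> ?P. ?m p = z}. (h (c (fst p)) \<otimes>\<^bsub>S\<^esub> h (d (snd p))) \<otimes>\<^bsub>S\<^esub> F z)"
      using fin cl Fz by (simp only: h.S.finsum_ldistr finite_Collect_conjI simp_thms) 
        (intro h.S.finsum_ldistr, auto)
    also have "\<dots> = (\<Oplus>\<^bsub>S\<^esub>p\<in>{p \<in> ?P. ?m p = z}. ?g p)"
      using cl Fz by (intro h.S.finsum_cong') auto
    finally show "h ((c \<otimes>\<^bsub>TA\<^esub> d) z) \<otimes>\<^bsub>S\<^esub> F z = (\<Oplus>\<^bsub>S\<^esub>p\<in>{p \<in> ?P. ?m p = z}. ?g p)" .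
  next
    show "(\<lambda>z. \<Oplus>\<^bsub>S\<^esub>p\<in>{p \<in> ?P. ?m p = z}. ?g p) \<in> ?m ` ?P \<rightarrow> carrier S"
      using cl Fm by (intro funcsetI h.S.finsum_closed) auto
  qed
  also have "\<dots> = (\<Oplus>\<^bsub>S\<^esub>p\<in>?P. ?g p)"
    using fin cl Fm by (intro h.S.finsum_fibers[symmetric]) auto
  also have "\<dots> = (\<Oplus>\<^bsub>S\<^esub>x\<in>supp L c. \<Oplus>\<^bsub>S\<^esub>y\<in>supp L d. (h (c x) \<otimes>\<^bsub>S\<^esub> h (d y)) \<otimes>\<^bsub>S\<^esub> F (tmult x y))"
    using TA_supp(1)[OF c] TA_supp(1)[OF d] cl Fm by (intro h.S.finsum_cartesian[symmetric]) auto
  also have "\<dots> = h.pairing c (\<lambda>x. h.pairing d (\<lambda>y. F (tmult x y)))"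
    unfolding h.pairing_def
  proof (intro h.S.finsum_cong' refl)
    fix x assume x: "x \<in> supp L c"
    have "(\<Oplus>\<^bsub>S\<^esub>y\<in>supp L d. (h (c x) \<otimes>\<^bsub>S\<^esub> h (d y)) \<otimes>\<^bsub>S\<^esub> F (tmult x y)) =
        (\<Oplus>\<^bsub>S\<^esub>y\<in>supp L d. h (c x) \<otimes>\<^bsub>S\<^esub> (h (d y) \<otimes>\<^bsub>S\<^esub> F (tmult x y)))"
      using x cl Fm by (intro h.S.finsum_cong') (auto simp: h.S.m_assoc)
    also have "\<dots> = h (c x) \<otimes>\<^bsub>S\<^esub> (\<Oplus>\<^bsub>S\<^esub>y\<in>supp L d. h (d y) \<otimes>\<^bsub>S\<^esub> F (tmult x y))"
      using x cl Fm TA_supp(1)[OF d] by (intro h.S.finsum_rdistr[symmetric]) auto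
    finally show "(\<Oplus>\<^bsub>S\<^esub>y\<in>supp L d. (h (c x) \<otimes>\<^bsub>S\<^esub> h (d y)) \<otimes>\<^bsub>S\<^esub> F (tmult x y)) =
        h (c x) \<otimes>\<^bsub>S\<^esub> (\<Oplus>\<^bsub>S\<^esub>y\<in>supp L d. h (d y) \<otimes>\<^bsub>S\<^esub> F (tmult x y))" .
  next
    show "(\<lambda>x. h (c x) \<otimes>\<^bsub>S\<^esub> (\<Oplus>\<^bsub>S\<^esub>y\<in>supp L d. h (d y) \<otimes>\<^bsub>S\<^esub> F (tmult x y))) \<in> supp L c \<rightarrow> carrier S"
      using cl Fm by (intro funcsetI h.S.m_closed h.S.finsum_closed) auto
  qed
  finally show ?thesis .
qed

lemma id_hom: "ring_hom_cring L L (\<lambda>x. x)"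
  by unfold_locales (simp add: ring_hom_def)

abbreviation id_pairing :: "('t \<Rightarrow> 'a) \<Rightarrow> ('t \<Rightarrow> 'a) \<Rightarrow> 'a"
  where "id_pairing \<equiv> ring_hom_cring.pairing L L (\<lambda>x. x)"

lemmas id_pairing_superset = ring_hom_cring.pairing_superset[OF id_hom]
  and id_pairing_closed = ring_hom_cring.pairing_closed[OF id_hom]
  and id_pairing_cong = ring_hom_cring.pairing_cong[OF id_hom]
  and id_pairing_add = ring_hom_cring.pairing_add[OF id_hom]
  and id_pairing_single = ring_hom_cring.pairing_single[OF id_hom]
  and id_pairing_reindex = ring_hom_cring.pairing_reindex[OF id_hom]

text \<open>Pairing with \<open>delta z\<close> reads off the coefficient at \<open>z\<close>, so
  that statements on coefficients become statements on pairings.\<close>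

definition delta :: "'t \<Rightarrow> 't \<Rightarrow> 'a"
  where "delta z x = (if x = z then \<one> else \<zero>)"

lemma delta_closed [simp]: "delta z x \<in> carrier L"
  by (simp add: delta_def)

lemma pairing_delta:
  assumes c: "c \<in> finitely_supported L"
  shows "id_pairing c (delta z) = c z"
proof -
  have "id_pairing c (delta z) = (\<Oplus>x\<in>insert z (supp L c). c x \<otimes> delta z x)"
    using c finitely_supported_finite by (intro id_pairing_superset) auto
  also have "\<dots> = c z \<otimes> delta z z"
    using c finitely_supported_finite by (intro finsum_eq_single) (auto simp: delta_def)
  finally show ?thesis
    using c by (simp add: delta_def)
qed

lemma TA_mult_pairing:
  assumes c: "c \<in> carrier TA" and d: "d \<in> carrier TA"
  shows "(c \<otimes>\<^bsub>TA\<^esub> d) z = id_pairing c (\<lambda>x. id_pairing d (\<lambda>y. delta z (tmult x y)))"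
  using pairing_delta[OF TA_finitely_supported[OF TA_mult_closed[OF c d]], of z]
    pairing_mult[OF id_hom c d, of "delta z"] by simp

text \<open>By \<open>pairing_mult\<close> both bracketings are threefold pairings, and
  associativity of \<open>tmult\<close> identifies them; distributivity is additivity of the
  pairing. Commutativity exchanges the components of the pairs of tuples.\<close>

lemma TA_cring: "cring TA"
proof (intro cringI abelian_groupI comm_monoidI)
  fix c d assume c: "c \<in> carrier TA" and d: "d \<in> carrier TA"
  have "supp L (c \<oplus>\<^bsub>TA\<^esub> d) \<subseteq> supp L c \<union> supp L d"
    by (auto simp: TA_add supp_def)
  moreover have "finite (supp L c \<union> supp L d)"
    using TA_supp(1)[OF c] TA_supp(1)[OF d] by simp
  ultimately have "finite (supp L (c \<oplus>\<^bsub>TA\<^esub> d))" "supp L (c \<oplus>\<^bsub>TA\<^esub> d) \<subseteq> tup"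
    using finite_subset c d by (simp_all only: TA_carrier) blast+
  then show "c \<oplus>\<^bsub>TA\<^esub> d \<in> carrier TA"
    using TA_values(1)[OF c] TA_values(1)[OF d] subringE(7)[OF is_subring] by (auto simp: TA_carrier TA_add)
  show "c \<oplus>\<^bsub>TA\<^esub> d = d \<oplus>\<^bsub>TA\<^esub> c"
    using TA_values(2)[OF c] TA_values(2)[OF d] by (auto simp: TA_add a_comm)
  show "c \<otimes>\<^bsub>TA\<^esub> d \<in> carrier TA"
    by (rule TA_mult_closed[OF c d])
  show "c \<otimes>\<^bsub>TA\<^esub> d = d \<otimes>\<^bsub>TA\<^esub> c"
  proof
    fix z
    let ?P = "{p \<in> supp L c \<times> supp L d. tmult (fst p) (snd p) = z}"
    let ?Q = "{p \<in> supp L d \<times> supp L c. tmult (fst p) (snd p) = z}"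
    have im: "prod.swap ` ?P = ?Q"
      using tmult_comm TA_supp(2)[OF c] TA_supp(2)[OF d] by (fastforce simp: image_iff)
    have "(d \<otimes>\<^bsub>TA\<^esub> c) z = (\<Oplus>p\<in>prod.swap ` ?P. d (fst p) \<otimes> c (snd p))"
      using TA_mult_eq[OF d c] im by simp
    also have "\<dots> = (\<Oplus>p\<in>?P. d (fst (prod.swap p)) \<otimes> c (snd (prod.swap p)))"
      using TA_values(2)[OF c] TA_values(2)[OF d] by (intro finsum_reindex) (auto simp: inj_on_def)
    also have "\<dots> = (c \<otimes>\<^bsub>TA\<^esub> d) z"
      unfolding TA_mult_eq[OF c d] using TA_values(2)[OF c] TA_values(2)[OF d]
      by (intro finsum_cong') (auto simp: m_comm)
    finally show "(c \<otimes>\<^bsub>TA\<^esub> d) z = (d \<otimes>\<^bsub>TA\<^esub> c) z"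
      by simp
  qed
  fix e assume e: "e \<in> carrier TA"
  show "c \<oplus>\<^bsub>TA\<^esub> d \<oplus>\<^bsub>TA\<^esub> e = c \<oplus>\<^bsub>TA\<^esub> (d \<oplus>\<^bsub>TA\<^esub> e)"
    using TA_values(2)[OF c] TA_values(2)[OF d] TA_values(2)[OF e] by (auto simp: TA_add a_assoc)
  note fs = TA_finitely_supported
  have inner: "id_pairing e G \<in> carrier L" if "\<And>x. G x \<in> carrier L" for G
    using that fs[OF e] by (intro id_pairing_closed) auto
  have inner2: "id_pairing d G \<in> carrier L" if "\<And>x. G x \<in> carrier L" for G
    using that fs[OF d] by (intro id_pairing_closed) auto
  show "c \<otimes>\<^bsub>TA\<^esub> d \<otimes>\<^bsub>TA\<^esub> e = c \<otimes>\<^bsub>TA\<^esub> (d \<otimes>\<^bsub>TA\<^esub> e)"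
  proof
    fix z
    have "(c \<otimes>\<^bsub>TA\<^esub> d \<otimes>\<^bsub>TA\<^esub> e) z =
        id_pairing c (\<lambda>x. id_pairing d (\<lambda>y. id_pairing e (\<lambda>v. delta z (tmult (tmult x y) v))))"
      using TA_mult_pairing[OF TA_mult_closed[OF c d] e]
        pairing_mult[OF id_hom c d, of "\<lambda>w. id_pairing e (\<lambda>v. delta z (tmult w v))"] inner
      by simp
    also have "\<dots> = id_pairing c (\<lambda>x. id_pairing d (\<lambda>y. id_pairing e (\<lambda>v. delta z (tmult x (tmult y v)))))"
      using c d e TA_supp(2) tmult_assoc fs inner inner2
      by (intro id_pairing_cong funcsetI) auto
    also have "\<dots> = id_pairing c (\<lambda>x. id_pairing (d \<otimes>\<^bsub>TA\<^esub> e) (\<lambda>w. delta z (tmult x w)))"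
      using pairing_mult[OF id_hom d e, of "\<lambda>w. delta z (tmult x w)" for x] by simp
    also have "\<dots> = (c \<otimes>\<^bsub>TA\<^esub> (d \<otimes>\<^bsub>TA\<^esub> e)) z"
      using TA_mult_pairing[OF c TA_mult_closed[OF d e]] by simp
    finally show "(c \<otimes>\<^bsub>TA\<^esub> d \<otimes>\<^bsub>TA\<^esub> e) z = (c \<otimes>\<^bsub>TA\<^esub> (d \<otimes>\<^bsub>TA\<^esub> e)) z" .
  qed
  show "(c \<oplus>\<^bsub>TA\<^esub> d) \<otimes>\<^bsub>TA\<^esub> e = c \<otimes>\<^bsub>TA\<^esub> e \<oplus>\<^bsub>TA\<^esub> d \<otimes>\<^bsub>TA\<^esub> e"
    using TA_mult_pairing[OF \<open>c \<oplus>\<^bsub>TA\<^esub> d \<in> carrier TA\<close> e] TA_mult_pairing[OF c e] TA_mult_pairing[OF d e]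
      id_pairing_add[OF fs[OF c] fs[OF d]] inner by (auto simp: TA_add)
next
  show zero: "\<zero>\<^bsub>TA\<^esub> \<in> carrier TA"
    using subringE(2)[OF is_subring] by (auto simp: TA_carrier TA_zero supp_def)
  show one: "\<one>\<^bsub>TA\<^esub> \<in> carrier TA"
    using single_closed subringE(3)[OF is_subring] by (simp add: TA_one)
  fix c assume c: "c \<in> carrier TA"
  show "\<zero>\<^bsub>TA\<^esub> \<oplus>\<^bsub>TA\<^esub> c = c"
    using TA_values(2)[OF c] by (auto simp: TA_add TA_zero)
  have "(\<lambda>z. \<ominus> c z) \<in> carrier TA"
    using c subringE(5)[OF is_subring] TA_values[OF c] by (auto simp: TA_carrier supp_def)
  moreover have "(\<lambda>z. \<ominus> c z) \<oplus>\<^bsub>TA\<^esub> c = \<zero>\<^bsub>TA\<^esub>"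
    using TA_values(2)[OF c] by (auto simp: TA_add TA_zero l_neg)
  ultimately show "\<exists>y\<in>carrier TA. y \<oplus>\<^bsub>TA\<^esub> c = \<zero>\<^bsub>TA\<^esub>"
    by blast
  show "\<one>\<^bsub>TA\<^esub> \<otimes>\<^bsub>TA\<^esub> c = c"
  proof
    fix z
    have "(\<one>\<^bsub>TA\<^esub> \<otimes>\<^bsub>TA\<^esub> c) z = id_pairing (single L \<one> tone) (\<lambda>x. id_pairing c (\<lambda>y. delta z (tmult x y)))"
      using TA_mult_pairing[OF one c] by (simp add: TA_one)
    also have "\<dots> = id_pairing c (\<lambda>y. delta z (tmult tone y))"
      using id_pairing_closed[OF TA_finitely_supported[OF c]] by (subst id_pairing_single) auto
    also have "\<dots> = id_pairing c (delta z)"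
      using TA_finitely_supported[OF c] TA_supp(2)[OF c] tmult_one by (intro id_pairing_cong) auto
    also have "\<dots> = c z"
      using pairing_delta[OF TA_finitely_supported[OF c]] .
    finally show "(\<one>\<^bsub>TA\<^esub> \<otimes>\<^bsub>TA\<^esub> c) z = c z" .
  qed
qed

section \<open>The tensor power and its permutation action\<close>

sublocale TA: cring TA
  by (rule TA_cring)

lemma single_add: "a \<in> carrier L \<Longrightarrow> b \<in> carrier L \<Longrightarrow> single L (a \<oplus> b) x = single L a x \<oplus>\<^bsub>TA\<^esub> single L b x"
  by (auto simp: TA_add single_def)

lemma single_mult:
  assumes "a \<in> k" "b \<in> k" "x \<in> tup" "y \<in> tup"
  shows "single L a x \<otimes>\<^bsub>TA\<^esub> single L b y = single L (a \<otimes> b) (tmult x y)"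
proof
  fix z
  have ab: "a \<in> carrier L" "b \<in> carrier L"
    using assms k_subset by auto
  have "(single L a x \<otimes>\<^bsub>TA\<^esub> single L b y) z = a \<otimes> (b \<otimes> delta z (tmult x y))"
    unfolding TA_mult_pairing[OF single_closed[OF assms(1,3)] single_closed[OF assms(2,4)]]
    using ab by (simp add: id_pairing_single)
  then show "(single L a x \<otimes>\<^bsub>TA\<^esub> single L b y) z = single L (a \<otimes> b) (tmult x y) z"
    using ab by (auto simp: delta_def single_def)
qed

lemma TA_finsum_apply:
  assumes "f \<in> A \<rightarrow> carrier TA"
  shows "(\<Oplus>\<^bsub>TA\<^esub>a\<in>A. f a) z = (\<Oplus>a\<in>A. f a z)"
  using assms
proof (induction A rule: infinite_finite_induct)
  case (insert a A)
  then have "(\<lambda>a. f a z) \<in> insert a A \<rightarrow> carrier L"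
    using TA_values(2) by auto
  then show ?case
    using insert by (simp add: TA_add)
qed (auto simp: TA_zero)

lemma TA_decomp:
  assumes c: "c \<in> carrier TA"
  shows "c = (\<Oplus>\<^bsub>TA\<^esub>x\<in>supp L c. single L (c x) x)"
proof
  fix z
  note cl = TA_values[OF c]
  have "(\<Oplus>\<^bsub>TA\<^esub>x\<in>supp L c. single L (c x) x) z = (\<Oplus>x\<in>supp L c. single L (c x) x z)"
    using cl(1) TA_supp(2)[OF c] single_closed by (intro TA_finsum_apply) auto
  also have "\<dots> = (\<Oplus>x\<in>insert z (supp L c). single L (c x) x z)"
    using cl(2) TA_supp(1)[OF c] by (intro finsum_mono_neutral_left) (auto simp: single_def supp_def)
  also have "\<dots> = c z"
    using cl(2) TA_supp(1)[OF c] by (subst finsum_eq_single[of _ z]) (auto simp: single_def)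
  finally show "c z = (\<Oplus>\<^bsub>TA\<^esub>x\<in>supp L c. single L (c x) x) z"
    by simp
qed

lemma tup_upd: "x \<in> tup \<Longrightarrow> i \<in> {1..n} \<Longrightarrow> a \<in> carrier L \<Longrightarrow> x(i := a) \<in> tup"
  by (auto simp: tuples_def PiE_iff extensional_def)

lemma L_one_closed: "\<one> \<in> carrier L"
  by simp

lemma L_one_mult: "\<one> \<otimes> \<one> = \<one>"
  by simp

lemma one_in_k [simp]: "\<one> \<in> k"
  using subringE(3)[OF is_subring] .

text \<open>A tuple is the product of the tuples that have one of its entries and ones elsewhere.
  This makes pure tensors products of images of the factors.\<close>

lemma single_prod:
  assumes x: "x \<in> tup"
  shows "single L \<one> x = (\<Otimes>\<^bsub>TA\<^esub>i\<in>{1..n}. single L \<one> (tone(i := x i)))"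
proof -
  have xi: "x i \<in> carrier L" if "i \<in> {1..n}" for i
    using x that by (auto simp: tuples_def)
  have cl: "single L \<one> (tone(i := x i)) \<in> carrier TA" if "i \<in> {1..n}" for i
    using single_closed[OF one_in_k tup_upd[OF tone_closed that xi[OF that]]] .
  \<comment> \<open>The partial product over \<open>A\<close>: entries of \<open>x\<close> on
    \<open>A\<close>, ones at the other places.\<close>
  define mask where "mask A = (\<lambda>i\<in>{1..n}. if i \<in> A then x i else \<one>)" for A
  define u where "u i = tone(i := x i)" for i
  have "(\<Otimes>\<^bsub>TA\<^esub>i\<in>A. single L \<one> (u i)) = single L \<one> (mask A)" if "finite A" "A \<subseteq> {1..n}" for A
    using that
  proof (induction A)
    case empty
    have "mask {} = tone"
      by (simp add: mask_def tuple_one_def)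
    then show ?case
      by (simp add: TA_one)
  next
    case (insert j A)
    have j: "j \<in> {1..n}"
      using insert.prems by blast
    have mask: "mask A \<in> tup"
      using xi by (auto simp: mask_def tuples_def)
    have u: "u j \<in> tup"
      using tup_upd[OF tone_closed j xi[OF j]] by (simp only: u_def)
    have "(\<Otimes>\<^bsub>TA\<^esub>i\<in>insert j A. single L \<one> (u i)) = single L \<one> (u j) \<otimes>\<^bsub>TA\<^esub> (\<Otimes>\<^bsub>TA\<^esub>i\<in>A. single L \<one> (u i))"
      using insert.hyps insert.prems cl
      by (intro TA.finprod_insert) (auto simp only: u_def Pi_iff)
    also have "\<dots> = single L (\<one> \<otimes> \<one>) (tmult (u j) (mask A))"
      using insert single_mult[OF one_in_k one_in_k u mask] by (simp only: insert_subset)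
    also have "tmult (u j) (mask A) = mask (insert j A)"
      using insert xi by (auto simp: mask_def u_def tuple_mult_def tuple_one_def fun_eq_iff)
    finally show ?case
      by (simp only: L_one_mult)
  qed
  from this[of "{1..n}"] have "(\<Otimes>\<^bsub>TA\<^esub>i\<in>{1..n}. single L \<one> (u i)) = single L \<one> (mask {1..n})"
    by simp
  moreover have "mask {1..n} = x"
    using x by (auto simp: mask_def tuples_def PiE_iff extensional_def fun_eq_iff)
  ultimately show ?thesis
    by (simp only: u_def)
qed

lemma multilinear_relation_cases [consumes 1, case_names add scalar]:
  assumes "r \<in> multilinear_relations k L n"
  obtains x i a b where "x \<in> tup" "i \<in> {1..n}" "a \<in> carrier L" "b \<in> carrier L"
      "r = single L \<one> (x(i := a \<oplus> b)) \<ominus>\<^bsub>TA\<^esub> (single L \<one> (x(i := a)) \<oplus>\<^bsub>TA\<^esub> single L \<one> (x(i := b)))"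
    | x i a c where "x \<in> tup" "i \<in> {1..n}" "a \<in> carrier L" "c \<in> k"
      "r = single L \<one> (x(i := c \<otimes> a)) \<ominus>\<^bsub>TA\<^esub> single L c (x(i := a))"
  using assms unfolding multilinear_relations_def by blast

lemma relations_closed: "multilinear_relations k L n \<subseteq> carrier TA"
proof
  have cl: "single L c (x(i := y)) \<in> carrier TA"
    if "c \<in> k" "x \<in> tup" "i \<in> {1..n}" "y \<in> carrier L" for c x i y
    using single_closed[OF that(1) tup_upd[OF that(2-4)]] .
  fix r assume "r \<in> multilinear_relations k L n"
  then show "r \<in> carrier TA"
  proof (cases rule: multilinear_relation_cases)
    case (add x i a b)
    then show ?thesis
      using cl[OF one_in_k add(1,2)] by (simp only: TA.minus_closed TA.a_closed a_closed)
  next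
    case (scalar x i a c)
    then have "c \<otimes> a \<in> carrier L"
      using k_subset by auto
    then show ?thesis
      using cl[OF one_in_k scalar(1,2)] cl[OF scalar(4,1,2,3)] scalar(5) by (simp only: TA.minus_closed)
  qed
qed

section \<open>The quotient and the inclusions of the factors\<close>

abbreviation TI where "TI \<equiv> tensor_ideal k L n"
abbreviation TP where "TP \<equiv> tensor_power k L n"

definition proj :: "((nat \<Rightarrow> 'a) \<Rightarrow> 'a) \<Rightarrow> ((nat \<Rightarrow> 'a) \<Rightarrow> 'a) set"
  where "proj c = TI +>\<^bsub>TA\<^esub> c"

lemma TI_ideal: "ideal TI TA"
  unfolding tensor_ideal_def using TA.genideal_ideal[OF relations_closed] .

sublocale TI: ideal TI TA
  by (rule TI_ideal)

lemma relations_in_TI: "multilinear_relations k L n \<subseteq> TI"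
  unfolding tensor_ideal_def using TA.genideal_self[OF relations_closed] .

sublocale TP: cring TP
  unfolding tensor_power_def by (rule TI.quotient_is_cring[OF TA_cring])

lemma proj_hom: "proj \<in> ring_hom TA TP"
  unfolding tensor_power_def using TI.rcos_ring_hom by (simp add: proj_def[abs_def])

sublocale proj: ring_hom_cring TA TP proj
  by unfold_locales (rule proj_hom)

lemma TP_E:
  assumes "T \<in> carrier TP"
  obtains c where "c \<in> carrier TA" "T = proj c"
  using assms by (auto simp: tensor_power_def FactRing_def A_RCOSETS_def' proj_def)

lemma proj_eqI: "c \<in> carrier TA \<Longrightarrow> d \<in> carrier TA \<Longrightarrow> c \<ominus>\<^bsub>TA\<^esub> d \<in> TI \<Longrightarrow> proj c = proj d"
  using TA.quotient_eq_iff_same_a_r_cos[OF TI_ideal] by (simp add: proj_def)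

lemma proj_additive:
  assumes "x \<in> tup" "i \<in> {1..n}" "a \<in> carrier L" "b \<in> carrier L"
  shows "proj (single L \<one> (x(i := a \<oplus> b))) = proj (single L \<one> (x(i := a))) \<oplus>\<^bsub>TP\<^esub> proj (single L \<one> (x(i := b)))"
proof -
  have cl: "single L \<one> (x(i := c)) \<in> carrier TA" if "c \<in> carrier L" for c
    using single_closed[OF one_in_k tup_upd[OF assms(1,2) that]] .
  have "single L \<one> (x(i := a \<oplus> b)) \<ominus>\<^bsub>TA\<^esub> (single L \<one> (x(i := a)) \<oplus>\<^bsub>TA\<^esub> single L \<one> (x(i := b))) \<in> TI"
    using relations_in_TI assms unfolding multilinear_relations_def by blast
  then have "proj (single L \<one> (x(i := a \<oplus> b))) = proj (single L \<one> (x(i := a)) \<oplus>\<^bsub>TA\<^esub> single L \<one> (x(i := b)))"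
    using cl assms by (intro proj_eqI) auto
  then show ?thesis
    using cl assms by simp
qed

lemma proj_scalar:
  assumes "x \<in> tup" "i \<in> {1..n}" "a \<in> carrier L" "c \<in> k"
  shows "proj (single L \<one> (x(i := c \<otimes> a))) = proj (single L c (x(i := a)))"
proof (rule proj_eqI)
  show "single L \<one> (x(i := c \<otimes> a)) \<ominus>\<^bsub>TA\<^esub> single L c (x(i := a)) \<in> TI"
    using relations_in_TI assms unfolding multilinear_relations_def by blast
next
  show "single L \<one> (x(i := c \<otimes> a)) \<in> carrier TA"
    using assms k_subset by (intro single_closed one_in_k tup_upd) auto
  show "single L c (x(i := a)) \<in> carrier TA"
    using assms by (intro single_closed tup_upd)
qed

definition factor_hom :: "nat \<Rightarrow> 'a \<Rightarrow> ((nat \<Rightarrow> 'a) \<Rightarrow> 'a) set"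
  where "factor_hom i y = proj (single L \<one> (tone(i := y)))"

lemma tensor_scalar_eq: "tensor_scalar k L n c = proj (single L c tone)"
  by (simp add: tensor_scalar_def proj_def)

lemma tensor_scalar_hom: "tensor_scalar k L n \<in> ring_hom (L\<lparr>carrier := k\<rparr>) TP"
proof (rule ring_hom_memI)
  fix c d assume "c \<in> carrier (L\<lparr>carrier := k\<rparr>)" "d \<in> carrier (L\<lparr>carrier := k\<rparr>)"
  then have cd: "c \<in> k" "d \<in> k"
    by auto
  note cl = single_closed[OF cd(1) tone_closed] single_closed[OF cd(2) tone_closed]
  show "tensor_scalar k L n c \<in> carrier TP"
    using cl by (simp add: tensor_scalar_eq)
  show "tensor_scalar k L n (c \<otimes>\<^bsub>L\<lparr>carrier := k\<rparr>\<^esub> d) = tensor_scalar k L n c \<otimes>\<^bsub>TP\<^esub> tensor_scalar k L n d"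
    using cl single_mult[OF cd tone_closed tone_closed] proj.hom_mult[OF cl]
    by (simp add: tensor_scalar_eq tmult_one)
  show "tensor_scalar k L n (c \<oplus>\<^bsub>L\<lparr>carrier := k\<rparr>\<^esub> d) = tensor_scalar k L n c \<oplus>\<^bsub>TP\<^esub> tensor_scalar k L n d"
    using cl cd k_subset single_add[of c d tone] by (simp add: tensor_scalar_eq subset_iff)
qed (use proj.hom_one in \<open>simp add: tensor_scalar_eq TA_one\<close>)

text \<open>Products and the unit are respected already by tuples; additivity holds only in the
  quotient, by the first kind of relation.\<close>

lemma factor_hom_hom:
  assumes i: "i \<in> {1..n}"
  shows "factor_hom i \<in> ring_hom L TP"
proof (rule ring_hom_memI)
  have cl: "single L \<one> (tone(i := y)) \<in> carrier TA" if "y \<in> carrier L" for y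
    using single_closed[OF one_in_k tup_upd[OF tone_closed i that]] .
  fix x y assume xy: "x \<in> carrier L" "y \<in> carrier L"
  show "factor_hom i x \<in> carrier TP"
    using cl xy by (simp add: factor_hom_def)
  have "tmult (tone(i := x)) (tone(i := y)) = tone(i := x \<otimes> y)"
    using i by (auto simp: tuple_mult_def tuple_one_def fun_eq_iff)
  then show "factor_hom i (x \<otimes> y) = factor_hom i x \<otimes>\<^bsub>TP\<^esub> factor_hom i y"
    using single_mult[OF one_in_k one_in_k tup_upd[OF tone_closed i xy(1)] tup_upd[OF tone_closed i xy(2)]]
      proj.hom_mult[OF cl[OF xy(1)] cl[OF xy(2)]] by (simp add: factor_hom_def)
  show "factor_hom i (x \<oplus> y) = factor_hom i x \<oplus>\<^bsub>TP\<^esub> factor_hom i y"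
    using proj_additive[OF tone_closed i xy] by (simp add: factor_hom_def)
next
  have "tone(i := \<one>) = tone"
    using i by (auto simp: tuple_one_def)
  then show "factor_hom i \<one> = \<one>\<^bsub>TP\<^esub>"
    using proj.hom_one by (simp add: factor_hom_def TA_one)
qed

text \<open>The second kind of relation, at the tuple of ones, moves the scalar out of place
  \<open>i\<close>. So all factors induce the same structure map on \<open>k\<close>.\<close>

lemma factor_hom_scalar:
  assumes i: "i \<in> {1..n}" and c: "c \<in> k"
  shows "factor_hom i c = tensor_scalar k L n c"
proof -
  have "tone(i := \<one>) = tone"
    using i by (auto simp: tuple_one_def)
  then show ?thesis
    using proj_scalar[OF tone_closed i L_one_closed c] c k_subset
    by (simp add: factor_hom_def tensor_scalar_eq subset_iff)
qed

lemma proj_single: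
  assumes a: "a \<in> k" and x: "x \<in> tup"
  shows "proj (single L a x) = tensor_scalar k L n a \<otimes>\<^bsub>TP\<^esub> (\<Otimes>\<^bsub>TP\<^esub>i\<in>{1..n}. factor_hom i (x i))"
proof -
  have cl: "single L \<one> (tone(i := x i)) \<in> carrier TA" if "i \<in> {1..n}" for i
    using x that by (intro single_closed one_in_k tup_upd tone_closed) (auto simp: tuples_def)
  have "proj (single L a x) = proj (single L a tone \<otimes>\<^bsub>TA\<^esub> single L \<one> x)"
    using single_mult[OF a one_in_k tone_closed x] a k_subset x by (simp add: tmult_one subset_iff)
  also have "\<dots> = tensor_scalar k L n a \<otimes>\<^bsub>TP\<^esub> proj (single L \<one> x)"
    using proj.hom_mult[OF single_closed[OF a tone_closed] single_closed[OF one_in_k x]]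
    by (simp add: tensor_scalar_eq)
  also have "proj (single L \<one> x) = (\<Otimes>\<^bsub>TP\<^esub>i\<in>{1..n}. factor_hom i (x i))"
    unfolding single_prod[OF x] using cl
    by (subst proj.hom_finprod) (auto simp: factor_hom_def o_def)
  finally show ?thesis .
qed

lemma TP_generated:
  assumes T: "T \<in> carrier TP"
  shows "\<exists>A c. finite A \<and> A \<subseteq> ({1..n} \<rightarrow>\<^sub>E carrier L) \<and> c \<in> A \<rightarrow> k \<and>
    T = (\<Oplus>\<^bsub>TP\<^esub>x\<in>A. tensor_scalar k L n (c x) \<otimes>\<^bsub>TP\<^esub> (\<Otimes>\<^bsub>TP\<^esub>i\<in>{1..n}. factor_hom i (x i)))"
proof -
  obtain c where c: "c \<in> carrier TA" "T = proj c"
    using TP_E[OF T] .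
  have cl: "single L (c x) x \<in> carrier TA" if "x \<in> supp L c" for x
    using single_closed TA_values(1)[OF c(1)] TA_supp(2)[OF c(1) that] by blast
  have "T = proj (\<Oplus>\<^bsub>TA\<^esub>x\<in>supp L c. single L (c x) x)"
    using c TA_decomp by simp
  also have "\<dots> = (\<Oplus>\<^bsub>TP\<^esub>x\<in>supp L c. proj (single L (c x) x))"
    using cl by (subst proj.hom_finsum) (auto simp: o_def)
  also have "\<dots> = (\<Oplus>\<^bsub>TP\<^esub>x\<in>supp L c. tensor_scalar k L n (c x) \<otimes>\<^bsub>TP\<^esub> (\<Otimes>\<^bsub>TP\<^esub>i\<in>{1..n}. factor_hom i (x i)))"
  proof (intro TP.finsum_cong' refl funcsetI)
    fix x assume x: "x \<in> supp L c"
    show "proj (single L (c x) x) = tensor_scalar k L n (c x) \<otimes>\<^bsub>TP\<^esub> (\<Otimes>\<^bsub>TP\<^esub>i\<in>{1..n}. factor_hom i (x i))"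
      by (rule proj_single[OF TA_values(1)[OF c(1)] TA_supp(2)[OF c(1) x]])
    then show "tensor_scalar k L n (c x) \<otimes>\<^bsub>TP\<^esub> (\<Otimes>\<^bsub>TP\<^esub>i\<in>{1..n}. factor_hom i (x i)) \<in> carrier TP"
      using cl[OF x] proj.hom_closed by metis
  qed
  finally show ?thesis
    using TA_carrier c(1) by (intro exI[of _ "supp L c"] exI[of _ c]) (auto simp: tuples_def)
qed

section \<open>Permutations of the factors\<close>

definition coeff_act :: "(nat \<Rightarrow> nat) \<Rightarrow> ((nat \<Rightarrow> 'a) \<Rightarrow> 'a) \<Rightarrow> ((nat \<Rightarrow> 'a) \<Rightarrow> 'a)"
  where "coeff_act \<pi> c = (\<lambda>x. c (x \<circ> \<pi>))"

context
  fixes \<pi> :: "nat \<Rightarrow> nat"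
  assumes \<pi>: "\<pi> permutes {1..n}"
begin

lemma comp_inverses: "(x \<circ> \<pi>) \<circ> inv' \<pi> = x" "(x \<circ> inv' \<pi>) \<circ> \<pi> = x"
  using permutes_inv_o[OF \<pi>] by (simp_all add: o_assoc[symmetric])

lemma bij_comp: "bij (\<lambda>x::nat \<Rightarrow> 'a. x \<circ> \<pi>)"
  by (rule o_bij[of "\<lambda>x. x \<circ> inv' \<pi>"]) (auto simp only: comp_inverses comp_apply id_apply fun_eq_iff[of "_ \<circ> _" id])

lemma inv_comp: "inv' (\<lambda>x::nat \<Rightarrow> 'a. x \<circ> \<pi>) = (\<lambda>x. x \<circ> inv' \<pi>)"
  by (rule inv_equality) (simp_all only: comp_inverses)

lemma tup_comp: "x \<circ> \<pi> \<in> tup \<longleftrightarrow> x \<in> tup" "x \<circ> inv' \<pi> \<in> tup \<longleftrightarrow> x \<in> tup"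
proof -
  have *: "y \<circ> \<rho> \<in> tup" if "y \<in> tup" "\<rho> permutes {1..n}" for y and \<rho> :: "nat \<Rightarrow> nat"
    using comp_PiE[OF that(2)] that(1) unfolding tuples_def by blast
  show "x \<circ> \<pi> \<in> tup \<longleftrightarrow> x \<in> tup" "x \<circ> inv' \<pi> \<in> tup \<longleftrightarrow> x \<in> tup"
    using *[OF _ \<pi>] *[OF _ permutes_inv[OF \<pi>]] comp_inverses by metis+
qed

lemma coeff_act_single: "coeff_act \<pi> (single L a x) = single L a (x \<circ> inv' \<pi>)"
  unfolding coeff_act_def single_def using comp_inverses by metis

lemma tone_comp: "tone \<circ> \<pi> = tone" "tone \<circ> inv' \<pi> = tone"
  using permutes_in_image[OF \<pi>] permutes_in_image[OF permutes_inv[OF \<pi>]]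
  by (auto simp: tuple_one_def fun_eq_iff)

lemma tmult_comp:
  assumes "x \<in> tup" "y \<in> tup"
  shows "tmult (x \<circ> inv' \<pi>) (y \<circ> inv' \<pi>) = tmult x y \<circ> inv' \<pi>"
  using permutes_in_image[OF permutes_inv[OF \<pi>]] by (auto simp: tuple_mult_def fun_eq_iff)

lemma coeff_act_closed:
  assumes c: "c \<in> carrier TA"
  shows "coeff_act \<pi> c \<in> carrier TA"
proof -
  have eq: "supp L (coeff_act \<pi> c) = (\<lambda>x. x \<circ> \<pi>) -` supp L c"
    by (auto simp: coeff_act_def supp_def)
  have "finite (supp L (coeff_act \<pi> c))"
    unfolding eq using TA_supp(1)[OF c] bij_is_inj[OF bij_comp] by (rule finite_vimageI)
  moreover have "supp L (coeff_act \<pi> c) \<subseteq> tup"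
    using TA_supp(2)[OF c] tup_comp(1) unfolding eq by blast
  ultimately show ?thesis
    using TA_values(1)[OF c] by (auto simp: TA_carrier coeff_act_def)
qed

text \<open>Multiplicativity is reindexing of the two pairings: shifting both tuples by
  \<open>inv' \<pi>\<close> shifts their product, which in \<open>delta z\<close> amounts to a shift
  of \<open>z\<close> by \<open>\<pi>\<close>.\<close>

lemma coeff_act_hom: "coeff_act \<pi> \<in> ring_hom TA TA"
proof (rule ring_hom_memI)
  fix c d assume c: "c \<in> carrier TA" and d: "d \<in> carrier TA"
  show "coeff_act \<pi> c \<in> carrier TA"
    by (rule coeff_act_closed[OF c])
  show "coeff_act \<pi> (c \<oplus>\<^bsub>TA\<^esub> d) = coeff_act \<pi> c \<oplus>\<^bsub>TA\<^esub> coeff_act \<pi> d"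
    by (simp add: coeff_act_def TA_add)
  note fs = TA_finitely_supported
  have inner: "id_pairing d G \<in> carrier L" if "\<And>x. G x \<in> carrier L" for G
    using that fs[OF d] by (intro id_pairing_closed) auto
  have reindex: "id_pairing (coeff_act \<pi> e) G = id_pairing e (\<lambda>x. G (x \<circ> inv' \<pi>))"
    if "e \<in> carrier TA" "\<And>x. G x \<in> carrier L" for e G
    using id_pairing_reindex[OF fs[OF that(1)] bij_comp, of G] that(2)
    by (simp only: coeff_act_def inv_comp) auto
  show "coeff_act \<pi> (c \<otimes>\<^bsub>TA\<^esub> d) = coeff_act \<pi> c \<otimes>\<^bsub>TA\<^esub> coeff_act \<pi> d"
  proof
    fix z
    have delta_comp: "delta z (w \<circ> inv' \<pi>) = delta (z \<circ> \<pi>) w" for w :: "nat \<Rightarrow> 'a"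
      unfolding delta_def using comp_inverses by metis
    have "(coeff_act \<pi> c \<otimes>\<^bsub>TA\<^esub> coeff_act \<pi> d) z =
        id_pairing c (\<lambda>x. id_pairing d (\<lambda>y. delta z (tmult (x \<circ> inv' \<pi>) (y \<circ> inv' \<pi>))))"
      unfolding TA_mult_pairing[OF coeff_act_closed[OF c] coeff_act_closed[OF d]]
      using inner reindex[OF c] reindex[OF d] by simp
    also have "\<dots> = id_pairing c (\<lambda>x. id_pairing d (\<lambda>y. delta (z \<circ> \<pi>) (tmult x y)))"
      using TA_supp(2)[OF c] TA_supp(2)[OF d] inner fs[OF c] fs[OF d]
      by (intro id_pairing_cong funcsetI) (simp_all only: tmult_comp delta_comp delta_closed)
    also have "\<dots> = (c \<otimes>\<^bsub>TA\<^esub> d) (z \<circ> \<pi>)"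
      by (rule TA_mult_pairing[OF c d, symmetric])
    finally show "coeff_act \<pi> (c \<otimes>\<^bsub>TA\<^esub> d) z = (coeff_act \<pi> c \<otimes>\<^bsub>TA\<^esub> coeff_act \<pi> d) z"
      by (simp only: coeff_act_def)
  qed
qed (simp only: TA_one coeff_act_single tone_comp)

lemma upd_comp: "(x(i := a)) \<circ> inv' \<pi> = (x \<circ> inv' \<pi>)(\<pi> i := a)"
  using permutes_inverses[OF \<pi>] by (auto simp: fun_eq_iff)

text \<open>A relation at place \<open>i\<close> becomes one of the same kind at place
  \<open>\<pi> i\<close>.\<close>

lemma coeff_act_relations:
  assumes "r \<in> multilinear_relations k L n"
  shows "coeff_act \<pi> r \<in> multilinear_relations k L n"
proof -
  interpret h: ring_hom_cring TA TA "coeff_act \<pi>"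
    by unfold_locales (rule coeff_act_hom)
  have \<pi>i: "\<pi> i \<in> {1..n}" if "i \<in> {1..n}" for i
    using that permutes_in_image[OF \<pi>] by blast
  from assms show ?thesis
  proof (cases rule: multilinear_relation_cases)
    case (add x i a b)
    have cl: "single L \<one> (x(i := y)) \<in> carrier TA" if "y \<in> carrier L" for y
      using single_closed[OF one_in_k tup_upd[OF add(1,2) that]] .
    have "coeff_act \<pi> r = single L \<one> ((x \<circ> inv' \<pi>)(\<pi> i := a \<oplus> b)) \<ominus>\<^bsub>TA\<^esub>
        (single L \<one> ((x \<circ> inv' \<pi>)(\<pi> i := a)) \<oplus>\<^bsub>TA\<^esub> single L \<one> ((x \<circ> inv' \<pi>)(\<pi> i := b)))"
      using cl add(3,4) unfolding add(5)
      by (simp add: h.hom_sub coeff_act_single upd_comp del: fun_upd_apply)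
    then show ?thesis
      using \<pi>i[OF add(2)] tup_comp(2)[of x] add(1,3,4) unfolding multilinear_relations_def by blast
  next
    case (scalar x i a c)
    have cl: "single L d (x(i := y)) \<in> carrier TA" if "d \<in> k" "y \<in> carrier L" for d y
      using single_closed[OF that(1) tup_upd[OF scalar(1,2) that(2)]] .
    have "coeff_act \<pi> r = single L \<one> ((x \<circ> inv' \<pi>)(\<pi> i := c \<otimes> a)) \<ominus>\<^bsub>TA\<^esub>
        single L c ((x \<circ> inv' \<pi>)(\<pi> i := a))"
      using cl scalar(3,4) k_subset unfolding scalar(5)
      by (simp add: h.hom_sub coeff_act_single upd_comp subset_iff del: fun_upd_apply)
    then show ?thesis
      using \<pi>i[OF scalar(2)] tup_comp(2)[of x] scalar(1,3,4) unfolding multilinear_relations_def by blast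
  qed
qed

text \<open>The preimage of \<open>TI\<close> is an ideal that contains the relations, and
  \<open>TI\<close> is the least such ideal.\<close>

lemma coeff_act_TI:
  assumes "c \<in> TI"
  shows "coeff_act \<pi> c \<in> TI"
proof -
  interpret h: ring_hom_cring TA TA "coeff_act \<pi>"
    by unfold_locales (rule coeff_act_hom)
  have "ideal {c \<in> carrier TA. coeff_act \<pi> c \<in> TI} TA"
    using h.ring.ideal_vimage[OF TI_ideal] .
  moreover have "multilinear_relations k L n \<subseteq> {c \<in> carrier TA. coeff_act \<pi> c \<in> TI}"
    using relations_closed relations_in_TI coeff_act_relations by blast
  ultimately have "TI \<subseteq> {c \<in> carrier TA. coeff_act \<pi> c \<in> TI}"
    unfolding tensor_ideal_def by (rule TA.genideal_minimal)
  then show ?thesis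
    using assms by blast
qed

end

text \<open>The elementwise image of a coset is again a coset because \<open>coeff_act \<pi>\<close>
  maps \<open>TI\<close> onto itself; the inverse permutation supplies the preimages.\<close>

lemma tensor_act_proj:
  assumes \<pi>: "\<pi> permutes {1..n}" and c: "c \<in> carrier TA"
  shows "tensor_act \<pi> (proj c) = proj (coeff_act \<pi> c)"
proof -
  have "coeff_act \<pi> ` TI = TI"
  proof (intro equalityI subsetI)
    fix c assume c: "c \<in> TI"
    have "c = coeff_act \<pi> (coeff_act (inv' \<pi>) c)"
      unfolding coeff_act_def by (simp only: comp_inverses[OF \<pi>])
    then show "c \<in> coeff_act \<pi> ` TI"
      using coeff_act_TI[OF permutes_inv[OF \<pi>] c] by (rule image_eqI)
  qed (use coeff_act_TI[OF \<pi>] in blast)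
  then have "proj (coeff_act \<pi> c) = (\<lambda>i. i \<oplus>\<^bsub>TA\<^esub> coeff_act \<pi> c) ` coeff_act \<pi> ` TI"
    by (auto simp: proj_def a_r_coset_def')
  also have "\<dots> = coeff_act \<pi> ` (\<lambda>i. i \<oplus>\<^bsub>TA\<^esub> c) ` TI"
    unfolding image_image by (simp only: coeff_act_def TA_add)
  also have "\<dots> = tensor_act \<pi> (proj c)"
    by (auto simp: proj_def a_r_coset_def' tensor_act_def coeff_act_def)
  finally show ?thesis
    by simp
qed

lemma tensor_act_hom:
  assumes \<pi>: "\<pi> permutes {1..n}"
  shows "tensor_act \<pi> \<in> ring_hom TP TP"
proof -
  interpret h: ring_hom_cring TA TA "coeff_act \<pi>"
    by unfold_locales (rule coeff_act_hom[OF \<pi>])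
  note act = tensor_act_proj[OF \<pi>]
  show ?thesis
  proof (rule ring_hom_memI)
    fix T U assume "T \<in> carrier TP" "U \<in> carrier TP"
    then obtain c d where c: "c \<in> carrier TA" "T = proj c" and d: "d \<in> carrier TA" "U = proj d"
      using TP_E by metis
    show "tensor_act \<pi> T \<in> carrier TP"
      using c act by simp
    show "tensor_act \<pi> (T \<otimes>\<^bsub>TP\<^esub> U) = tensor_act \<pi> T \<otimes>\<^bsub>TP\<^esub> tensor_act \<pi> U"
      using c d act act[OF TA.m_closed[OF c(1) d(1)]] by simp
    show "tensor_act \<pi> (T \<oplus>\<^bsub>TP\<^esub> U) = tensor_act \<pi> T \<oplus>\<^bsub>TP\<^esub> tensor_act \<pi> U"
      using c d act act[OF TA.a_closed[OF c(1) d(1)]] by simp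
  next
    show "tensor_act \<pi> \<one>\<^bsub>TP\<^esub> = \<one>\<^bsub>TP\<^esub>"
      using act[OF TA.one_closed] by simp
  qed
qed

lemma tensor_act_scalar:
  assumes \<pi>: "\<pi> permutes {1..n}" and c: "c \<in> k"
  shows "tensor_act \<pi> (tensor_scalar k L n c) = tensor_scalar k L n c"
  using tensor_act_proj[OF \<pi> single_closed[OF c tone_closed]]
  by (simp only: tensor_scalar_eq coeff_act_single[OF \<pi>] tone_comp[OF \<pi>])

lemma tensor_act_factor_hom:
  assumes \<pi>: "\<pi> permutes {1..n}" and i: "i \<in> {1..n}" and y: "y \<in> carrier L"
  shows "tensor_act \<pi> (factor_hom i y) = factor_hom (\<pi> i) y"
  using tensor_act_proj[OF \<pi> single_closed[OF one_in_k tup_upd[OF tone_closed i y]]]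
  by (simp only: factor_hom_def coeff_act_single[OF \<pi>] upd_comp[OF \<pi>] tone_comp[OF \<pi>])

end

section \<open>The comparison map\<close>

lemma image_eq_singleton: "S \<noteq> {} \<Longrightarrow> (\<And>x. x \<in> S \<Longrightarrow> g x = r) \<Longrightarrow> g ` S = {r}"
  by auto

locale galois_tensor_power = galois_points k L K \<iota>
  for k and L :: "('a, 'm) ring_scheme" (structure) and K :: "('b, 'p) ring_scheme" and \<iota> +
  fixes n :: nat
begin

sublocale TR: tuple_ring k L n
  by unfold_locales

lemma tuple_hom_eq: "tuple_hom L K \<iota> n f c = \<iota>.pairing c (\<lambda>x. \<Otimes>\<^bsub>K\<^esub>i\<in>{1..n}. f i (x i))"
  by (simp add: tuple_hom_def \<iota>.pairing_def)

section \<open>Products of points as homomorphisms on the tensor power\<close>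

context
  fixes f
  assumes f: "f \<in> {1..n} \<rightarrow>\<^sub>E points"
begin

lemma f_point: "i \<in> {1..n} \<Longrightarrow> f i \<in> points"
  using f by (auto simp: PiE_iff)

lemma f_closed: "x \<in> TR.tup \<Longrightarrow> i \<in> {1..n} \<Longrightarrow> f i (x i) \<in> carrier K"
  using f_point by (auto simp: tuples_def PiE_iff)

definition eval_tuple where "eval_tuple x = (\<Otimes>\<^bsub>K\<^esub>i\<in>{1..n}. f i (x i))"

lemma eval_tuple_closed: "x \<in> TR.tup \<Longrightarrow> eval_tuple x \<in> carrier K"
  unfolding eval_tuple_def using f_closed by (intro K.finprod_closed) auto

lemma eval_tuple_mult:
  assumes "x \<in> TR.tup" "y \<in> TR.tup"
  shows "eval_tuple (TR.tmult x y) = eval_tuple x \<otimes>\<^bsub>K\<^esub> eval_tuple y"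
proof -
  have "eval_tuple (TR.tmult x y) = (\<Otimes>\<^bsub>K\<^esub>i\<in>{1..n}. f i (x i) \<otimes>\<^bsub>K\<^esub> f i (y i))"
    unfolding eval_tuple_def
  proof (intro K.finprod_cong' refl)
    fix i assume i: "i \<in> {1..n}"
    interpret fi: ring_hom_cring L K "f i" using point_ring_hom_cring[OF f_point[OF i]] .
    have "x i \<in> carrier L" "y i \<in> carrier L"
      using assms i by (auto simp: tuples_def PiE_iff)
    then show "f i (TR.tmult x y i) = f i (x i) \<otimes>\<^bsub>K\<^esub> f i (y i)"
      using i by (simp add: tuple_mult_def)
  qed (use f_closed assms in auto)
  also have "\<dots> = eval_tuple x \<otimes>\<^bsub>K\<^esub> eval_tuple y"
    unfolding eval_tuple_def using f_closed assms by (intro K.finprod_multf) auto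
  finally show ?thesis .
qed

lemma eval_tuple_one: "eval_tuple TR.tone = \<one>\<^bsub>K\<^esub>"
  unfolding eval_tuple_def
proof (rule K.finprod_one_eqI)
  fix i assume i: "i \<in> {1..n}"
  interpret fi: ring_hom_cring L K "f i" using point_ring_hom_cring[OF f_point[OF i]] .
  show "f i (TR.tone i) = \<one>\<^bsub>K\<^esub>"
    using i by (simp add: tuple_one_def)
qed

text \<open>Isolates the one factor that depends on place \<open>i\<close>, so that multilinearity
  reduces to properties of \<open>f i\<close>.\<close>

lemma eval_tuple_upd:
  assumes x: "x \<in> TR.tup" and i: "i \<in> {1..n}" and a: "a \<in> carrier L"
  shows "eval_tuple (x(i := a)) = f i a \<otimes>\<^bsub>K\<^esub> (\<Otimes>\<^bsub>K\<^esub>j\<in>{1..n} - {i}. f j (x j))"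
proof -
  have "eval_tuple (x(i := a)) = (\<Otimes>\<^bsub>K\<^esub>j\<in>insert i ({1..n} - {i}). f j ((x(i := a)) j))"
    using i by (simp only: eval_tuple_def insert_Diff)
  also have "\<dots> = f i a \<otimes>\<^bsub>K\<^esub> (\<Otimes>\<^bsub>K\<^esub>j\<in>{1..n} - {i}. f j ((x(i := a)) j))"
    using f_closed[OF x] f_point[OF i] a by (subst K.finprod_insert) auto
  also have "(\<Otimes>\<^bsub>K\<^esub>j\<in>{1..n} - {i}. f j ((x(i := a)) j)) = (\<Otimes>\<^bsub>K\<^esub>j\<in>{1..n} - {i}. f j (x j))"
    using f_closed[OF x] by (intro K.finprod_cong') auto
  finally show ?thesis .
qed

lemma tuple_hom_single: "a \<in> k \<Longrightarrow> x \<in> TR.tup \<Longrightarrow> tuple_hom L K \<iota> n f (single L a x) = \<iota> a \<otimes>\<^bsub>K\<^esub> eval_tuple x"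
  unfolding tuple_hom_eq eval_tuple_def[symmetric]
  using k_subset eval_tuple_closed[of x] by (intro \<iota>.pairing_single) auto

text \<open>\<open>pairing_mult\<close> turns the value at a product into a double pairing, which
  factors because \<open>eval_tuple\<close> is multiplicative.\<close>

lemma tuple_hom_hom: "tuple_hom L K \<iota> n f \<in> ring_hom TR.TA K"
proof (rule ring_hom_memI)
  have eq: "tuple_hom L K \<iota> n f c = \<iota>.pairing c eval_tuple" for c
    by (simp add: tuple_hom_eq eval_tuple_def[abs_def])
  fix c d assume c: "c \<in> carrier TR.TA" and d: "d \<in> carrier TR.TA"
  note fs = TR.TA_finitely_supported
  have tup: "x \<in> TR.tup" if "x \<in> supp L c \<or> x \<in> supp L d" for x
    using that TR.TA_supp(2) c d by blast
  have cl: "\<iota>.pairing c eval_tuple \<in> carrier K" "\<iota>.pairing d eval_tuple \<in> carrier K"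
    using fs c d tup eval_tuple_closed by (auto intro!: \<iota>.pairing_closed)
  then show "tuple_hom L K \<iota> n f c \<in> carrier K"
    by (simp add: eq)
  show "tuple_hom L K \<iota> n f (c \<oplus>\<^bsub>TR.TA\<^esub> d) = tuple_hom L K \<iota> n f c \<oplus>\<^bsub>K\<^esub> tuple_hom L K \<iota> n f d"
    unfolding eq TR.TA_add using fs c d tup eval_tuple_closed by (intro \<iota>.pairing_add) auto
  have "tuple_hom L K \<iota> n f (c \<otimes>\<^bsub>TR.TA\<^esub> d) = \<iota>.pairing c (\<lambda>x. \<iota>.pairing d (\<lambda>y. eval_tuple (TR.tmult x y)))"
    unfolding eq using eval_tuple_closed by (intro TR.pairing_mult \<iota>.ring_hom_cring_axioms c d) auto
  also have "\<dots> = \<iota>.pairing c (\<lambda>x. eval_tuple x \<otimes>\<^bsub>K\<^esub> \<iota>.pairing d eval_tuple)"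
  proof (intro \<iota>.pairing_cong fs c)
    fix x assume x: "x \<in> supp L c"
    have "\<iota>.pairing d (\<lambda>y. eval_tuple (TR.tmult x y)) = \<iota>.pairing d (\<lambda>y. eval_tuple y \<otimes>\<^bsub>K\<^esub> eval_tuple x)"
      using x tup eval_tuple_closed eval_tuple_mult
      by (intro \<iota>.pairing_cong fs d) (auto simp: K.m_comm)
    also have "\<dots> = \<iota>.pairing d eval_tuple \<otimes>\<^bsub>K\<^esub> eval_tuple x"
      using x tup eval_tuple_closed by (intro \<iota>.pairing_times fs d) auto
    finally show "\<iota>.pairing d (\<lambda>y. eval_tuple (TR.tmult x y)) = eval_tuple x \<otimes>\<^bsub>K\<^esub> \<iota>.pairing d eval_tuple"
      using cl(2) eval_tuple_closed[of x] tup x by (simp add: K.m_comm)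
  qed (use cl(2) eval_tuple_closed tup in auto)
  also have "\<dots> = \<iota>.pairing c eval_tuple \<otimes>\<^bsub>K\<^esub> \<iota>.pairing d eval_tuple"
    using cl tup eval_tuple_closed by (intro \<iota>.pairing_times fs c) auto
  finally show "tuple_hom L K \<iota> n f (c \<otimes>\<^bsub>TR.TA\<^esub> d) = tuple_hom L K \<iota> n f c \<otimes>\<^bsub>K\<^esub> tuple_hom L K \<iota> n f d"
    by (simp add: eq)
next
  show "tuple_hom L K \<iota> n f \<one>\<^bsub>TR.TA\<^esub> = \<one>\<^bsub>K\<^esub>"
    using tuple_hom_single[OF TR.one_in_k TR.tone_closed] by (simp add: TR.TA_one eval_tuple_one)
qed

text \<open>The kernel is an ideal, so only the relations have to be checked. On these the value
  vanishes because \<open>f i\<close> is additive and \<open>k\<close>-linear.\<close>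

lemma tuple_hom_TI:
  assumes "c \<in> TR.TI"
  shows "tuple_hom L K \<iota> n f c = \<zero>\<^bsub>K\<^esub>"
proof -
  interpret h: ring_hom_cring TR.TA K "tuple_hom L K \<iota> n f"
    by unfold_locales (rule tuple_hom_hom)
  have "ideal (a_kernel TR.TA K (tuple_hom L K \<iota> n f)) TR.TA"
    by (rule h.ring.kernel_is_ideal)
  moreover have "multilinear_relations k L n \<subseteq> a_kernel TR.TA K (tuple_hom L K \<iota> n f)"
  proof
    fix r assume r: "r \<in> multilinear_relations k L n"
    have single: "single L c (x(i := y)) \<in> carrier TR.TA"
        "tuple_hom L K \<iota> n f (single L c (x(i := y))) =
          \<iota> c \<otimes>\<^bsub>K\<^esub> (f i y \<otimes>\<^bsub>K\<^esub> (\<Otimes>\<^bsub>K\<^esub>j\<in>{1..n} - {i}. f j (x j)))"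
      if "c \<in> k" "x \<in> TR.tup" "i \<in> {1..n}" "y \<in> carrier L" for c x i y
      using TR.single_closed[OF that(1) TR.tup_upd[OF that(2-4)]]
        tuple_hom_single[OF that(1) TR.tup_upd[OF that(2-4)]] eval_tuple_upd[OF that(2-4)]
      by (simp_all only:)
    have rest: "(\<Otimes>\<^bsub>K\<^esub>j\<in>{1..n} - {i}. f j (x j)) \<in> carrier K" if "x \<in> TR.tup" for x i
      using f_closed[OF that] by (intro K.finprod_closed) auto
    from r have "tuple_hom L K \<iota> n f r = \<zero>\<^bsub>K\<^esub>"
    proof (cases rule: TR.multilinear_relation_cases)
      case (add x i a b)
      interpret fi: ring_hom_cring L K "f i" using point_ring_hom_cring[OF f_point[OF add(2)]] .
      define p where "p = (\<Otimes>\<^bsub>K\<^esub>j\<in>{1..n} - {i}. f j (x j))"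
      note s = single[OF TR.one_in_k add(1,2), folded p_def]
      have p: "p \<in> carrier K" "f i a \<in> carrier K" "f i b \<in> carrier K"
        using rest[OF add(1)] add(3,4) by (simp_all add: p_def)
      have ab: "a \<oplus> b \<in> carrier L"
        using add(3,4) by simp
      have "tuple_hom L K \<iota> n f r = f i (a \<oplus> b) \<otimes>\<^bsub>K\<^esub> p \<ominus>\<^bsub>K\<^esub> (f i a \<otimes>\<^bsub>K\<^esub> p \<oplus>\<^bsub>K\<^esub> f i b \<otimes>\<^bsub>K\<^esub> p)"
        unfolding add(5) using s(1)[OF ab] s(1)[OF add(3)] s(1)[OF add(4)]
          s(2)[OF ab] s(2)[OF add(3)] s(2)[OF add(4)] p add(3,4)
        by (simp add: h.hom_sub del: fun_upd_apply fi.hom_add)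
      also have "\<dots> = \<zero>\<^bsub>K\<^esub>"
        using p add(3,4) by (simp add: K.l_distr K.r_right_minus_eq)
      finally show ?thesis .
    next
      case (scalar x i a c)
      interpret fi: ring_hom_cring L K "f i" using point_ring_hom_cring[OF f_point[OF scalar(2)]] .
      define p where "p = (\<Otimes>\<^bsub>K\<^esub>j\<in>{1..n} - {i}. f j (x j))"
      have c: "c \<in> carrier L" "f i c = \<iota> c"
        using scalar(4) k_subset f_point[OF scalar(2)] by (auto simp: points_iff)
      have p: "p \<in> carrier K" "f i a \<in> carrier K"
        using rest[OF scalar(1)] scalar(3) by (simp_all add: p_def)
      have ca: "c \<otimes> a \<in> carrier L"
        using c scalar(3) by simp
      note s = single[OF TR.one_in_k scalar(1,2) ca, folded p_def] single[OF scalar(4,1,2,3), folded p_def]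
      have "tuple_hom L K \<iota> n f r = f i (c \<otimes> a) \<otimes>\<^bsub>K\<^esub> p \<ominus>\<^bsub>K\<^esub> \<iota> c \<otimes>\<^bsub>K\<^esub> (f i a \<otimes>\<^bsub>K\<^esub> p)"
        unfolding scalar(5) using s p c(1) scalar(3)
        by (simp add: h.hom_sub del: fun_upd_apply fi.hom_mult)
      also have "\<dots> = \<zero>\<^bsub>K\<^esub>"
        using p c scalar(3) by (simp add: K.m_assoc K.r_right_minus_eq)
      finally show ?thesis .
    qed
    then show "r \<in> a_kernel TR.TA K (tuple_hom L K \<iota> n f)"
      unfolding a_kernel_def' using r TR.relations_closed by blast
  qed
  ultimately have "TR.TI \<subseteq> a_kernel TR.TA K (tuple_hom L K \<iota> n f)"
    unfolding tensor_ideal_def by (rule TR.TA.genideal_minimal)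
  then show ?thesis
    using assms unfolding a_kernel_def' by blast
qed

text \<open>\<open>tuple_hom\<close> is constant on the coset, so \<open>the_elem\<close> is applied
  to a singleton.\<close>

lemma tensor_hom_proj:
  assumes c: "c \<in> carrier TR.TA"
  shows "tensor_hom L K \<iota> n f (TR.proj c) = tuple_hom L K \<iota> n f c"
proof -
  interpret h: ring_hom_cring TR.TA K "tuple_hom L K \<iota> n f"
    by unfold_locales (rule tuple_hom_hom)
  have "tuple_hom L K \<iota> n f (i \<oplus>\<^bsub>TR.TA\<^esub> c) = tuple_hom L K \<iota> n f c" if "i \<in> TR.TI" for i
    using that c tuple_hom_TI[OF that] TR.TI.Icarr by simp
  moreover have "TR.TI \<noteq> {}"
    using TR.TI.zero_closed by blast
  ultimately have "(\<lambda>i. tuple_hom L K \<iota> n f (i \<oplus>\<^bsub>TR.TA\<^esub> c)) ` TR.TI = {tuple_hom L K \<iota> n f c}"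
    by (intro image_eq_singleton)
  moreover have "TR.proj c = (\<lambda>i. i \<oplus>\<^bsub>TR.TA\<^esub> c) ` TR.TI"
    by (auto simp: TR.proj_def a_r_coset_def')
  ultimately show ?thesis
    by (simp only: tensor_hom_def image_image the_elem_eq)
qed

lemma tensor_hom_hom: "tensor_hom L K \<iota> n f \<in> ring_hom TR.TP K"
proof -
  interpret h: ring_hom_cring TR.TA K "tuple_hom L K \<iota> n f"
    by unfold_locales (rule tuple_hom_hom)
  note th = tensor_hom_proj
  show ?thesis
  proof (rule ring_hom_memI)
    fix T U assume "T \<in> carrier TR.TP" "U \<in> carrier TR.TP"
    then obtain c d where c: "c \<in> carrier TR.TA" "T = TR.proj c" and d: "d \<in> carrier TR.TA" "U = TR.proj d"
      using TR.TP_E by metis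
    show "tensor_hom L K \<iota> n f T \<in> carrier K"
      using c th by simp
    show "tensor_hom L K \<iota> n f (T \<otimes>\<^bsub>TR.TP\<^esub> U) = tensor_hom L K \<iota> n f T \<otimes>\<^bsub>K\<^esub> tensor_hom L K \<iota> n f U"
      using c d th th[OF TR.TA.m_closed[OF c(1) d(1)]] by simp
    show "tensor_hom L K \<iota> n f (T \<oplus>\<^bsub>TR.TP\<^esub> U) = tensor_hom L K \<iota> n f T \<oplus>\<^bsub>K\<^esub> tensor_hom L K \<iota> n f U"
      using c d th th[OF TR.TA.a_closed[OF c(1) d(1)]] by simp
  next
    show "tensor_hom L K \<iota> n f \<one>\<^bsub>TR.TP\<^esub> = \<one>\<^bsub>K\<^esub>"
      using th[OF TR.TA.one_closed] by simp
  qed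
qed

lemma tensor_hom_scalar: "c \<in> k \<Longrightarrow> tensor_hom L K \<iota> n f (tensor_scalar k L n c) = \<iota> c"
  using tensor_hom_proj[OF TR.single_closed] tuple_hom_single[OF _ TR.tone_closed] k_subset
  by (auto simp: TR.tensor_scalar_eq eval_tuple_one)

lemma tensor_hom_factor:
  assumes i: "i \<in> {1..n}" and y: "y \<in> carrier L"
  shows "tensor_hom L K \<iota> n f (TR.factor_hom i y) = f i y"
proof -
  have "(\<Otimes>\<^bsub>K\<^esub>j\<in>{1..n} - {i}. f j (TR.tone j)) = \<one>\<^bsub>K\<^esub>"
  proof (rule K.finprod_one_eqI)
    fix j assume "j \<in> {1..n} - {i}"
    then have j: "j \<in> {1..n}" by blast
    interpret fj: ring_hom_cring L K "f j" using point_ring_hom_cring[OF f_point[OF j]] .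
    show "f j (TR.tone j) = \<one>\<^bsub>K\<^esub>"
      using j by (simp add: tuple_one_def)
  qed
  then have "eval_tuple (TR.tone(i := y)) = f i y"
    using eval_tuple_upd[OF TR.tone_closed i y] f_point[OF i] y by simp
  moreover note up = TR.tup_upd[OF TR.tone_closed i y]
  ultimately have "tuple_hom L K \<iota> n f (single L \<one> (TR.tone(i := y))) = f i y"
    using tuple_hom_single[OF TR.one_in_k up] f_point[OF i] y by simp
  then show ?thesis
    using tensor_hom_proj[OF TR.single_closed[OF TR.one_in_k up]] by (simp only: TR.factor_hom_def)
qed

end

text \<open>The concrete tensor power satisfies the abstract assumptions, for \<open>n = 0\<close>
  with empty index set, so the description of the points of the invariants applies to it.\<close>

sublocale tensor_points k L K \<iota> "tensor_power k L n" "{1..n}" "tensor_scalar k L n" TR.factor_hom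
  tensor_act "tensor_hom L K \<iota> n"
proof unfold_locales
  fix b assume "b \<in> carrier TR.TP"
  then show "\<exists>A c. finite A \<and> A \<subseteq> ({1..n} \<rightarrow>\<^sub>E carrier L) \<and> c \<in> A \<rightarrow> k \<and>
    b = (\<Oplus>\<^bsub>TR.TP\<^esub>x\<in>A. tensor_scalar k L n (c x) \<otimes>\<^bsub>TR.TP\<^esub> (\<Otimes>\<^bsub>TR.TP\<^esub>i\<in>{1..n}. TR.factor_hom i (x i)))"
    by (rule TR.TP_generated)
qed (rule finite_atLeastAtMost TR.tensor_scalar_hom TR.factor_hom_hom TR.factor_hom_scalar tensor_hom_hom
    tensor_hom_scalar tensor_hom_factor TR.tensor_act_hom TR.tensor_act_scalar TR.tensor_act_factor_hom; assumption)+

lemma symmetric_tensors_eq: "symmetric_tensors k L n = TR.TP\<lparr>carrier := invariants\<rparr>"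
proof -
  have "{T \<in> carrier TR.TP. \<forall>\<pi>\<in>carrier (sym_group n). tensor_act \<pi> T = T} = invariants"
    unfolding invariants_def sym_group_def by auto
  then show ?thesis
    by (simp only: symmetric_tensors_def)
qed

text \<open>Well-definedness of the comparison map: the members of an orbit agree on invariants, so
  the image in the definition of \<open>theta\<close> is a singleton.\<close>

lemma theta_orbit:
  assumes f: "f \<in> {1..n} \<rightarrow>\<^sub>E points"
  shows "theta k L K \<iota> n {f \<circ> inv' \<pi> | \<pi>. \<pi> permutes {1..n}} = restrict (tensor_hom L K \<iota> n f) invariants"
proof -
  have "restrict (tensor_hom L K \<iota> n (f \<circ> inv' \<pi>)) invariants = restrict (tensor_hom L K \<iota> n f) invariants"
    if "\<pi> permutes {1..n}" for \<pi>
    by (rule restrict_ext) (rule \<phi>_invariants[OF f permutes_inv[OF that]])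
  moreover have "{f \<circ> inv' \<pi> | \<pi>. \<pi> permutes {1..n}} \<noteq> {}"
    using permutes_id by blast
  ultimately have "(\<lambda>f. restrict (tensor_hom L K \<iota> n f) invariants) ` {f \<circ> inv' \<pi> | \<pi>. \<pi> permutes {1..n}} =
      {restrict (tensor_hom L K \<iota> n f) invariants}"
    by (intro image_eq_singleton) blast+
  moreover have "carrier (TR.TP\<lparr>carrier := invariants\<rparr>) = invariants"
    by simp
  ultimately show ?thesis
    unfolding theta_def symmetric_tensors_eq by (simp only: the_elem_eq)
qed

lemma bij_betw_theta:
  "bij_betw (theta k L K \<iota> n) (categoric_sym_power k L K \<iota> n) (geometric_sym_power k L K \<iota> n)"
proof -
  let ?C = "\<lambda>f. {f \<circ> inv' \<pi> | \<pi>. \<pi> permutes {1..n}}"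
  have cat: "categoric_sym_power k L K \<iota> n = ?C ` ({1..n} \<rightarrow>\<^sub>E points)"
    unfolding categoric_sym_power_def orbits_def orbit_def points_def sym_group_def by auto
  have geo: "\<chi> \<in> geometric_sym_power k L K \<iota> n \<longleftrightarrow> \<chi> \<in> ring_hom (TR.TP\<lparr>carrier := invariants\<rparr>) K \<and>
      \<chi> \<in> extensional invariants \<and> (\<forall>c\<in>k. \<chi> (tensor_scalar k L n c) = \<iota> c)" for \<chi>
    unfolding geometric_sym_power_def alg_homs_def symmetric_tensors_eq by auto
  show ?thesis
    unfolding bij_betw_def
  proof
    show "inj_on (theta k L K \<iota> n) (categoric_sym_power k L K \<iota> n)"
    proof (rule inj_onI)
      fix F G assume FG: "F \<in> categoric_sym_power k L K \<iota> n" "G \<in> categoric_sym_power k L K \<iota> n"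
        and eq: "theta k L K \<iota> n F = theta k L K \<iota> n G"
      obtain f where f: "f \<in> {1..n} \<rightarrow>\<^sub>E points" "F = ?C f"
        using FG(1) cat by blast
      obtain g where g: "g \<in> {1..n} \<rightarrow>\<^sub>E points" "G = ?C g"
        using FG(2) cat by blast
      have "restrict (tensor_hom L K \<iota> n f) invariants = restrict (tensor_hom L K \<iota> n g) invariants"
        using eq theta_orbit f g by simp
      then have "tensor_hom L K \<iota> n f b = tensor_hom L K \<iota> n g b" if "b \<in> invariants" for b
        using that by (metis restrict_apply')
      then obtain \<pi> where \<pi>: "\<pi> permutes {1..n}" "g = f \<circ> \<pi>"
        using points_of_invariants(1)[OF f(1) g(1)] by blast
      \<comment> \<open>The classes are sets of all \<open>f \<circ> inv' \<rho>\<close>;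
        translation by \<open>\<pi>\<close> permutes the possible \<open>\<rho>\<close>, so the two
        representatives have the same class.\<close>
      have "?C (f \<circ> \<pi>) = ?C f"
      proof (intro equalityI subsetI)
        fix h assume "h \<in> ?C (f \<circ> \<pi>)"
        then obtain \<rho> where \<rho>: "\<rho> permutes {1..n}" "h = f \<circ> \<pi> \<circ> inv' \<rho>"
          by blast
        have "h = f \<circ> inv' (\<rho> \<circ> inv' \<pi>)"
          using o_inv_distrib[OF permutes_bij[OF \<rho>(1)] permutes_bij[OF permutes_inv[OF \<pi>(1)]]]
          by (simp only: \<rho>(2) permutes_inv_inv[OF \<pi>(1)] o_assoc)
        then show "h \<in> ?C f"
          using permutes_compose[OF permutes_inv[OF \<pi>(1)] \<rho>(1)] by blast
      next
        fix h assume "h \<in> ?C f"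
        then obtain \<rho> where \<rho>: "\<rho> permutes {1..n}" "h = f \<circ> inv' \<rho>"
          by blast
        have "h = f \<circ> \<pi> \<circ> inv' (\<rho> \<circ> \<pi>)"
          using o_inv_distrib[OF permutes_bij[OF \<rho>(1)] permutes_bij[OF \<pi>(1)]] permutes_inv_o(1)[OF \<pi>(1)]
          by (metis \<rho>(2) comp_id o_assoc)
        then show "h \<in> ?C (f \<circ> \<pi>)"
          using permutes_compose[OF \<pi>(1) \<rho>(1)] by blast
      qed
      then show "F = G"
        using f g \<pi> by simp
    qed
    show "theta k L K \<iota> n ` categoric_sym_power k L K \<iota> n = geometric_sym_power k L K \<iota> n"
    proof (intro equalityI subsetI)
      fix \<chi> assume "\<chi> \<in> theta k L K \<iota> n ` categoric_sym_power k L K \<iota> n"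
      then obtain f where f: "f \<in> {1..n} \<rightarrow>\<^sub>E points"
        and \<chi>: "\<chi> = restrict (tensor_hom L K \<iota> n f) invariants"
        using cat theta_orbit by auto
      have "\<chi> \<in> ring_hom (TR.TP\<lparr>carrier := invariants\<rparr>) K"
        using \<phi>_hom[OF f] subringE[OF subring_invariants]
        unfolding \<chi> ring_hom_def by (auto simp: Pi_iff subset_iff)
      then show "\<chi> \<in> geometric_sym_power k L K \<iota> n"
        using tensor_hom_scalar[OF f] s_in_invariants by (simp add: geo \<chi>)
    next
      fix \<chi> assume "\<chi> \<in> geometric_sym_power k L K \<iota> n"
      then have \<chi>: "\<chi> \<in> ring_hom (TR.TP\<lparr>carrier := invariants\<rparr>) K" "\<chi> \<in> extensional invariants"
          "\<And>c. c \<in> k \<Longrightarrow> \<chi> (tensor_scalar k L n c) = \<iota> c"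
        by (auto simp: geo)
      then obtain f where f: "f \<in> {1..n} \<rightarrow>\<^sub>E points" "\<forall>b\<in>invariants. \<chi> b = tensor_hom L K \<iota> n f b"
        using points_of_invariants(2) by blast
      \<comment> \<open>\<open>\<chi>\<close> is extensional, so agreement on the invariants is
        equality of functions.\<close>
      then have "\<chi> = restrict (tensor_hom L K \<iota> n f) invariants"
        using \<chi>(2) by (intro extensionalityI[of _ invariants]) auto
      then have "\<chi> = theta k L K \<iota> n (?C f)"
        using theta_orbit[OF f(1)] by simp
      then show "\<chi> \<in> theta k L K \<iota> n ` categoric_sym_power k L K \<iota> n"
        using f(1) cat by blast
    qed
  qed
qed

end

theorem proposition100:
  fixes k :: "'a set"
    and L :: "('a, 'm) ring_scheme"
    and K :: "('b, 'p) ring_scheme"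
    and \<iota> :: "'a \<Rightarrow> 'b"
    and n :: nat
  assumes "finite_galois_extension k L"
    and "algebraically_closed K"
    and "\<iota> \<in> ring_hom L K"
  shows "bij_betw (theta k L K \<iota> n)
           (categoric_sym_power k L K \<iota> n) (geometric_sym_power k L K \<iota> n)"
proof -
  interpret galois_tensor_power k L K \<iota> n
    using assms by (intro galois_tensor_power.intro galois_points.intro galois_points_axioms.intro)
  show ?thesis
    by (rule bij_betw_theta)
qed

end
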